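(* Let $D_e>0$, $\mathrm{Pe}=0$ and $m>0$. Then the stationary solution $f_\infty$ of $$0=D_e\,\mathrm{div}\big((1-\rho_\infty)\nabla f_\infty+f_\infty\nabla\rho_\infty\big)+\partial_\theta^2f_\infty,\qquad \rho_\infty(x)=\int_0^{2\pi}f_\infty(x,\theta)\,d\theta,$$ with periodic boundary conditions on $\Upsilon$, is unique within the class $\int_\Upsilon f_\infty\,d\xi=m$; that is, any two stationary solutions of total mass $m$ coincide a.e. in $\Upsilon$.
   Context: $\Omega=(0,2\pi)^2$ (space variable $x$), $\Upsilon=\Omega\times(0,2\pi)$ (variable $\xi=(x,\theta)$); $\mathrm{div},\nabla$ act in $x$ only. The subscript "per" denotes $2\pi$-periodicity in every coordinate. A stationary solution is a time-independent weak solution: $f_\infty\in L^3_{\mathrm{per}}(\Upsilon)$ with $f_\infty\ge0$ a.e., $\rho_\infty\in[0,1]$ a.e., $\partial_\theta\sqrt{f_\infty}\in L^2(\Upsilon)$, $\nabla\sqrt{1-\rho_\infty}\in L^2(\Omega)$, $\sqrt{1-\rho_\infty}\,\nabla\sqrt{f_\infty}\in L^2(\Upsilon)$ (in the product-rule sense $\nabla(\sqrt{1-\rho_\infty}\sqrt{f_\infty})-\sqrt{f_\infty}\,\nabla\sqrt{1-\rho_\infty}$), such that for all $\psi\in W^{1,6}_{\mathrm{per}}(\Upsilon)$ $$\int_{\Upsilon}\Big(D_e\big((1-\rho_\infty)\nabla f_\infty+f_\infty\nabla\rho_\infty\big)\cdot\nabla\psi+\partial_\theta f_\infty\,\partial_\theta\psi\Big)d\xi=0,$$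 where $(1-\rho_\infty)\nabla f_\infty=2\sqrt{1-\rho_\infty}\sqrt{f_\infty}\,(\sqrt{1-\rho_\infty}\,\nabla\sqrt{f_\infty})$, $f_\infty\nabla\rho_\infty=-2f_\infty\sqrt{1-\rho_\infty}\,\nabla\sqrt{1-\rho_\infty}$, $\partial_\theta f_\infty=2\sqrt{f_\infty}\,\partial_\theta\sqrt{f_\infty}$. *)

theory Defs
  imports "HOL-Analysis.Analysis"
begin

type_synonym space = "real ^ 2"
type_synonym phase = "space \<times> real"

definition Omega :: "space set" where
  "Omega = {x. \<forall>i. 0 < x $ i \<and> x $ i < 2 * pi}"

definition Upsilon :: "phase set" where
  "Upsilon = Omega \<times> {0<..<2 * pi}"

text \<open>
  Periodic functions are functions on the whole space, and all weak derivatives below are taken on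
  the whole space. For a periodic function this gives the weak derivative on the torus; weak
  derivatives in the open cell alone would ignore jumps across its faces.
\<close>

definition periodic :: "('a::euclidean_space \<Rightarrow> real) \<Rightarrow> bool" where
  "periodic u \<longleftrightarrow> (\<forall>b\<in>Basis. AE x in lebesgue. u (x + (2 * pi) *\<^sub>R b) = u x)"

definition in_Lp :: "nat \<Rightarrow> 'a::euclidean_space set \<Rightarrow> ('a \<Rightarrow> 'b::euclidean_space) \<Rightarrow> bool" where
  "in_Lp p S u \<longleftrightarrow> u \<in> borel_measurable (lebesgue_on S) \<and>
     integrable (lebesgue_on S) (\<lambda>x. norm (u x) ^ p)"

definition locally_integrable :: "('a::euclidean_space \<Rightarrow> real) \<Rightarrow> bool" where
  "locally_integrable u \<longleftrightarrow> (\<forall>K. compact K \<longrightarrow> integrable (lebesgue_on K) u)"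

text \<open>\<open>Ck k\<close> is the class of \<open>k\<close> times continuously differentiable functions.\<close>

primrec Ck :: "nat \<Rightarrow> ('a::euclidean_space \<Rightarrow> real) \<Rightarrow> bool" where
  "Ck 0 \<phi> \<longleftrightarrow> continuous_on UNIV \<phi>"
| "Ck (Suc k) \<phi> \<longleftrightarrow> (\<forall>x. \<phi> differentiable (at x)) \<and>
     (\<forall>b\<in>Basis. Ck k (\<lambda>x. frechet_derivative \<phi> (at x) b))"

definition test_function :: "('a::euclidean_space \<Rightarrow> real) \<Rightarrow> bool" where
  "test_function \<phi> \<longleftrightarrow> (\<forall>k. Ck k \<phi>) \<and> compact (closure {x. \<phi> x \<noteq> 0})"

text \<open>\<open>v\<close> is the weak derivative of \<open>u\<close> in direction \<open>e\<close>.\<close>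

definition has_weak_deriv ::
    "'a::euclidean_space \<Rightarrow> ('a \<Rightarrow> real) \<Rightarrow> ('a \<Rightarrow> real) \<Rightarrow> bool" where
  "has_weak_deriv e u v \<longleftrightarrow> locally_integrable u \<and> locally_integrable v \<and>
     (\<forall>\<phi>. test_function \<phi> \<longrightarrow>
        (LINT x|lebesgue. u x * frechet_derivative \<phi> (at x) e) = - (LINT x|lebesgue. v x * \<phi> x))"

definition has_weak_grad :: "(space \<Rightarrow> real) \<Rightarrow> (space \<Rightarrow> space) \<Rightarrow> bool" where
  "has_weak_grad u G \<longleftrightarrow> (\<forall>i. has_weak_deriv (axis i 1) u (\<lambda>x. G x $ i))"

definition has_weak_grad_x :: "(phase \<Rightarrow> real) \<Rightarrow> (phase \<Rightarrow> space) \<Rightarrow> bool" where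
  "has_weak_grad_x u G \<longleftrightarrow> (\<forall>i. has_weak_deriv (axis i 1, 0) u (\<lambda>\<xi>. G \<xi> $ i))"

definition has_weak_deriv_theta :: "(phase \<Rightarrow> real) \<Rightarrow> (phase \<Rightarrow> real) \<Rightarrow> bool" where
  "has_weak_deriv_theta u v \<longleftrightarrow> has_weak_deriv (0, 1) u v"

text \<open>\<open>\<psi>\<close> belongs to the periodic Sobolev space of order 1 and exponent \<open>p\<close>, with
  \<open>x\<close>-gradient \<open>G\<close> and \<open>\<theta>\<close>-derivative \<open>d\<close>.\<close>

definition in_W1p_per ::
    "nat \<Rightarrow> (phase \<Rightarrow> real) \<Rightarrow> (phase \<Rightarrow> space) \<Rightarrow> (phase \<Rightarrow> real) \<Rightarrow> bool" where
  "in_W1p_per p \<psi> G d \<longleftrightarrow> periodic \<psi> \<and> has_weak_grad_x \<psi> G \<and> has_weak_deriv_theta \<psi> d \<and>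
     in_Lp p Upsilon \<psi> \<and> in_Lp p Upsilon G \<and> in_Lp p Upsilon d"

definition theta_density :: "(phase \<Rightarrow> real) \<Rightarrow> space \<Rightarrow> real" where
  "theta_density f x = (LINT \<theta>:{0..2 * pi}|lebesgue. f (x, \<theta>))"

definition mass :: "(phase \<Rightarrow> real) \<Rightarrow> real" where
  "mass f = (LINT \<xi>:Upsilon|lebesgue. f \<xi>)"

text \<open>
  Writing \<open>g = sqrt f\<close>, \<open>s = sqrt (1 - \<rho>)\<close>, the functions \<open>dg\<close>, \<open>Ds\<close>, \<open>W\<close> are
  \<open>\<partial>\<^sub>\<theta> g\<close>, \<open>\<nabla>s\<close>, \<open>\<nabla>(s g)\<close> (each unique up to null sets), and
  \<open>V = W - g Ds\<close> is the meaning of \<open>s \<nabla>g\<close>; the gradient of \<open>g\<close> itself need not exist where \<open>s = 0\<close>.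
  The integrand of the weak equation is integrable by Hoelder's inequality.
\<close>

definition stationary_solution :: "real \<Rightarrow> (phase \<Rightarrow> real) \<Rightarrow> bool" where
  "stationary_solution De f \<longleftrightarrow>
     (let \<rho> = theta_density f; g = (\<lambda>\<xi>. sqrt (f \<xi>)); s = (\<lambda>x. sqrt (1 - \<rho> x)) in
      periodic f \<and> in_Lp 3 Upsilon f \<and>
      (AE \<xi> in lebesgue. 0 \<le> f \<xi>) \<and> (AE x in lebesgue. \<rho> x \<in> {0..1}) \<and>
      (\<exists>dg Ds W.
         has_weak_deriv_theta g dg \<and> in_Lp 2 Upsilon dg \<and>
         has_weak_grad s Ds \<and> in_Lp 2 Omega Ds \<and>
         has_weak_grad_x (\<lambda>\<xi>. s (fst \<xi>) * g \<xi>) W \<and>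
         (let V = (\<lambda>\<xi>. W \<xi> - g \<xi> *\<^sub>R Ds (fst \<xi>)) in
            in_Lp 2 Upsilon V \<and>
            (\<forall>\<psi> G d. in_W1p_per 6 \<psi> G d \<longrightarrow>
               (LINT \<xi>:Upsilon|lebesgue.
                  (De *\<^sub>R ((2 * s (fst \<xi>) * g \<xi>) *\<^sub>R V \<xi>
                         + (- 2 * f \<xi> * s (fst \<xi>)) *\<^sub>R Ds (fst \<xi>))) \<bullet> G \<xi>
                  + (2 * g \<xi> * dg \<xi>) * d \<xi>) = 0))))"

end

theory Submission
  imports Defs
begin

text \<open>
  Every stationary solution is constant, so the mass determines it. Write \<open>g = sqrt f\<close> and
  \<open>s = sqrt (1 - \<rho>)\<close>. Testing with trigonometric functions of \<open>x\<close> alone, the chain rule for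
  squares turns the flux into \<open>-2 s \<nabla>s = \<nabla>\<rho>\<close>; hence all Fourier coefficients of \<open>s\<^sup>2\<close> at
  nonzero frequencies vanish and \<open>s\<close> is constant. The equation then has constant coefficients
  and forces \<open>(De s\<^sup>2 |k\<^sub>x|\<^sup>2 + k\<^sub>\<theta>\<^sup>2) f\<^sub>k = 0\<close> for the Fourier coefficients of \<open>f\<close>. The frequencies with
  \<open>k\<^sub>\<theta> = 0\<close>, for which this says nothing when \<open>s = 0\<close>, are those of the constant \<open>\<rho>\<close>.

  The chain rule for the square of a periodic \<open>W\<^sup>1\<^sup>,\<^sup>2\<close> function is obtained by passing to the limit
  in the Fourier partial sums, which commute with differentiation.
\<close>

section \<open>Smooth functions and cutoffs\<close>

text \<open>The obstacle is that \<open>g\<close> need not have an x-gradient of its own where s =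
  0, so f can only be differentiated inside products with s. Since V = W - g \<nabla>s, the x-flux 2
  s g V - 2 f s \<nabla>s equals \<nabla>((s g)^2) - 4 f s \<nabla>s, in which only the square of s
  g is differentiated. Integrated over the angle, f becomes 1 - s^2 and the flux becomes
  \<nabla>(s^2 - s^4) - \<nabla>(2 s^2 - s^4) = -\<nabla>(s^2); this cancellation is what makes the
  equation for \<rho> linear. All nonlinear terms reduce to squares, of g, s, s^2 and s g, so the
  chain rule for squares is the whole nonlinear calculus.

  A second gap lies between the definitions and Fourier series: weak derivatives are tested on the
  whole space against functions of compact support, whereas exponentials are periodic. A smooth
  function whose translates by periods sum to 1 bridges it.\<close>

lemma Ck_Suc_imp: "Ck (Suc k) \<phi> \<Longrightarrow> Ck k \<phi>"
proof (induct k arbitrary: \<phi>)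
  case 0
  then show ?case
    by (auto simp: continuous_on_eq_continuous_within differentiable_imp_continuous_within)
next
  case (Suc k)
  then show ?case by (metis Ck.simps(2))
qed

lemma Ck_const [intro]: "Ck k (\<lambda>x. c)"
  by (induct k arbitrary: c) auto

lemma Ck_add [intro]: "Ck k f \<Longrightarrow> Ck k g \<Longrightarrow> Ck k (\<lambda>x. f x + g x)"
proof (induct k arbitrary: f g)
  case 0
  then show ?case by (auto intro: continuous_intros)
next
  case (Suc k)
  have "frechet_derivative (\<lambda>x. f x + g x) (at x) =
      (\<lambda>b. frechet_derivative f (at x) b + frechet_derivative g (at x) b)" for x
    using Suc.prems
    by (intro frechet_derivative_at[symmetric] has_derivative_add)
      (auto simp: frechet_derivative_works)
  with Suc show ?case by (auto intro: differentiable_add)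
qed

lemma Ck_mult [intro]: "Ck k f \<Longrightarrow> Ck k g \<Longrightarrow> Ck k (\<lambda>x. f x * g x)"
proof (induct k arbitrary: f g)
  case 0
  then show ?case by (auto intro: continuous_intros)
next
  case (Suc k)
  have eq: "frechet_derivative (\<lambda>x. f x * g x) (at x) =
      (\<lambda>b. f x * frechet_derivative g (at x) b + frechet_derivative f (at x) b * g x)" for x
    using Suc.prems
    by (intro frechet_derivative_at[symmetric] has_derivative_mult)
      (auto simp: frechet_derivative_works)
  have "Ck k f" "Ck k g" using Suc.prems Ck_Suc_imp by blast+
  with Suc show ?case unfolding Ck.simps eq by (auto intro!: Ck_add differentiable_mult)
qed

lemma Ck_minus [intro]: "Ck k f \<Longrightarrow> Ck k (\<lambda>x. - f x)"
  using Ck_mult[OF Ck_const[of k "-1"]] by simp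

lemma Ck_prod [intro]: "(\<And>i. i \<in> I \<Longrightarrow> Ck k (f i)) \<Longrightarrow> Ck k (\<lambda>x. \<Prod>i\<in>I. f i x)"
  by (induct I rule: infinite_finite_induct) auto

text \<open>The derivative of 1/f contains 1/f again, so the induction keeps \<open>f\<close> fixed
  and feeds the class of 1/f back into the product rule.\<close>

lemma Ck_inverse:
  assumes "Ck k f" "\<And>x. f x \<noteq> 0"
  shows "Ck k (\<lambda>x. inverse (f x))"
  using assms(1)
proof (induct k)
  case 0
  then show ?case using assms(2) by (auto intro!: continuous_intros)
next
  case (Suc k)
  have eq: "frechet_derivative (\<lambda>x. inverse (f x)) (at x) =
      (\<lambda>b. - (inverse (f x) * frechet_derivative f (at x) b * inverse (f x)))" for x
    using Suc.prems assms(2)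
    by (intro frechet_derivative_at[symmetric] Deriv.has_derivative_inverse)
      (auto simp: frechet_derivative_works)
  have "Ck k (\<lambda>x. inverse (f x))" using Suc Ck_Suc_imp by blast
  with Suc.prems assms(2) show ?case
    unfolding Ck.simps eq by (auto intro!: Ck_minus Ck_mult differentiable_inverse)
qed

lemma Ck_Suc_real:
  fixes h h' :: "real \<Rightarrow> real"
  assumes "\<And>t. (h has_real_derivative h' t) (at t)" "Ck k h'"
  shows "Ck (Suc k) h"
proof -
  have "frechet_derivative h (at x) = (\<lambda>b. h' x * b)" for x
    using assms(1) by (intro frechet_derivative_at[symmetric]) (simp add: has_field_derivative_def)
  moreover have "h differentiable (at x)" for x
    using assms(1) unfolding differentiable_def has_field_derivative_def by blast
  ultimately show ?thesis using assms(2) by simp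
qed

text \<open>The derivative is expressed through \<open>frechet_derivative h (at t) 1\<close> because
  this is the function of \<open>t\<close> that \<open>Ck (Suc k) h\<close> controls;
  \<open>Ck_inner_comp\<close> can then apply its induction hypothesis to it.\<close>

lemma frechet_derivative_inner_comp:
  fixes h :: "real \<Rightarrow> real" and a :: "'a::euclidean_space"
  assumes "\<And>t. h differentiable (at t)"
  shows "((\<lambda>x. h (a \<bullet> x + c)) has_derivative
      (\<lambda>b. (a \<bullet> b) * frechet_derivative h (at (a \<bullet> x + c)) 1)) (at x)"
proof -
  have 1: "((\<lambda>x. a \<bullet> x + c) has_derivative (\<lambda>b. a \<bullet> b)) (at x)"
    by (auto intro!: derivative_eq_intros)
  have 2: "(h has_derivative frechet_derivative h (at (a \<bullet> x + c))) (at (a \<bullet> x + c))"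
    using assms frechet_derivative_works by blast
  have "frechet_derivative h (at (a \<bullet> x + c)) r = r * frechet_derivative h (at (a \<bullet> x + c)) 1" for r
    using linear_scale[OF linear_frechet_derivative[OF assms], of _ r 1] by simp
  then have "frechet_derivative h (at (a \<bullet> x + c)) \<circ> (\<lambda>b. a \<bullet> b) =
      (\<lambda>b. (a \<bullet> b) * frechet_derivative h (at (a \<bullet> x + c)) 1)"
    unfolding o_def by (intro ext)
  then show ?thesis using diff_chain_at[OF 1 2] by (simp add: o_def)
qed

lemma Ck_inner_comp:
  fixes h :: "real \<Rightarrow> real" and a :: "'a::euclidean_space"
  shows "Ck k h \<Longrightarrow> Ck k (\<lambda>x. h (a \<bullet> x + c))"
proof (induct k arbitrary: h)
  case 0
  then show ?case
    by (auto intro!: continuous_intros continuous_on_compose2[of UNIV h])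
next
  case (Suc k)
  from Suc.prems have d: "\<And>t. h differentiable (at t)" by simp
  note D = frechet_derivative_inner_comp[OF d]
  show ?case using Suc
    by (auto simp: differentiable_def frechet_derivative_at[OF D, symmetric] intro: D)
qed

lemma frechet_derivative_translate:
  assumes "\<And>x. \<phi> differentiable (at x)"
  shows "((\<lambda>x. \<phi> (x + a)) has_derivative frechet_derivative \<phi> (at (x + a))) (at x)"
proof -
  have 1: "((\<lambda>x. x + a) has_derivative (\<lambda>b. b)) (at x)"
    by (auto intro!: derivative_eq_intros)
  show ?thesis
    using diff_chain_at[OF 1, of \<phi> "frechet_derivative \<phi> (at (x + a))"] assms
    by (simp add: o_def frechet_derivative_works)
qed

lemma Ck_translate: "Ck k \<phi> \<Longrightarrow> Ck k (\<lambda>x. \<phi> (x + a))"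
proof (induct k arbitrary: \<phi>)
  case 0
  then show ?case
    by (auto intro!: continuous_intros continuous_on_compose2[of UNIV \<phi>])
next
  case (Suc k)
  from Suc.prems have d: "\<And>t. \<phi> differentiable (at t)" by simp
  note D = frechet_derivative_translate[OF d]
  show ?case using Suc
    by (auto simp: differentiable_def frechet_derivative_at[OF D, symmetric] intro: D)
qed

text \<open>For \<open>P = 1\<close> this is the classical smooth function that is not analytic at
  0. The polynomial factor makes the family closed under differentiation, so smoothness follows by
  one induction over all \<open>P\<close>.\<close>

definition flat :: "real poly \<Rightarrow> real \<Rightarrow> real" where
  "flat P t = (if t > 0 then poly P (1 / t) * exp (- 1 / t) else 0)"

lemma poly_exp_tendsto: "((\<lambda>y. poly P y * exp (- y)) \<longlongrightarrow> 0) at_top" for P :: "real poly"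
proof -
  have "((\<lambda>y::real. \<Sum>i\<le>degree P. coeff P i * (y ^ i / exp y)) \<longlongrightarrow>
      (\<Sum>i\<le>degree P. coeff P i * 0)) at_top"
    by (intro tendsto_intros tendsto_power_div_exp_0)
  then show ?thesis
    by (simp add: poly_altdef sum_distrib_right exp_minus divide_inverse mult.assoc)
qed

lemma flat_tendsto: "(flat P \<longlongrightarrow> 0) (at 0)"
proof -
  have "((\<lambda>t. poly P (1 / t) * exp (- (1 / t))) \<longlongrightarrow> 0) (at_right 0)"
    by (rule filterlim_compose[OF poly_exp_tendsto])
      (simp add: filterlim_inverse_at_top_right divide_inverse)
  then have "(flat P \<longlongrightarrow> 0) (at_right 0)"
    by (rule Lim_transform_eventually)
      (auto simp: flat_def eventually_at_filter)
  moreover have "(flat P \<longlongrightarrow> 0) (at_left 0)"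
    by (rule Lim_transform_eventually[OF tendsto_const])
      (auto simp: flat_def eventually_at_filter)
  ultimately show ?thesis by (simp add: filterlim_split_at_real filterlim_at_split)
qed

text \<open>With y = 1/t one has dy/dt = -y^2, so differentiating P(y) exp(-y) produces y^2 (P -
  P')(y) exp(-y).\<close>

lemma flat_deriv:
  "(flat P has_real_derivative flat (monom 1 2 * (P - pderiv P)) t) (at t)"
proof -
  consider "t > 0" | "t < 0" | "t = 0" by linarith
  then show ?thesis
  proof cases
    case 1
    have "((\<lambda>t. poly P (1 / t) * exp (- 1 / t)) has_real_derivative
        flat (monom 1 2 * (P - pderiv P)) t) (at t)"
      using 1 unfolding flat_def
      by (auto intro!: derivative_eq_intros DERIV_chain2[OF poly_DERIV]
          simp: poly_monom field_simps power2_eq_square)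
    then show ?thesis
      by (rule DERIV_cong_ev[OF refl _ refl, THEN iffD1, rotated])
        (use 1 eventually_nhds_in_open[of "{0<..}" t] in \<open>auto simp: flat_def elim!: eventually_mono\<close>)
  next
    case 2
    have "((\<lambda>t. 0) has_real_derivative flat (monom 1 2 * (P - pderiv P)) t) (at t)"
      using 2 by (simp add: flat_def)
    then show ?thesis
      by (rule DERIV_cong_ev[OF refl _ refl, THEN iffD1, rotated])
        (use 2 eventually_nhds_in_open[of "{..<0}" t] in \<open>auto simp: flat_def elim!: eventually_mono\<close>)
  next
    case 3
    \<comment> \<open>Dividing by h multiplies the polynomial by y = 1/h, so the difference quotient
      at 0 is again a member of the family and tends to 0.\<close>
    have "(\<lambda>h. flat P h / h) = flat ([:0, 1:] * P)"
      by (auto simp: flat_def fun_eq_iff)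
    then show ?thesis
      using flat_tendsto[of "[:0, 1:] * P"] 3 unfolding DERIV_def
      by (simp add: flat_def[of _ 0])
  qed
qed

lemma Ck_flat: "Ck k (flat P)"
proof (induct k arbitrary: P)
  case 0
  then show ?case
    using DERIV_isCont[OF flat_deriv] by (auto intro!: continuous_at_imp_continuous_on)
next
  case (Suc k)
  show ?case by (rule Ck_Suc_real[OF flat_deriv Suc])
qed

lemma flat_1: "flat 1 t > 0 \<longleftrightarrow> t > 0" "flat 1 t \<ge> 0" "t \<le> 0 \<Longrightarrow> flat 1 t = 0"
  by (auto simp: flat_def)

text \<open>The usual smooth transition from 0 to 1, spread over one period so that differences of
  its translates telescope. The denominator is positive because t and 2 pi - t cannot both be
  nonpositive.\<close>

definition smooth_step :: "real \<Rightarrow> real" where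
  "smooth_step t = flat 1 t * inverse (flat 1 t + flat 1 (2 * pi - t))"

lemma Ck_smooth_step: "Ck k smooth_step"
proof -
  have "flat 1 t + flat 1 (2 * pi - t) > 0" for t
    using flat_1(1)[of t] flat_1(1)[of "2 * pi - t"] flat_1(2)[of t] flat_1(2)[of "2 * pi - t"]
      pi_gt_zero by linarith
  then have "flat 1 t + flat 1 (2 * pi - t) \<noteq> 0" for t
    by (metis less_irrefl)
  moreover have "Ck k (\<lambda>t. flat 1 (2 * pi - t))"
    using Ck_inner_comp[OF Ck_flat, of k 1 "-1::real" "2 * pi"] by simp
  ultimately show ?thesis
    unfolding smooth_step_def[abs_def] by (intro Ck_mult Ck_inverse Ck_add Ck_flat)
qed

lemma smooth_step_eq: "t \<le> 0 \<Longrightarrow> smooth_step t = 0" "t \<ge> 2 * pi \<Longrightarrow> smooth_step t = 1"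
proof -
  show "t \<le> 0 \<Longrightarrow> smooth_step t = 0" by (simp add: smooth_step_def flat_1)
  assume "t \<ge> 2 * pi"
  moreover from this have "flat 1 t \<noteq> 0" using flat_1(1)[of t] pi_gt_zero by auto
  ultimately show "smooth_step t = 1" by (simp add: smooth_step_def flat_1)
qed

text \<open>The translates of \<open>hat\<close> by \<open>2\<pi>\<close> telescope to 1.\<close>

definition hat :: "real \<Rightarrow> real" where
  "hat t = smooth_step (t + 2 * pi) - smooth_step t"

lemma Ck_hat: "Ck k hat"
  unfolding hat_def[abs_def]
  using Ck_add[OF Ck_translate[OF Ck_smooth_step] Ck_minus[OF Ck_smooth_step]] by simp

lemma hat_eq_0: "t \<notin> {- 2 * pi<..<2 * pi} \<Longrightarrow> hat t = 0"
proof (cases "t \<le> - 2 * pi")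
  case True
  with pi_gt_zero have "t \<le> 0" "t + 2 * pi \<le> 0" by linarith+
  then show ?thesis by (simp add: hat_def smooth_step_eq)
next
  case False
  assume "t \<notin> {- 2 * pi<..<2 * pi}"
  with False pi_gt_zero have "t \<ge> 2 * pi" "t + 2 * pi \<ge> 2 * pi" by auto
  then show ?thesis by (simp add: hat_def smooth_step_eq)
qed

lemma hat_sum: "0 \<le> t \<Longrightarrow> t \<le> 2 * pi \<Longrightarrow> hat t + hat (t - 2 * pi) = 1"
  by (simp add: hat_def smooth_step_eq)

text \<open>The phase \<open>c\<close> closes the family under differentiation, since the derivative
  has phase \<open>c + pi / 2\<close>. The same device replaces sines in all Fourier integrals
  below.\<close>

lemma Ck_cos: "Ck k (\<lambda>t::real. cos (t + c))"
proof (induct k arbitrary: c)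
  case 0
  then show ?case by (auto intro!: continuous_intros)
next
  case (Suc k)
  show ?case
    by (rule Ck_Suc_real[OF _ Suc[of "c + pi / 2"]])
      (auto intro!: derivative_eq_intros simp: add.assoc[symmetric] cos_add sin_add)
qed

lemma Ck_cos_inner: "Ck k (\<lambda>x. cos (a \<bullet> x + c))"
  using Ck_inner_comp[OF Ck_cos[of k 0], of a c] by simp

section \<open>Stability of test functions\<close>

lemma test_function_translate:
  assumes "test_function \<phi>"
  shows "test_function (\<lambda>x. \<phi> (x + a))"
proof -
  have "{x. \<phi> (x + a) \<noteq> 0} = (\<lambda>x. x + (- a)) ` {x. \<phi> x \<noteq> 0}"
    by (auto intro!: image_eqI[where x = "_ + a"])
  then have "closure {x. \<phi> (x + a) \<noteq> 0} = (\<lambda>x. x + (- a)) ` closure {x. \<phi> x \<noteq> 0}"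
    using closure_translation[of "-a" "{x. \<phi> x \<noteq> 0}"] by (simp add: add.commute)
  then show ?thesis
    using assms compact_translation[of "closure {x. \<phi> x \<noteq> 0}" "-a"]
    by (auto simp: test_function_def Ck_translate add.commute)
qed

lemma test_functionI:
  assumes "\<And>k. Ck k \<phi>" "compact S" "\<And>x. x \<notin> S \<Longrightarrow> \<phi> x = 0"
  shows "test_function \<phi>"
proof -
  have "closure {x. \<phi> x \<noteq> 0} \<subseteq> S"
    using assms(2,3) by (intro closure_minimal compact_imp_closed) auto
  then have "compact (closure {x. \<phi> x \<noteq> 0})"
    using compact_Int_closed[OF assms(2) closed_closure[of "{x. \<phi> x \<noteq> 0}"]] by (simp add: inf.absorb2)
  then show ?thesis
    using assms(1) unfolding test_function_def by blast
qed

lemma test_function_mult: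
  assumes "test_function \<phi>" "\<And>k. Ck k \<psi>"
  shows "test_function (\<lambda>x. \<phi> x * \<psi> x)"
proof (rule test_functionI)
  show "Ck k (\<lambda>x. \<phi> x * \<psi> x)" for k using assms by (auto simp: test_function_def)
  show "compact (closure {x. \<phi> x \<noteq> 0})" using assms by (auto simp: test_function_def)
  show "x \<notin> closure {x. \<phi> x \<noteq> 0} \<Longrightarrow> \<phi> x * \<psi> x = 0" for x
    using closure_subset[of "{x. \<phi> x \<noteq> 0}"] by auto
qed

section \<open>The periodic cell\<close>

lemma
  fixes a :: "'a::euclidean_space"
  shows measurable_lebesgue_translate [measurable]: "(\<lambda>x. x + a) \<in> lebesgue \<rightarrow>\<^sub>M lebesgue"
    and distr_lebesgue_translate: "distr lebesgue lebesgue (\<lambda>x. x + a) = lebesgue"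
proof -
  have eq: "(\<lambda>x. a + (\<Sum>j\<in>Basis. (1 * (x \<bullet> j)) *\<^sub>R j)) = (\<lambda>x. x + a)"
    by (simp add: euclidean_representation add.commute)
  show "(\<lambda>x. x + a) \<in> lebesgue \<rightarrow>\<^sub>M lebesgue"
    using lebesgue_affine_measurable[of "\<lambda>_. 1" a] unfolding eq by simp
  show "distr lebesgue lebesgue (\<lambda>x. x + a) = lebesgue"
    using lebesgue_affine_euclidean[of "\<lambda>_. 1" a] unfolding eq by (simp add: density_1)
qed

lemma integral_lebesgue_translate:
  fixes F :: "'a::euclidean_space \<Rightarrow> real"
  assumes "F \<in> borel_measurable lebesgue"
  shows "(LINT x|lebesgue. F (x + a)) = (LINT x|lebesgue. F x)"
    and "integrable lebesgue (\<lambda>x. F (x + a)) \<longleftrightarrow> integrable lebesgue F"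
  using integral_distr[OF measurable_lebesgue_translate[of a], of F]
    integrable_distr_eq[OF measurable_lebesgue_translate[of a], of F] assms
  by (simp_all add: distr_lebesgue_translate)

lemma AE_lebesgue_translate: "(AE x in lebesgue. P x) \<Longrightarrow> (AE x in lebesgue. P (x + a))"
  using AE_distrD[OF measurable_lebesgue_translate[of a], of P]
  unfolding distr_lebesgue_translate .

text \<open>The translates of the open cell by periods leave out only hyperplanes of this kind, so
  they cover almost every point.\<close>

lemma AE_off_hyperplanes:
  "AE x in lebesgue. \<forall>b\<in>Basis. (x::'a::euclidean_space) \<bullet> b \<noteq> c"
proof (rule AE_finite_allI)
  fix b :: 'a assume "b \<in> Basis"
  then have "{x. x \<bullet> b = c} \<in> null_sets lebesgue"
    using negligible_standard_hyperplane[of b c] by (simp add: negligible_iff_null_sets)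
  then show "AE x in lebesgue. x \<bullet> b \<noteq> c"
    using AE_not_in by force
qed simp

text \<open>Stated over an arbitrary Euclidean space so that \<open>Omega\<close>,
  \<open>Upsilon\<close> and the interval of angles are all instances, and the Fourier analysis is
  done once.\<close>

definition cell :: "'a::euclidean_space set" where
  "cell = box 0 ((2 * pi) *\<^sub>R One)"

abbreviation torus :: "'a::euclidean_space measure" where
  "torus \<equiv> lebesgue_on cell"

lemma mem_cell: "x \<in> cell \<longleftrightarrow> (\<forall>b\<in>Basis. 0 < x \<bullet> b \<and> x \<bullet> b < 2 * pi)"
  by (auto simp: cell_def mem_box)

lemma cell_sets [measurable, simp]: "cell \<in> sets lebesgue" "cell \<in> sets borel" "cell \<in> sets lborel"
  by (simp_all add: cell_def)

lemma space_torus [simp]: "space torus = cell"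
  by (simp add: space_restrict_space)

interpretation torus: finite_measure "torus :: 'a::euclidean_space measure"
proof
  have "emeasure lebesgue (cell :: 'a set) < \<infinity>"
    using emeasure_lborel_box_finite[of 0 "(2 * pi) *\<^sub>R One :: 'a"] by (simp add: cell_def)
  then show "emeasure (torus :: 'a measure) (space torus) \<noteq> \<infinity>"
    by (simp add: emeasure_restrict_space)
qed

lemma torus_integrable_iff:
  "integrable torus f \<longleftrightarrow> integrable lebesgue (\<lambda>x. indicator cell x *\<^sub>R f x :: real)"
  by (subst integrable_restrict_space) auto

lemma torus_integral_eq:
  "(LINT x|torus. f x) = (LINT x|lebesgue. indicator cell x *\<^sub>R f x :: real)"
  by (subst integral_restrict_space) auto

lemma AE_torus: "(AE x in lebesgue. P x) \<Longrightarrow> (AE x in torus. P x)"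
  by (subst AE_restrict_space_iff) auto

text \<open>The corners of the cube [0, 2 pi]^n, indexed by sets of coordinates. For supports in
  [-2 pi, 2 pi]^n these are all the translations that matter, so sums over the period lattice become
  finite sums over \<open>Pow Basis\<close>.\<close>

definition shift :: "'a::euclidean_space set \<Rightarrow> 'a" where
  "shift S = (2 * pi) *\<^sub>R \<Sum>S"

lemma shift_inner: "S \<subseteq> Basis \<Longrightarrow> b \<in> Basis \<Longrightarrow> shift S \<bullet> b = (if b \<in> S then 2 * pi else 0)"
proof -
  assume S: "S \<subseteq> Basis" "b \<in> Basis"
  have "(\<Sum>S) \<bullet> b = (\<Sum>i\<in>S. i \<bullet> b)" by (simp add: inner_sum_left)
  also have "\<dots> = (\<Sum>i\<in>S. if i = b then 1 else 0)"
    using S by (intro sum.cong) (auto simp: inner_Basis subset_iff)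
  also have "\<dots> = (if b \<in> S then 1 else 0)"
    using finite_subset[OF S(1) finite_Basis] by simp
  finally show ?thesis by (simp add: shift_def)
qed

text \<open>Up to faces, the cube [-2 pi, 2 pi]^n is tiled by 2^n translates of the cell; the
  integral is cut along this tiling and each piece is moved back into the cell.\<close>

lemma integral_unfold_cell:
  fixes F :: "'a::euclidean_space \<Rightarrow> real"
  assumes F: "integrable lebesgue F"
    and supp: "\<And>x. F x \<noteq> 0 \<Longrightarrow> x \<in> cbox (- (2 * pi) *\<^sub>R One) ((2 * pi) *\<^sub>R One)"
  shows "(LINT x|lebesgue. F x) = (\<Sum>S\<in>Pow Basis. (LINT x|torus. F (x - shift S)))"
    and "S \<subseteq> Basis \<Longrightarrow> integrable torus (\<lambda>x. F (x - shift S))"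
proof -
  have [measurable]: "F \<in> borel_measurable lebesgue" using F by auto
  define G where "G S x = indicator cell (x + shift S) * F x" for S x
  have Gm: "(\<lambda>x. indicator cell x * F (x + - shift S)) \<in> borel_measurable lebesgue" for S
    by (intro borel_measurable_times measurable_compose[OF measurable_lebesgue_translate]) auto
  have G_eq: "G S = (\<lambda>x. indicator cell (x + shift S) * F (x + shift S + - shift S))" for S
    by (simp add: G_def fun_eq_iff)
  have Gm': "G S \<in> borel_measurable lebesgue" for S
    unfolding G_eq by (rule measurable_compose[OF measurable_lebesgue_translate Gm])
  have Gi: "integrable lebesgue (G S)" for S
    by (rule Bochner_Integration.integrable_bound[OF F Gm'])
      (auto simp: G_def indicator_def)
  have tr: "(LINT x|torus. F (x - shift S)) = (LINT x|lebesgue. G S x)"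
    "integrable torus (\<lambda>x. F (x - shift S))" for S
    using integral_lebesgue_translate[OF Gm[of S], of "shift S"] Gi[of S]
    unfolding torus_integral_eq torus_integrable_iff G_eq by simp_all
  then show "S \<subseteq> Basis \<Longrightarrow> integrable torus (\<lambda>x. F (x - shift S))" by simp
  have "AE x in lebesgue. F x = (\<Sum>S\<in>Pow Basis. G S x)"
    using AE_off_hyperplanes[of 0] AE_off_hyperplanes[of "2 * pi"] AE_off_hyperplanes[of "- (2 * pi)"]
  proof eventually_elim
    case (elim x)
    show ?case
    proof (cases "F x = 0")
      case False
      then have x: "\<forall>b\<in>Basis. - (2 * pi) < x \<bullet> b \<and> x \<bullet> b < 2 * pi"
        using supp[of x] elim by (fastforce simp: mem_box less_le)
      \<comment> \<open>The negative coordinates are exactly those that must be shifted to enter the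
        cell, so a single term of the sum survives.\<close>
      define T where "T = {b\<in>Basis. x \<bullet> b < 0}"
      have iff: "x + shift S \<in> cell \<longleftrightarrow> S = T" if "S \<subseteq> Basis" for S
      proof
        assume "x + shift S \<in> cell"
        then have *: "\<forall>b\<in>Basis. 0 < x \<bullet> b + (if b \<in> S then 2 * pi else 0) \<and>
            x \<bullet> b + (if b \<in> S then 2 * pi else 0) < 2 * pi"
          using that by (simp add: mem_cell inner_add_left shift_inner)
        show "S = T"
        proof (intro set_eqI iffI)
          fix b assume "b \<in> S"
          with that have b: "b \<in> Basis" by blast
          have "x \<bullet> b + 2 * pi < 2 * pi" using bspec[OF * b] \<open>b \<in> S\<close> by simp
          with b show "b \<in> T" by (simp add: T_def)
        next
          fix b assume "b \<in> T"
          then show "b \<in> S" using bspec[OF *, of b] by (auto simp: T_def split: if_splits)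
        qed
      next
        assume "S = T"
        then show "x + shift S \<in> cell"
          using x elim by (auto simp: mem_cell inner_add_left shift_inner T_def less_le)
      qed
      have "(\<Sum>S\<in>Pow Basis. G S x) = (\<Sum>S\<in>Pow Basis. if S = T then F x else 0)"
        by (intro sum.cong) (auto simp: G_def iff)
      also have "\<dots> = F x" by (simp add: T_def)
      finally show ?thesis ..
    qed (simp add: G_def)
  qed
  then have "(LINT x|lebesgue. F x) = (LINT x|lebesgue. (\<Sum>S\<in>Pow Basis. G S x))"
    using Gm' by (intro integral_cong_AE) auto
  also have "\<dots> = (\<Sum>S\<in>Pow Basis. (LINT x|torus. F (x - shift S)))"
    unfolding tr by (rule Bochner_Integration.integral_sum) (rule Gi)
  finally show "(LINT x|lebesgue. F x) = (\<Sum>S\<in>Pow Basis. (LINT x|torus. F (x - shift S)))" .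
qed

section \<open>Weak derivatives of smooth functions\<close>

lemma integrable_continuous_compact_support:
  fixes F :: "'a::euclidean_space \<Rightarrow> real"
  assumes "continuous_on UNIV F" "compact K" "\<And>x. x \<notin> K \<Longrightarrow> F x = 0"
  shows "integrable lebesgue F"
proof -
  have "integrable lborel (\<lambda>x. indicator K x *\<^sub>R F x)"
    using assms(1,2) by (intro borel_integrable_compact) (auto intro: continuous_on_subset)
  moreover have "(\<lambda>x. indicator K x *\<^sub>R F x) = F"
    using assms(3) by (auto simp: indicator_def fun_eq_iff)
  ultimately show ?thesis by (simp add: integrable_completion)
qed

lemma test_functionD:
  assumes "test_function \<phi>"
  shows "continuous_on UNIV \<phi>" "\<phi> differentiable (at x)"
    "b \<in> Basis \<Longrightarrow> continuous_on UNIV (\<lambda>x. frechet_derivative \<phi> (at x) b)"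
    "\<exists>K. compact K \<and> (\<forall>x. x \<notin> K \<longrightarrow> \<phi> x = 0)"
proof -
  have C: "Ck 0 \<phi>" "Ck 1 \<phi>" using assms by (auto simp: test_function_def)
  then show "continuous_on UNIV \<phi>" "\<phi> differentiable (at x)"
    "b \<in> Basis \<Longrightarrow> continuous_on UNIV (\<lambda>x. frechet_derivative \<phi> (at x) b)" by auto
  show "\<exists>K. compact K \<and> (\<forall>x. x \<notin> K \<longrightarrow> \<phi> x = 0)"
    using assms closure_subset[of "{x. \<phi> x \<noteq> 0}"]
    by (intro exI[of _ "closure {x. \<phi> x \<noteq> 0}"]) (auto simp: test_function_def)
qed

lemma frechet_derivative_support:
  assumes "compact K" "\<And>x. x \<notin> K \<Longrightarrow> F x = 0" "x \<notin> K"
  shows "frechet_derivative F (at x) = (\<lambda>b. 0)"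
proof -
  have "frechet_derivative (\<lambda>x. 0) (at x) = frechet_derivative F (at x)"
    by (rule frechet_derivative_transform_within_open[where X = "- K"])
      (use assms compact_imp_closed in auto)
  then show ?thesis by (metis frechet_derivative_const)
qed

text \<open>By translation invariance every difference quotient of \<open>F\<close> has integral 0.
  Dominated convergence carries this over to the derivative; the mean value theorem provides the
  bound.\<close>

lemma integral_derivative_eq_0:
  fixes F :: "'a::euclidean_space \<Rightarrow> real"
  assumes F: "\<And>x. F differentiable (at x)" and K: "compact K" "\<And>x. x \<notin> K \<Longrightarrow> F x = 0"
    and cont: "continuous_on UNIV (\<lambda>x. frechet_derivative F (at x) e)"
  shows "(LINT x|lebesgue. frechet_derivative F (at x) e) = 0"
    and "integrable lebesgue (\<lambda>x. frechet_derivative F (at x) e)"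
proof -
  define D where "D x = frechet_derivative F (at x) e" for x
  have D0: "x \<notin> K \<Longrightarrow> D x = 0" for x
    unfolding D_def by (subst frechet_derivative_support[OF K]) auto
  have "bounded (D ` K)"
    using cont K(1) unfolding D_def
    by (intro compact_imp_bounded compact_continuous_image) (auto intro: continuous_on_subset)
  then obtain C where C: "C > 0" "\<And>x. x \<in> K \<Longrightarrow> norm (D x) \<le> C"
    by (auto simp: bounded_pos)
  have CD: "norm (D x) \<le> C" for x
    using C D0 by (cases "x \<in> K") auto
  have contF: "continuous_on UNIV F"
    using F differentiable_imp_continuous_within by (auto simp: continuous_on_eq_continuous_within)
  have intF: "integrable lebesgue F"
    by (rule integrable_continuous_compact_support[OF contF K])
  have [measurable]: "F \<in> borel_measurable lebesgue" using intF by auto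
  have der: "((\<lambda>t. F (x + t *\<^sub>R e)) has_real_derivative D (x + t *\<^sub>R e)) (at t)" for x t
  proof -
    have 1: "((\<lambda>t. x + t *\<^sub>R e) has_derivative (\<lambda>t. t *\<^sub>R e)) (at t)"
      by (auto intro!: derivative_eq_intros)
    have 2: "(F has_derivative frechet_derivative F (at (x + t *\<^sub>R e))) (at (x + t *\<^sub>R e))"
      using F frechet_derivative_works by blast
    have "frechet_derivative F (at (x + t *\<^sub>R e)) (r *\<^sub>R e) = D (x + t *\<^sub>R e) * r" for r
      using linear_scale[OF linear_frechet_derivative[OF F]] by (simp add: D_def)
    then show ?thesis
      using diff_chain_at[OF 1 2] by (simp add: o_def has_field_derivative_def)
  qed
  define h :: "nat \<Rightarrow> real" where "h n = 1 / Suc n" for n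
  have h: "0 < h n" "h n \<le> 1" for n by (auto simp: h_def)
  have h0: "h \<longlonglongrightarrow> 0" unfolding h_def by (rule LIMSEQ_Suc, rule lim_1_over_n)
  define G where "G n x = (F (x + h n *\<^sub>R e) - F x) / h n" for n x
  obtain R where R: "\<And>x. x \<in> K \<Longrightarrow> norm x \<le> R"
    using compact_imp_bounded[OF K(1)] by (auto simp: bounded_iff)
  \<comment> \<open>Since \<open>h n \<le> 1\<close>, the quotients vanish off the support enlarged
    by \<open>norm e\<close>, so one ball serves all \<open>n\<close>.\<close>
  define B where "B = cball (0::'a) (R + norm e)"
  have lim: "(\<lambda>n. G n x) \<longlonglongrightarrow> D x" for x
  proof -
    have "((\<lambda>t. (F (x + t *\<^sub>R e) - F x) / t) \<longlongrightarrow> D x) (at 0)"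
      using der[of x 0] by (simp add: DERIV_def)
    moreover have "filterlim h (at 0) sequentially"
      using h0 h(1) by (auto simp: filterlim_at intro!: always_eventually less_imp_neq[symmetric])
    ultimately show ?thesis unfolding G_def by (rule filterlim_compose)
  qed
  have bound: "norm (G n x) \<le> C * indicator B x" for n x
  proof (cases "x \<in> B")
    case True
    obtain z where "F (x + h n *\<^sub>R e) - F (x + 0 *\<^sub>R e) = (h n - 0) * D (x + z *\<^sub>R e)"
      using MVT2[OF h(1)[of n] der] by blast
    then have "G n x = D (x + z *\<^sub>R e)" using h(1)[of n] by (simp add: G_def)
    then show ?thesis using CD True by simp
  next
    case False
    then have nx: "norm x > R + norm e" by (simp add: B_def)
    then have 1: "x \<notin> K" using R[of x] norm_ge_zero[of e] by linarith
    have "norm (h n *\<^sub>R e) \<le> norm e" using h[of n] by (simp add: mult_left_le_one_le)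
    then have "norm (x + h n *\<^sub>R e) > R" using nx norm_diff_ineq[of x "h n *\<^sub>R e"] by linarith
    then have "x + h n *\<^sub>R e \<notin> K" using R by force
    with 1 show ?thesis using K(2) False by (simp add: G_def)
  qed
  have Bint: "integrable lebesgue (\<lambda>x. C * indicator B x :: real)"
    unfolding B_def by (intro integrable_mult_right) (metis lmeasurable_cball lmeasurable_iff_integrable)
  have Gm: "G n \<in> borel_measurable lebesgue" for n
  proof -
    have "(\<lambda>x. F (x + h n *\<^sub>R e)) \<in> borel_measurable lebesgue"
      by (rule measurable_compose[OF measurable_lebesgue_translate]) fact
    then show ?thesis unfolding G_def by simp
  qed
  have Dm: "D \<in> borel_measurable lebesgue"
    using borel_measurable_LIMSEQ_real[OF lim Gm] .
  have "(\<lambda>n. LINT x|lebesgue. G n x) \<longlonglongrightarrow> (LINT x|lebesgue. D x)"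
    by (rule integral_dominated_convergence[OF Dm Gm Bint]) (use lim bound in auto)
  moreover have "(LINT x|lebesgue. G n x) = 0" for n
    unfolding G_def
    by (subst integral_divide_zero, subst Bochner_Integration.integral_diff)
      (auto simp: integral_lebesgue_translate intF)
  ultimately show "(LINT x|lebesgue. frechet_derivative F (at x) e) = 0"
    by (simp add: D_def LIMSEQ_const_iff)
  show "integrable lebesgue (\<lambda>x. frechet_derivative F (at x) e)"
    using integrable_continuous_compact_support[OF cont K(1)] D0 by (simp add: D_def)
qed

lemma locally_integrable_continuous: "continuous_on UNIV u \<Longrightarrow> locally_integrable u"
  unfolding locally_integrable_def
proof (intro allI impI)
  fix K :: "'a set" assume u: "continuous_on UNIV u" and K: "compact K"
  have "integrable lborel (\<lambda>x. indicator K x *\<^sub>R u x)"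
    using u K by (intro borel_integrable_compact) (auto intro: continuous_on_subset)
  then have "integrable lebesgue (\<lambda>x. indicator K x *\<^sub>R u x)" by (simp add: integrable_completion)
  then show "integrable (lebesgue_on K) u"
    using K by (subst integrable_restrict_space) (auto dest!: lmeasurable_compact)
qed

text \<open>The function \<psi> itself may lack compact support, but its product with a test
  function has it, so \<open>integral_derivative_eq_0\<close> applied to the product is the
  integration by parts.\<close>

lemma has_weak_deriv_C1:
  fixes \<psi> :: "'a::euclidean_space \<Rightarrow> real"
  assumes \<psi>: "\<And>x. \<psi> differentiable (at x)"
    and cont: "continuous_on UNIV (\<lambda>x. frechet_derivative \<psi> (at x) e)" and e: "e \<in> Basis"
  shows "has_weak_deriv e \<psi> (\<lambda>x. frechet_derivative \<psi> (at x) e)"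
  unfolding has_weak_deriv_def
proof (intro conjI allI impI)
  have c: "continuous_on UNIV \<psi>"
    using \<psi> differentiable_imp_continuous_within by (auto simp: continuous_on_eq_continuous_within)
  then show "locally_integrable \<psi>" "locally_integrable (\<lambda>x. frechet_derivative \<psi> (at x) e)"
    using cont locally_integrable_continuous by auto
  fix \<phi> :: "'a \<Rightarrow> real" assume \<phi>: "test_function \<phi>"
  note \<phi>D = test_functionD[OF \<phi>]
  obtain K where K: "compact K" "\<And>x. x \<notin> K \<Longrightarrow> \<phi> x = 0" using \<phi>D(4) by blast
  have eq: "frechet_derivative (\<lambda>x. \<psi> x * \<phi> x) (at x) e =
      \<psi> x * frechet_derivative \<phi> (at x) e + frechet_derivative \<psi> (at x) e * \<phi> x" for x
    by (subst frechet_derivative_at[OF has_derivative_mult, symmetric])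
      (use \<psi> \<phi>D(2) frechet_derivative_works in blast)+
  have i1: "integrable lebesgue (\<lambda>x. \<psi> x * frechet_derivative \<phi> (at x) e)"
    using \<phi>D(3)[OF e] c frechet_derivative_support[OF K]
    by (intro integrable_continuous_compact_support[OF _ K(1)] continuous_intros) auto
  have i2: "integrable lebesgue (\<lambda>x. frechet_derivative \<psi> (at x) e * \<phi> x)"
    using cont \<phi>D(1) K(2)
    by (intro integrable_continuous_compact_support[OF _ K(1)] continuous_intros) auto
  have "(LINT x|lebesgue. frechet_derivative (\<lambda>x. \<psi> x * \<phi> x) (at x) e) = 0"
  proof (rule integral_derivative_eq_0[OF _ K(1)])
    show "continuous_on UNIV (\<lambda>x. frechet_derivative (\<lambda>x. \<psi> x * \<phi> x) (at x) e)"
      unfolding eq using c cont \<phi>D(1) \<phi>D(3)[OF e] by (intro continuous_intros)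
  qed (use \<psi> \<phi>D(2) K(2) in \<open>auto intro: differentiable_mult\<close>)
  then show "(LINT x|lebesgue. \<psi> x * frechet_derivative \<phi> (at x) e) =
      - (LINT x|lebesgue. frechet_derivative \<psi> (at x) e * \<phi> x)"
    unfolding eq using i1 i2 by simp
qed

section \<open>Trigonometric polynomials\<close>

text \<open>The integer vectors, which are the frequencies of exponentials with period 2 pi in each
  coordinate.\<close>

definition lat :: "'a::euclidean_space set" where
  "lat = {k. \<forall>b\<in>Basis. k \<bullet> b \<in> \<int>}"

definition ek :: "'a::euclidean_space \<Rightarrow> 'a \<Rightarrow> complex" where
  "ek k x = cis (k \<bullet> x)"

lemma lat_0 [simp]: "0 \<in> lat" and lat_Basis: "b \<in> Basis \<Longrightarrow> b \<in> lat"
  and lat_add: "k \<in> lat \<Longrightarrow> l \<in> lat \<Longrightarrow> k + l \<in> lat"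
  and lat_minus [simp]: "- k \<in> lat \<longleftrightarrow> k \<in> lat"
  and lat_diff: "k \<in> lat \<Longrightarrow> l \<in> lat \<Longrightarrow> k - l \<in> lat"
  by (auto simp: lat_def inner_simps inner_Basis)

lemma ek_0 [simp]: "ek 0 x = 1" and ek_add: "ek (k + l) x = ek k x * ek l x"
  and norm_ek [simp]: "norm (ek k x) = 1" and cnj_ek: "cnj (ek k x) = ek (- k) x"
  by (simp_all add: ek_def inner_simps cis_mult cis_cnj)

lemma continuous_ek [continuous_intros]: "continuous_on S (ek k)"
  unfolding ek_def[abs_def] cis_conv_exp by (intro continuous_intros)

definition trig :: "('a::euclidean_space \<Rightarrow> complex) \<Rightarrow> bool" where
  "trig p \<longleftrightarrow> (\<exists>F c. finite F \<and> F \<subseteq> lat \<and> p = (\<lambda>x. \<Sum>k\<in>F. c k * ek k x))"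

lemma trig_cmult_ek: "k \<in> lat \<Longrightarrow> trig (\<lambda>x. c * ek k x)"
  unfolding trig_def by (intro exI[of _ "{k}"] exI[of _ "\<lambda>_. c"]) auto

lemma trig_const: "trig (\<lambda>x. c)"
  using trig_cmult_ek[of 0 c] by simp

lemma trig_add:
  assumes "trig p" "trig q" shows "trig (\<lambda>x. p x + q x)"
proof -
  obtain F c where p: "finite F" "F \<subseteq> lat" "p = (\<lambda>x. \<Sum>k\<in>F. c k * ek k x)"
    using assms(1) by (auto simp: trig_def)
  obtain G d where q: "finite G" "G \<subseteq> lat" "q = (\<lambda>x. \<Sum>k\<in>G. d k * ek k x)"
    using assms(2) by (auto simp: trig_def)
  have 1: "(\<Sum>k\<in>F. c k * ek k x) = (\<Sum>k\<in>F \<union> G. (if k \<in> F then c k else 0) * ek k x)" for x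
    using p(1) q(1) by (intro sum.mono_neutral_cong_left) auto
  have 2: "(\<Sum>k\<in>G. d k * ek k x) = (\<Sum>k\<in>F \<union> G. (if k \<in> G then d k else 0) * ek k x)" for x
    using p(1) q(1) by (intro sum.mono_neutral_cong_left) auto
  show ?thesis
    unfolding trig_def p(3) q(3) 1 2 using p q
    by (intro exI[of _ "F \<union> G"] exI[of _ "\<lambda>k. (if k \<in> F then c k else 0) + (if k \<in> G then d k else 0)"])
      (auto simp: sum.distrib ring_distribs)
qed

lemma trig_sum: "(\<And>i. i \<in> I \<Longrightarrow> trig (p i)) \<Longrightarrow> trig (\<lambda>x. \<Sum>i\<in>I. p i x)"
  by (induct I rule: infinite_finite_induct) (auto intro: trig_add trig_const)

lemma trig_mult:
  assumes "trig p" "trig q" shows "trig (\<lambda>x. p x * q x)"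
proof -
  obtain F c where p: "finite F" "F \<subseteq> lat" "p = (\<lambda>x. \<Sum>k\<in>F. c k * ek k x)"
    using assms(1) by (auto simp: trig_def)
  obtain G d where q: "finite G" "G \<subseteq> lat" "q = (\<lambda>x. \<Sum>k\<in>G. d k * ek k x)"
    using assms(2) by (auto simp: trig_def)
  have "(\<lambda>x. p x * q x) = (\<lambda>x. \<Sum>k\<in>F. \<Sum>l\<in>G. (c k * d l) * ek (k + l) x)"
    by (simp add: p q sum_product ek_add mult_ac)
  moreover have "trig (\<lambda>x. \<Sum>k\<in>F. \<Sum>l\<in>G. (c k * d l) * ek (k + l) x)"
    using p q by (intro trig_sum trig_cmult_ek lat_add) auto
  ultimately show ?thesis by simp
qed

lemma trig_prod: "(\<And>i. i \<in> I \<Longrightarrow> trig (p i)) \<Longrightarrow> trig (\<lambda>x. \<Prod>i\<in>I. p i x)"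
  by (induct I rule: infinite_finite_induct) (auto intro: trig_mult trig_const)

lemma trig_cos:
  assumes "b \<in> Basis" shows "trig (\<lambda>x. complex_of_real (cos (x \<bullet> b - c)))"
proof -
  have "(\<lambda>x. complex_of_real (cos (x \<bullet> b - c))) = (\<lambda>x. cis (- c) / 2 * ek b x + cis c / 2 * ek (- b) x)"
    by (auto simp: fun_eq_iff complex_eq_iff ek_def cis_mult inner_commute cos_diff sin_diff field_simps)
  moreover have "trig (\<lambda>x. cis (- c) / 2 * ek b x + cis c / 2 * ek (- b) x)"
    using assms by (intro trig_add trig_cmult_ek) (simp_all add: lat_Basis)
  ultimately show ?thesis by simp
qed

lemma trig_polynomial_cos:
  assumes "real_polynomial_function q" "b \<in> Basis"
  shows "trig (\<lambda>x. complex_of_real (q (cos (x \<bullet> b - c))))"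
  using assms(1)
proof (induct q rule: real_polynomial_function.induct)
  case (linear f)
  have "f y = f 1 * y" for y
    using linear_scale[OF bounded_linear.linear[OF linear], of y 1] by simp
  then have "(\<lambda>x. complex_of_real (f (cos (x \<bullet> b - c)))) =
      (\<lambda>x. complex_of_real (f 1) * complex_of_real (cos (x \<bullet> b - c)))"
    by (metis of_real_mult)
  then show ?case using trig_mult[OF trig_const trig_cos[OF assms(2)]] by simp
qed (use trig_const in \<open>auto intro!: trig_add trig_mult\<close>)

lemma continuous_trig: "trig p \<Longrightarrow> continuous_on S p"
  unfolding trig_def by (auto intro!: continuous_intros)

lemma measurable_trig: "trig p \<Longrightarrow> p \<in> borel_measurable lebesgue"
proof (rule measurable_completion)
  assume "trig p"
  then have "p \<in> borel_measurable borel" by (intro borel_measurable_continuous_onI continuous_trig)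
  then show "p \<in> borel_measurable lborel" by simp
qed

lemma measurable_trig_torus: "trig p \<Longrightarrow> p \<in> borel_measurable torus"
  using measurable_trig measurable_restrict_space1 by blast

lemma trig_bounded: "trig p \<Longrightarrow> \<exists>C>0. \<forall>x. norm (p x) \<le> C"
proof -
  assume "trig p"
  then obtain F c where p: "p = (\<lambda>x. \<Sum>k\<in>F. c k * ek k x)" by (auto simp: trig_def)
  have "norm (p x) \<le> (\<Sum>k\<in>F. norm (c k)) + 1" for x
    unfolding p by (rule order_trans[OF norm_sum]) (simp add: norm_mult)
  moreover have "(\<Sum>k\<in>F. norm (c k)) + 1 > 0" by (simp add: add_nonneg_pos sum_nonneg)
  ultimately show ?thesis by blast
qed

text \<open>Ramps of slope n + 1 starting at \<open>a\<close> converge to the jump, and Weierstrass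
  replaces each by a polynomial with error below 1 / (n + 1). The uniform bound is kept for
  dominated convergence.\<close>

lemma polynomial_approx_threshold:
  "\<exists>q. (\<forall>n. real_polynomial_function (q n)) \<and> (\<forall>n. \<forall>y\<in>{-1..1}. \<bar>q n y\<bar> \<le> 2) \<and>
    (\<forall>y\<in>{-1..1::real}. (\<lambda>n. q n y) \<longlonglongrightarrow> (if y > a then 1 else 0))"
proof -
  define h where "h n y = min 1 (max 0 (real (Suc n) * (y - a)))" for n y
  have "\<exists>q. real_polynomial_function q \<and> (\<forall>y\<in>{-1..1}. \<bar>h n y - q y\<bar> < 1 / Suc n)" for n
  proof -
    have "continuous_on {-1..1} (h n)" unfolding h_def by (intro continuous_intros)
    then obtain q where "real_polynomial_function q" "\<And>y. y \<in> {-1..1} \<Longrightarrow> \<bar>h n y - q y\<bar> < 1 / Suc n"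
      using Stone_Weierstrass_real_polynomial_function[of "{-1..1}" "h n" "1 / Suc n"] by auto
    then show ?thesis by blast
  qed
  then obtain q where q: "\<And>n. real_polynomial_function (q n)"
    "\<And>n y. y \<in> {-1..1} \<Longrightarrow> \<bar>h n y - q n y\<bar> < 1 / Suc n" by metis
  have "\<bar>q n y\<bar> \<le> 2" if "y \<in> {-1..1}" for n y
  proof -
    have "1 / real (Suc n) \<le> 1" by simp
    moreover have "\<bar>h n y\<bar> \<le> 1" by (auto simp: h_def)
    ultimately show ?thesis using q(2)[OF that, of n] by linarith
  qed
  moreover have "(\<lambda>n. q n y) \<longlonglongrightarrow> (if y > a then 1 else 0)" if "y \<in> {-1..1}" for y
  proof -
    have hl: "(\<lambda>n. h n y) \<longlonglongrightarrow> (if y > a then 1 else 0)"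
    proof (cases "y > a")
      case True
      obtain N where N: "1 / (y - a) < real N" using reals_Archimedean2 by blast
      have "h n y = 1" if "n \<ge> N" for n
      proof -
        have "1 / (y - a) \<le> real (Suc n)" using N that by linarith
        then have "1 \<le> real (Suc n) * (y - a)" using True by (simp add: divide_le_eq)
        then show ?thesis by (simp add: h_def)
      qed
      then show ?thesis using True
        by (auto intro!: tendsto_eventually eventually_sequentiallyI[of N])
    next
      case False
      then have "h n y = 0" for n
        by (auto simp: h_def min_def max_def mult_le_0_iff zero_le_mult_iff)
      then show ?thesis using False by simp
    qed
    have "(\<lambda>n. h n y - q n y) \<longlonglongrightarrow> 0"
      by (rule Lim_null_comparison[OF _ LIMSEQ_Suc[OF lim_1_over_n]])
        (use q(2)[OF that] in \<open>auto intro!: always_eventually less_imp_le\<close>)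
    from tendsto_diff[OF hl this] show ?thesis by simp
  qed
  ultimately show ?thesis using q(1) by blast
qed

text \<open>Thresholding a cosine is how trigonometric polynomials reach the indicator of an
  interval. The hypotheses keep the distance \<open>s\<close> from the midpoint at most
  \<open>2 * pi - r\<close>, so past pi the cosine does not climb back above
  \<open>cos r\<close>.\<close>

lemma cos_gt_iff_interval:
  assumes "0 \<le> l" "l < u" "u \<le> 2 * pi" "0 < t" "t < 2 * pi"
  shows "cos (t - (l + u) / 2) > cos ((u - l) / 2) \<longleftrightarrow> l < t \<and> t < u"
proof -
  define s where "s = \<bar>t - (l + u) / 2\<bar>"
  define r where "r = (u - l) / 2"
  have r: "0 < r" "r \<le> pi" using assms by (auto simp: r_def)
  have s: "0 \<le> s" "s \<le> 2 * pi - r" using assms by (auto simp: s_def r_def abs_if field_simps)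
  have "cos s > cos r \<longleftrightarrow> s < r"
  proof (cases "s \<le> pi")
    case True
    then show ?thesis using cos_mono_less_eq[of r s] r s by auto
  next
    case False
    have "cos (2 * pi - s) = cos s" by (simp add: cos_diff)
    moreover have "cos (2 * pi - s) \<le> cos r"
      using False r s by (intro cos_monotone_0_pi_le) auto
    ultimately show ?thesis using False r by auto
  qed
  moreover have "cos s = cos (t - (l + u) / 2)" by (simp add: s_def abs_if cos_diff cos_add)
  moreover have "s < r \<longleftrightarrow> l < t \<and> t < u" by (auto simp: s_def r_def abs_if field_simps)
  ultimately show ?thesis by (simp add: r_def)
qed

text \<open>One thresholded cosine per coordinate, each factor bounded by 2; their product tends to
  the indicator. Indicators are discontinuous, so the convergence is pointwise with a uniform bound,
  which suffices for dominated convergence.\<close>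

lemma trig_approx_box:
  fixes l u :: "'a::euclidean_space"
  assumes lu: "\<And>b. b \<in> Basis \<Longrightarrow> 0 \<le> l \<bullet> b \<and> l \<bullet> b < u \<bullet> b \<and> u \<bullet> b \<le> 2 * pi"
  shows "\<exists>p. (\<forall>n. trig (p n)) \<and> (\<forall>n x. norm (p n x) \<le> 2 ^ DIM('a)) \<and>
    (\<forall>x\<in>cell. (\<lambda>n. p n x) \<longlonglongrightarrow> indicator (box l u) x)"
proof -
  define a where "a b = cos ((u \<bullet> b - l \<bullet> b) / 2)" for b
  define m where "m b = (l \<bullet> b + u \<bullet> b) / 2" for b
  from choice[OF allI[OF polynomial_approx_threshold, of a]]
  obtain q where q: "\<And>b n. real_polynomial_function (q b n)"
    "\<And>b n y. y \<in> {-1..1} \<Longrightarrow> \<bar>q b n y\<bar> \<le> 2"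
    "\<And>b y. y \<in> {-1..1} \<Longrightarrow> (\<lambda>n. q b n y) \<longlonglongrightarrow> (if y > a b then 1 else 0)"
    by blast
  define p where "p n x = (\<Prod>b\<in>Basis. complex_of_real (q b n (cos (x \<bullet> b - m b))))" for n and x :: 'a
  have "trig (p n)" for n
    unfolding p_def[abs_def] by (intro trig_prod trig_polynomial_cos q(1))
  moreover have "norm (p n x) \<le> 2 ^ DIM('a)" for n x
  proof -
    have "norm (p n x) = (\<Prod>b\<in>Basis. \<bar>q b n (cos (x \<bullet> b - m b))\<bar>)"
      by (simp add: p_def flip: prod_norm)
    also have "\<dots> \<le> (\<Prod>b\<in>(Basis::'a set). 2)" by (intro prod_mono) (use q(2) in auto)
    finally show ?thesis by simp
  qed
  moreover have "(\<lambda>n. p n x) \<longlonglongrightarrow> indicator (box l u) x" if "x \<in> cell" for x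
  proof -
    have "(\<lambda>n. p n x) \<longlonglongrightarrow>
        (\<Prod>b\<in>Basis. complex_of_real (if cos (x \<bullet> b - m b) > a b then 1 else 0))"
      unfolding p_def by (intro tendsto_prod tendsto_of_real q(3)) auto
    also have "(\<Prod>b\<in>Basis. complex_of_real (if cos (x \<bullet> b - m b) > a b then 1 else 0)) =
        (\<Prod>b\<in>Basis. if l \<bullet> b < x \<bullet> b \<and> x \<bullet> b < u \<bullet> b then 1 else 0)"
      using lu that by (intro prod.cong) (auto simp: a_def m_def mem_cell cos_gt_iff_interval)
    also have "\<dots> = indicator (box l u) x"
    proof (cases "x \<in> box l u")
      case True
      then show ?thesis by (simp add: mem_box)
    next
      case False
      then obtain b where "b \<in> Basis" "\<not> (l \<bullet> b < x \<bullet> b \<and> x \<bullet> b < u \<bullet> b)"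
        by (auto simp: mem_box)
      then show ?thesis using False by (intro trans[OF prod_zero]) auto
    qed
    finally show ?thesis .
  qed
  ultimately show ?thesis by blast
qed

text \<open>Dynkin's argument relative to the cell: complements are taken inside it and boxes are
  clipped to it. A box clipped to nothing falls under the empty case, since the box case has strict
  inequalities.\<close>

lemma cell_borel_induct [consumes 1, case_names box empty compl union]:
  fixes A :: "'a::euclidean_space set"
  assumes A: "A \<in> sets borel"
    and box: "\<And>l u. (\<And>b. b \<in> Basis \<Longrightarrow> 0 \<le> l \<bullet> b \<and> l \<bullet> b < u \<bullet> b \<and> u \<bullet> b \<le> 2 * pi) \<Longrightarrow> P (box l u)"
    and empty: "P {}"
    and compl: "\<And>A. A \<in> sets borel \<Longrightarrow> A \<subseteq> cell \<Longrightarrow> P A \<Longrightarrow> P (cell - A)"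
    and union: "\<And>A. (\<And>i::nat. A i \<in> sets borel) \<Longrightarrow> (\<And>i. A i \<subseteq> cell) \<Longrightarrow> disjoint_family A \<Longrightarrow>
      (\<And>i. P (A i)) \<Longrightarrow> P (\<Union>i. A i)"
  shows "P (A \<inter> cell)"
proof -
  let ?G = "range (\<lambda>(a, b). box a b :: 'a set)"
  have sets: "sets borel = sigma_sets UNIV ?G" by (simp add: borel_eq_box)
  have "Int_stable ?G" by (auto simp: Int_stable_def box_Int_box)
  moreover have "?G \<subseteq> Pow UNIV" by simp
  moreover have "A \<in> sigma_sets UNIV ?G" using A by (simp add: sets)
  ultimately show ?thesis
  proof (induct rule: sigma_sets_induct_disjoint)
    case (basic B)
    then obtain a b where B: "B = box a b" by auto
    define l where "l = (\<Sum>i\<in>Basis. max (a \<bullet> i) (0 \<bullet> i) *\<^sub>R i)"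
    define u where "u = (\<Sum>i\<in>Basis. min (b \<bullet> i) (((2 * pi) *\<^sub>R One) \<bullet> i) *\<^sub>R i)"
    have eq: "B \<inter> cell = box l u"
      unfolding B cell_def box_Int_box l_def u_def by simp
    have "0 \<le> l \<bullet> i" "u \<bullet> i \<le> 2 * pi" if "i \<in> Basis" for i
      using that by (simp_all add: l_def u_def)
    then show ?case
      unfolding eq using empty box[of l u] box_ne_empty(2)[of l u] by (cases "box l u = {}") auto
  next
    case empty
    then show ?case using assms(3) by simp
  next
    case (compl B)
    then have "P (cell - (B \<inter> cell))"
      by (intro assms(4)) (auto simp: sets[symmetric])
    then show ?case by (simp add: Diff_Int Diff_eq Int_Un_distrib Int_commute)
  next
    case (union B)
    have "P (\<Union>i. B i \<inter> cell)"
      using union by (intro assms(5)) (auto simp: sets[symmetric] disjoint_family_on_def)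
    then show ?case by simp
  qed
qed

text \<open>The set induction covers Borel sets only; level sets of a Borel representative bring
  Lebesgue measurable functions within its reach.\<close>

lemma torus_measurable_borel_ex:
  fixes w :: "'a::euclidean_space \<Rightarrow> real"
  assumes "w \<in> borel_measurable torus"
  obtains w' where "w' \<in> borel_measurable borel" "AE x in torus. w x = w' x"
proof -
  have "(\<lambda>x. w x * indicator cell x) \<in> borel_measurable lebesgue"
    using assms by (subst (asm) borel_measurable_restrict_space_iff) (auto simp: mult.commute)
  then obtain w' where w': "w' \<in> borel_measurable lborel"
    "AE x in lborel. w x * indicator cell x = w' x"
    using completion_ex_borel_measurable_real by blast
  have "AE x in lebesgue. w x * indicator cell x = w' x" by (rule AE_completion[OF w'(2)])
  then have "AE x in torus. w x = w' x"
    by (subst AE_restrict_space_iff) (auto elim!: eventually_mono)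
  with w'(1) that show ?thesis by auto
qed

section \<open>Uniqueness of Fourier coefficients\<close>

lemma integrable_mult_trig:
  assumes "integrable torus w" "trig p"
  shows "integrable torus (\<lambda>x. complex_of_real (w x) * p x)"
proof -
  obtain C where C: "\<And>x. norm (p x) \<le> C" "C > 0" using trig_bounded[OF assms(2)] by blast
  have [measurable]: "p \<in> borel_measurable torus" "w \<in> borel_measurable torus"
    using assms measurable_trig_torus by auto
  show ?thesis
    using C by (intro Bochner_Integration.integrable_bound[OF integrable_mult_right[OF assms(1), of C]])
      (auto simp: norm_mult abs_mult mult.commute[of C] intro!: AE_I2 mult_left_mono)
qed

lemma integral_mult_trig_eq_0:
  assumes w: "integrable torus w"
    and 0: "\<And>k. k \<in> lat \<Longrightarrow> (LINT x|torus. complex_of_real (w x) * ek k x) = 0"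
    and p: "trig p"
  shows "(LINT x|torus. complex_of_real (w x) * p x) = 0"
proof -
  obtain F c where F: "finite F" "F \<subseteq> lat" "p = (\<lambda>x. \<Sum>k\<in>F. c k * ek k x)"
    using p by (auto simp: trig_def)
  have "(\<lambda>x. complex_of_real (w x) * p x) = (\<lambda>x. \<Sum>k\<in>F. c k * (complex_of_real (w x) * ek k x))"
    by (simp add: F sum_distrib_left mult_ac)
  moreover have "integrable torus (\<lambda>x. complex_of_real (w x) * ek k x)" if "k \<in> F" for k
    using integrable_mult_trig[OF w] trig_cmult_ek[of k 1] F(2) that by auto
  ultimately show ?thesis
    using F 0 by (auto simp: Bochner_Integration.integral_sum subset_iff intro!: sum.neutral)
qed

text \<open>Integrability alone is assumed, and no summability kernel is used: integrals against
  trigonometric polynomials vanish, hence integrals over boxes, hence over all Borel subsets of the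
  cell, and the sets where \<open>w\<close> has a sign must be null.\<close>

theorem fourier_uniqueness:
  fixes w :: "'a::euclidean_space \<Rightarrow> real"
  assumes w: "integrable torus w"
    and 0: "\<And>k. k \<in> lat \<Longrightarrow> (LINT x|torus. complex_of_real (w x) * ek k x) = 0"
  shows "AE x in torus. w x = 0"
proof -
  note [measurable] = borel_measurable_integrable[OF w]
  have torus_sets: "A \<in> sets borel \<Longrightarrow> A \<inter> cell \<in> sets torus" for A :: "'a set"
    by (subst sets_restrict_space_iff) auto
  have set_int: "set_integrable torus A w" if "A \<in> sets torus" for A
    using that w unfolding set_integrable_def by (rule integrable_mult_indicator)
  have all: "(LINT x|torus. w x) = 0"
    using 0[of 0] integral_complex_of_real[of torus w] by simp
  have Z: "(LINT x:A \<inter> cell|torus. w x) = 0" if "A \<in> sets borel" for A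
    using that
  proof (induct rule: cell_borel_induct)
    case (box l u)
    obtain p where p: "\<And>n. trig (p n)" "\<And>n x. norm (p n x) \<le> 2 ^ DIM('a)"
      "\<And>x. x \<in> cell \<Longrightarrow> (\<lambda>n. p n x) \<longlonglongrightarrow> indicator (box l u) x"
      using trig_approx_box[OF box] by blast
    have [measurable]: "p n \<in> borel_measurable torus" for n using p(1) measurable_trig_torus by blast
    have [measurable]: "(indicator (box l u) :: 'a \<Rightarrow> real) \<in> borel_measurable torus"
      by (intro measurable_restrict_space1 borel_measurable_indicator) auto
    have "(\<lambda>n. LINT x|torus. complex_of_real (w x) * p n x) \<longlonglongrightarrow>
        (LINT x|torus. complex_of_real (w x) * complex_of_real (indicator (box l u) x))"
    proof (rule integral_dominated_convergence[where w = "\<lambda>x. 2 ^ DIM('a) * \<bar>w x\<bar>"])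
      show "AE x in torus. (\<lambda>n. complex_of_real (w x) * p n x) \<longlonglongrightarrow>
          complex_of_real (w x) * complex_of_real (indicator (box l u) x)"
      proof (intro AE_I2 tendsto_mult tendsto_const)
        fix x :: 'a assume "x \<in> space torus"
        moreover have "complex_of_real (indicator (box l u) x) = indicator (box l u) x"
          by (simp add: indicator_def)
        ultimately show "(\<lambda>n. p n x) \<longlonglongrightarrow> complex_of_real (indicator (box l u) x)"
          using p(3)[of x] by simp
      qed
      show "AE x in torus. norm (complex_of_real (w x) * p n x) \<le> 2 ^ DIM('a) * \<bar>w x\<bar>" for n
        using p(2) by (auto simp: norm_mult mult.commute intro!: mult_left_mono)
    qed (use w in auto)
    then have "(LINT x|torus. complex_of_real (w x * indicator (box l u) x)) = 0"
      using integral_mult_trig_eq_0[OF w 0 p(1)] by (simp add: LIMSEQ_const_iff)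
    then show ?case
      unfolding set_lebesgue_integral_def integral_complex_of_real by (simp add: mult.commute)
  next
    case (compl A)
    have "A \<in> sets torus" using torus_sets[of A] compl by (simp add: inf.absorb1)
    moreover have "cell \<in> sets torus" using sets.top[of torus] by simp
    ultimately have "(LINT x:cell|torus. w x) = (LINT x:A|torus. w x) + (LINT x:cell - A|torus. w x)"
      using compl(2) set_integral_Un[of A "cell - A" torus w] set_int
      by (simp add: Un_absorb1 sets.Diff)
    moreover have "(LINT x:cell|torus. w x) = 0"
      using all set_integral_space[OF w] by simp
    ultimately show ?case using compl by simp
  next
    case (union A)
    have "A i \<in> sets torus" for i using torus_sets[of "A i"] union by (simp add: inf.absorb1)
    then have "(LINT x:(\<Union>i. A i)|torus. w x) = (\<Sum>i. LINT x:A i|torus. w x)"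
      using union(3) by (intro lebesgue_integral_countable_add set_int)
        (auto simp: disjoint_family_on_def)
    then show ?case using union by simp
  qed (simp add: set_lebesgue_integral_def)
  obtain w' where w' [measurable]: "w' \<in> borel_measurable borel" and ae: "AE x in torus. w x = w' x"
    using torus_measurable_borel_ex[of w] by auto
  \<comment> \<open>The factor \<open>s\<close> is a sign: 1 excludes positive values of
    \<open>w'\<close> and -1 negative ones.\<close>
  have half: "AE x in torus. \<not> s * w' x > 0" if "s = 1 \<or> s = -1" for s :: real
  proof -
    define A where "A = {x. s * w' x > 0}"
    have A: "A \<in> sets borel" unfolding A_def by measurable
    have At: "A \<inter> cell \<in> sets torus" by (rule torus_sets[OF A])
    have i: "integrable torus (\<lambda>x. indicator (A \<inter> cell) x * (s * w x))"
      using integrable_mult_right[OF set_int[OF At, unfolded set_integrable_def], of s]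
      by (simp add: mult_ac)
    have nn: "AE x in torus. 0 \<le> indicator (A \<inter> cell) x * (s * w x)"
      using ae by eventually_elim (auto simp: A_def indicator_def)
    have "(LINT x|torus. indicator (A \<inter> cell) x * (s * w x)) = s * (LINT x:A \<inter> cell|torus. w x)"
      by (simp add: set_lebesgue_integral_def mult_ac flip: integral_mult_right_zero)
    also have "\<dots> = 0" using Z[OF A] by simp
    finally have "AE x in torus. indicator (A \<inter> cell) x * (s * w x) = 0"
      using integral_nonneg_eq_0_iff_AE[OF i nn] by simp
    then show ?thesis
      using ae AE_space by eventually_elim (auto simp: A_def indicator_def)
  qed
  show ?thesis
    using half[OF disjI1[OF refl]] half[OF disjI2[OF refl]] ae by eventually_elim auto
qed

section \<open>Square integrable functions\<close>

definition L2 :: "('a::euclidean_space \<Rightarrow> 'b::{real_normed_vector,second_countable_topology}) \<Rightarrow> bool" where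
  "L2 u \<longleftrightarrow> u \<in> borel_measurable torus \<and> integrable torus (\<lambda>x. (norm (u x))\<^sup>2)"

text \<open>The squared norm, which avoids square roots; the price is the factor 2 in
  \<open>nsq_add\<close> in place of the triangle inequality.\<close>

definition nsq :: "('a::euclidean_space \<Rightarrow> 'b::{real_normed_vector,second_countable_topology}) \<Rightarrow> real" where
  "nsq u = (LINT x|torus. (norm (u x))\<^sup>2)"

lemma norm_add_sq_le: "(norm (a + b))\<^sup>2 \<le> 2 * (norm a)\<^sup>2 + 2 * (norm b)\<^sup>2"
  for a b :: "'b::real_normed_vector"
proof -
  have "(norm (a + b))\<^sup>2 \<le> (norm a + norm b)\<^sup>2"
    by (intro power_mono norm_triangle_ineq norm_ge_zero)
  also have "\<dots> \<le> 2 * (norm a)\<^sup>2 + 2 * (norm b)\<^sup>2"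
    using sum_squares_bound[of "norm a" "norm b"] by (simp add: power2_sum)
  finally show ?thesis .
qed

lemma L2_measurable: "L2 u \<Longrightarrow> u \<in> borel_measurable torus"
  and L2_integrable_sq: "L2 u \<Longrightarrow> integrable torus (\<lambda>x. (norm (u x))\<^sup>2)"
  by (auto simp: L2_def)

lemma L2_add: "L2 u \<Longrightarrow> L2 v \<Longrightarrow> L2 (\<lambda>x. u x + v x)"
  and nsq_add: "L2 u \<Longrightarrow> L2 v \<Longrightarrow> nsq (\<lambda>x. u x + v x) \<le> 2 * nsq u + 2 * nsq v"
proof -
  assume u: "L2 u" and v: "L2 v"
  note [measurable] = L2_measurable[OF u] L2_measurable[OF v]
  note i = L2_integrable_sq[OF u] L2_integrable_sq[OF v]
  have b: "integrable torus (\<lambda>x. 2 * (norm (u x))\<^sup>2 + 2 * (norm (v x))\<^sup>2)"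
    using i by auto
  have s: "integrable torus (\<lambda>x. (norm (u x + v x))\<^sup>2)"
    by (rule Bochner_Integration.integrable_bound[OF b])
      (auto intro!: AE_I2 order_trans[OF norm_add_sq_le])
  then show "L2 (\<lambda>x. u x + v x)" by (simp add: L2_def)
  have "nsq (\<lambda>x. u x + v x) \<le> (LINT x|torus. 2 * (norm (u x))\<^sup>2 + 2 * (norm (v x))\<^sup>2)"
    unfolding nsq_def by (intro integral_mono s b norm_add_sq_le)
  then show "nsq (\<lambda>x. u x + v x) \<le> 2 * nsq u + 2 * nsq v"
    using i by (simp add: nsq_def)
qed

lemma L2_scaleR: "L2 u \<Longrightarrow> L2 (\<lambda>x. c *\<^sub>R u x)"
  and nsq_scaleR: "nsq (\<lambda>x. c *\<^sub>R u x) = c\<^sup>2 * nsq u"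
  by (auto simp: L2_def nsq_def power_mult_distrib)

lemma L2_minus: "L2 u \<Longrightarrow> L2 (\<lambda>x. - u x)"
  by (auto simp: L2_def)

lemma L2_diff: "L2 u \<Longrightarrow> L2 v \<Longrightarrow> L2 (\<lambda>x. u x - v x)"
  using L2_add[OF _ L2_minus, of u v] by simp

lemma L2_of_real: "L2 u \<Longrightarrow> L2 (\<lambda>x. complex_of_real (u x))"
  by (auto simp: L2_def)

lemma nsq_nonneg: "nsq u \<ge> 0"
  by (simp add: nsq_def)

lemma L2_bounded:
  assumes "u \<in> borel_measurable torus" "\<And>x. x \<in> cell \<Longrightarrow> norm (u x) \<le> C"
  shows "L2 u"
  unfolding L2_def
proof
  show "integrable torus (\<lambda>x. (norm (u x))\<^sup>2)"
    using assms
    by (intro torus.integrable_const_bound[where B = "C\<^sup>2"]) (auto intro!: AE_I2 power_mono)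
qed (fact assms)

lemma L2_trig: "trig p \<Longrightarrow> L2 p"
  using trig_bounded[of p] by (auto intro: L2_bounded measurable_trig_torus)

lemma integrable_mult_L2:
  fixes u v :: "'a::euclidean_space \<Rightarrow> 'b::{real_normed_field,second_countable_topology,banach}"
  assumes u: "L2 u" and v: "L2 v"
  shows "integrable torus (\<lambda>x. u x * v x)"
proof -
  note [measurable] = L2_measurable[OF u] L2_measurable[OF v]
  have b: "integrable torus (\<lambda>x. (norm (u x))\<^sup>2 + (norm (v x))\<^sup>2)"
    using L2_integrable_sq[OF u] L2_integrable_sq[OF v] by auto
  show ?thesis
  proof (rule Bochner_Integration.integrable_bound[OF b])
    have "norm (u x * v x) \<le> (norm (u x))\<^sup>2 + (norm (v x))\<^sup>2" for x
      using sum_squares_bound[of "norm (u x)" "norm (v x)"]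
        mult_nonneg_nonneg[OF norm_ge_zero norm_ge_zero, of "u x" "v x"]
      unfolding norm_mult mult.assoc by linarith
    then show "AE x in torus. norm (u x * v x) \<le> norm ((norm (u x))\<^sup>2 + (norm (v x))\<^sup>2)"
      by (intro AE_I2) auto
  qed simp
qed

lemma L2_integrable: "L2 u \<Longrightarrow> integrable torus u" for u :: "'a::euclidean_space \<Rightarrow> real"
  using integrable_mult_L2[of u "\<lambda>_. 1"] L2_bounded[of "\<lambda>_. 1::real" 1] by simp

section \<open>Density of the trigonometric polynomials in real L2\<close>

definition approx :: "('a::euclidean_space \<Rightarrow> real) \<Rightarrow> bool" where
  "approx u \<longleftrightarrow> L2 u \<and> (\<forall>\<epsilon>>0. \<exists>p. trig p \<and> nsq (\<lambda>x. complex_of_real (u x) - p x) < \<epsilon>)"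

lemma approxD: "approx u \<Longrightarrow> \<epsilon> > 0 \<Longrightarrow> \<exists>p. trig p \<and> nsq (\<lambda>x. complex_of_real (u x) - p x) < \<epsilon>"
  by (auto simp: approx_def)

lemma approx_closed:
  assumes u: "L2 u" and ap: "\<And>\<epsilon>. \<epsilon> > 0 \<Longrightarrow> \<exists>v. approx v \<and> nsq (\<lambda>x. u x - v x) < \<epsilon>"
  shows "approx u"
  unfolding approx_def
proof (intro conjI allI impI u)
  fix \<epsilon> :: real assume \<epsilon>: "\<epsilon> > 0"
  \<comment> \<open>A quarter for each of the two errors, because \<open>nsq_add\<close> doubles
    both.\<close>
  obtain v where v: "approx v" "nsq (\<lambda>x. u x - v x) < \<epsilon> / 4" using ap[of "\<epsilon> / 4"] \<epsilon> by auto
  obtain p where p: "trig p" "nsq (\<lambda>x. complex_of_real (v x) - p x) < \<epsilon> / 4"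
    using approxD[OF v(1), of "\<epsilon> / 4"] \<epsilon> by auto
  have "L2 v" using v by (simp add: approx_def)
  then have "nsq (\<lambda>x. complex_of_real (u x - v x) + (complex_of_real (v x) - p x)) \<le>
      2 * nsq (\<lambda>x. complex_of_real (u x - v x)) + 2 * nsq (\<lambda>x. complex_of_real (v x) - p x)"
    using u p by (intro nsq_add L2_of_real L2_diff L2_trig)
  also have "nsq (\<lambda>x. complex_of_real (u x - v x)) = nsq (\<lambda>x. u x - v x)"
    unfolding nsq_def norm_of_real by simp
  finally show "\<exists>p. trig p \<and> nsq (\<lambda>x. complex_of_real (u x) - p x) < \<epsilon>"
    using p v by (intro exI[of _ p]) auto
qed

lemma approx_lincomb:
  assumes u: "approx u" and v: "approx v"
  shows "approx (\<lambda>x. c * u x + d * v x)"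
  unfolding approx_def
proof (intro conjI allI impI)
  have uv: "L2 u" "L2 v" using assms by (auto simp: approx_def)
  then show "L2 (\<lambda>x. c * u x + d * v x)" using L2_add[OF L2_scaleR L2_scaleR, of u v c d] by simp
  fix \<epsilon> :: real assume \<epsilon>: "\<epsilon> > 0"
  \<comment> \<open>The two errors are scaled by c^2 and d^2 and doubled by \<open>nsq_add\<close>;
    the summand 1 keeps the denominator positive when c = d = 0.\<close>
  define \<delta> where "\<delta> = \<epsilon> / (4 * (1 + c\<^sup>2 + d\<^sup>2))"
  have pos: "1 + c\<^sup>2 + d\<^sup>2 > 0" by (smt (verit) zero_le_power2)
  have \<delta>: "\<delta> > 0" using \<epsilon> pos by (simp add: \<delta>_def)
  obtain p where p: "trig p" "nsq (\<lambda>x. complex_of_real (u x) - p x) < \<delta>" using approxD[OF u \<delta>] by auto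
  obtain q where q: "trig q" "nsq (\<lambda>x. complex_of_real (v x) - q x) < \<delta>" using approxD[OF v \<delta>] by auto
  have t: "trig (\<lambda>x. c * p x + d * q x)"
    by (intro trig_add trig_mult[OF trig_const] p q)
  have eq: "(\<lambda>x. complex_of_real (c * u x + d * v x) - (c * p x + d * q x)) =
      (\<lambda>x. c *\<^sub>R (complex_of_real (u x) - p x) + d *\<^sub>R (complex_of_real (v x) - q x))"
    by (simp add: scaleR_conv_of_real algebra_simps)
  have "nsq (\<lambda>x. complex_of_real (c * u x + d * v x) - (c * p x + d * q x)) \<le>
      2 * (c\<^sup>2 * nsq (\<lambda>x. complex_of_real (u x) - p x)) + 2 * (d\<^sup>2 * nsq (\<lambda>x. complex_of_real (v x) - q x))"
    unfolding eq nsq_scaleR[symmetric] using uv p q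
    by (intro nsq_add L2_scaleR L2_diff L2_of_real L2_trig)
  also have "\<dots> \<le> 2 * (c\<^sup>2 * \<delta>) + 2 * (d\<^sup>2 * \<delta>)"
    using p q by (intro add_mono mult_left_mono) auto
  also have "\<dots> = 2 * (c\<^sup>2 + d\<^sup>2) * \<delta>" by (simp add: algebra_simps)
  also have "\<dots> < 4 * (1 + c\<^sup>2 + d\<^sup>2) * \<delta>"
    using \<delta> zero_le_power2[of c] zero_le_power2[of d]
    by (intro mult_strict_right_mono) (auto simp: algebra_simps intro!: add_strict_increasing)
  also have "\<dots> = \<epsilon>" using pos by (simp add: \<delta>_def)
  finally show "\<exists>p. trig p \<and> nsq (\<lambda>x. complex_of_real (c * u x + d * v x) - p x) < \<epsilon>"
    using t by blast
qed

lemma nsq_tendsto_0: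
  assumes u: "L2 u" and v: "\<And>n. v n \<in> borel_measurable torus"
    and lim: "AE x in torus. (\<lambda>n. v n x) \<longlonglongrightarrow> u x"
    and b: "AE x in torus. \<forall>n. norm (v n x) \<le> norm (u x)"
  shows "(\<lambda>n. nsq (\<lambda>x. u x - v n x)) \<longlonglongrightarrow> 0"
proof -
  note [measurable] = L2_measurable[OF u] v
  have "(\<lambda>n. LINT x|torus. (norm (u x - v n x))\<^sup>2) \<longlonglongrightarrow> (LINT x|(torus::'a measure). 0)"
  proof (rule integral_dominated_convergence[where w = "\<lambda>x. 4 * (norm (u x))\<^sup>2"])
    show "AE x in torus. (\<lambda>n. (norm (u x - v n x))\<^sup>2) \<longlonglongrightarrow> 0"
      using lim by eventually_elim (auto intro!: tendsto_eq_intros)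
    show "AE x in torus. norm ((norm (u x - v n x))\<^sup>2) \<le> 4 * (norm (u x))\<^sup>2" for n
      using b
    proof eventually_elim
      case (elim x)
      have "norm (u x - v n x) \<le> 2 * norm (u x)"
        using elim norm_triangle_ineq4[of "u x" "v n x"] by (smt (verit))
      then have "(norm (u x - v n x))\<^sup>2 \<le> (2 * norm (u x))\<^sup>2" by (intro power_mono) auto
      then show ?case by (simp add: power_mult_distrib)
    qed
  qed (use L2_integrable_sq[OF u] in auto)
  then show ?thesis by (simp add: nsq_def)
qed

lemma approx_limit:
  assumes "L2 u" "\<And>n. approx (v n)" "AE x in torus. (\<lambda>n. v n x) \<longlonglongrightarrow> u x"
    "AE x in torus. \<forall>n. norm (v n x) \<le> norm (u x)"
  shows "approx u"
proof (rule approx_closed[OF assms(1)])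
  have "v n \<in> borel_measurable torus" for n using assms(2) by (auto simp: approx_def L2_def)
  from nsq_tendsto_0[OF assms(1) this assms(3,4)]
  have *: "(\<lambda>n. nsq (\<lambda>x. u x - v n x)) \<longlonglongrightarrow> 0" .
  fix \<epsilon> :: real assume "\<epsilon> > 0"
  then have "\<forall>\<^sub>F n in sequentially. nsq (\<lambda>x. u x - v n x) < \<epsilon>"
    by (rule order_tendstoD(2)[OF *])
  then obtain n where "nsq (\<lambda>x. u x - v n x) < \<epsilon>" using eventually_happens' sequentially_bot by blast
  with assms(2) show "\<exists>v. approx v \<and> nsq (\<lambda>x. u x - v x) < \<epsilon>" by blast
qed

lemma approx_cong_AE:
  assumes "approx v" "u \<in> borel_measurable torus" "AE x in torus. u x = v x"
  shows "approx u"
proof (rule approx_limit[where v = "\<lambda>_. v"])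
  have "L2 v" using assms by (simp add: approx_def)
  then have "integrable torus (\<lambda>x. (norm (u x))\<^sup>2)"
    using assms(2,3) by (subst integrable_cong_AE[where g = "\<lambda>x. (norm (v x))\<^sup>2"]) (auto simp: L2_def)
  then show "L2 u" using assms(2) by (simp add: L2_def)
qed (use assms in auto)

lemma L2_indicator:
  "A \<in> sets torus \<Longrightarrow> L2 (indicator A :: 'a::euclidean_space \<Rightarrow> real)"
  by (rule L2_bounded[where C = 1]) (auto simp: indicator_def)

lemma approx_const_1: "approx (indicator cell)"
proof -
  have "L2 (indicator cell :: 'a \<Rightarrow> real)" 
    by (rule L2_bounded[where C = 1]) (auto intro!: measurable_restrict_space1 borel_measurable_indicator)
  moreover have "nsq (\<lambda>x::'a. complex_of_real (indicator cell x) - 1) = 0"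
    unfolding nsq_def by (intro integral_eq_zero_AE AE_I2) auto
  ultimately show ?thesis
    unfolding approx_def using trig_const[of 1] by auto
qed

text \<open>The same passage from boxes to Borel sets as in \<open>fourier_uniqueness\<close>, with
  L2 approximation in place of vanishing integrals. A countable union is the L2 limit of its finite
  partial unions.\<close>

lemma approx_indicator_borel:
  fixes A :: "'a::euclidean_space set"
  assumes "A \<in> sets borel"
  shows "approx (indicator (A \<inter> cell))"
proof -
  have torus_sets: "A \<inter> cell \<in> sets torus" if "A \<in> sets borel" for A :: "'a set"
    using that by (subst sets_restrict_space_iff) auto
  show ?thesis
    using assms
  proof (induct rule: cell_borel_induct)
    case (box l u)
    obtain p where p: "\<And>n. trig (p n)" "\<And>n x. norm (p n x) \<le> 2 ^ DIM('a)"
      "\<And>x. x \<in> cell \<Longrightarrow> (\<lambda>n. p n x) \<longlonglongrightarrow> indicator (box l u) x"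
      using trig_approx_box[OF box] by blast
    have [measurable]: "p n \<in> borel_measurable torus" for n using p(1) measurable_trig_torus by blast
    have [measurable]: "(indicator (box l u) :: 'a \<Rightarrow> real) \<in> borel_measurable torus"
      by (intro measurable_restrict_space1 borel_measurable_indicator) auto
    have L: "L2 (indicator (box l u) :: 'a \<Rightarrow> real)"
      by (rule L2_bounded[where C = 1]) (auto simp: indicator_def)
    have "(\<lambda>n. LINT x|torus. (norm (complex_of_real (indicator (box l u) x) - p n x))\<^sup>2) \<longlonglongrightarrow>
        (LINT x|(torus::'a measure). 0)"
    proof (rule integral_dominated_convergence[where w = "\<lambda>_. (1 + 2 ^ DIM('a))\<^sup>2"])
      show "AE x in torus. (\<lambda>n. (norm (complex_of_real (indicator (box l u) x) - p n x))\<^sup>2) \<longlonglongrightarrow> 0"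
      proof (intro AE_I2)
        fix x :: 'a assume "x \<in> space torus"
        moreover have "complex_of_real (indicator (box l u) x) = indicator (box l u) x"
          by (simp add: indicator_def)
        ultimately have "(\<lambda>n. p n x) \<longlonglongrightarrow> complex_of_real (indicator (box l u) x)"
          using p(3)[of x] by simp
        then show "(\<lambda>n. (norm (complex_of_real (indicator (box l u) x) - p n x))\<^sup>2) \<longlonglongrightarrow> 0"
          by (auto intro!: tendsto_eq_intros)
      qed
      show "AE x in torus. norm ((norm (complex_of_real (indicator (box l u) x) - p n x))\<^sup>2) \<le>
          (1 + 2 ^ DIM('a))\<^sup>2" for n
      proof (intro AE_I2)
        fix x :: 'a
        have "norm (complex_of_real (indicator (box l u) x) - p n x) \<le>
            norm (complex_of_real (indicator (box l u) x)) + norm (p n x)"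
          by (rule norm_triangle_ineq4)
        also have "\<dots> \<le> 1 + 2 ^ DIM('a)"
          using p(2) by (intro add_mono) (auto simp: indicator_def)
        finally show "norm ((norm (complex_of_real (indicator (box l u) x) - p n x))\<^sup>2) \<le>
            (1 + 2 ^ DIM('a))\<^sup>2" by (simp add: power_mono)
      qed
    qed auto
    then have *: "(\<lambda>n. nsq (\<lambda>x. complex_of_real (indicator (box l u) x) - p n x)) \<longlonglongrightarrow> 0"
      by (simp add: nsq_def)
    show ?case
      unfolding approx_def
    proof (intro conjI L allI impI)
      fix \<epsilon> :: real assume "\<epsilon> > 0"
      then have "\<forall>\<^sub>F n in sequentially. nsq (\<lambda>x. complex_of_real (indicator (box l u) x) - p n x) < \<epsilon>"
        by (rule order_tendstoD(2)[OF *])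
      then obtain n where "nsq (\<lambda>x. complex_of_real (indicator (box l u) x) - p n x) < \<epsilon>"
        using eventually_happens' sequentially_bot by blast
      with p(1) show "\<exists>p. trig p \<and> nsq (\<lambda>x. complex_of_real (indicator (box l u) x) - p x) < \<epsilon>"
        by blast
    qed
  next
    case empty
    show ?case using approx_lincomb[OF approx_const_1 approx_const_1, of 0 0] by (simp add: indicator_def)
  next
    case (compl A)
    have "(\<lambda>x. 1 * indicator cell x + - 1 * indicator A x) = (indicator (cell - A) :: 'a \<Rightarrow> real)"
      using compl by (auto simp: indicator_def fun_eq_iff)
    then show ?case using approx_lincomb[OF approx_const_1 compl(3), of 1 "-1"] by simp
  next
    case (union A)
    have At: "A i \<in> sets torus" for i using torus_sets[of "A i"] union by (simp add: inf.absorb1)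
    have fin: "approx (indicator (\<Union>i<n. A i))" for n :: nat
    proof (induct n)
      case 0
      show ?case using approx_lincomb[OF approx_const_1 approx_const_1, of 0 0] by (simp add: indicator_def)
    next
      case (Suc n)
      have "A n \<inter> A i = {}" if "i < n" for i
        using union(3) that by (simp add: disjoint_family_on_def)
      then have "A n \<inter> (\<Union>i<n. A i) = {}" by blast
      then have "(\<lambda>x. 1 * indicator (\<Union>i<n. A i) x + 1 * indicator (A n) x) =
          (indicator (\<Union>i<Suc n. A i) :: 'a \<Rightarrow> real)"
        by (auto simp: indicator_def fun_eq_iff lessThan_Suc)
      then show ?case using approx_lincomb[OF Suc union(4)[of n], of 1 1] by simp
    qed
    show ?case
    proof (rule approx_limit[OF _ fin])
      show "L2 (indicator (\<Union>i. A i) :: 'a \<Rightarrow> real)" using At by (intro L2_indicator) auto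
      show "AE x in torus. (\<lambda>n. indicator (\<Union>i<n. A i) x :: real) \<longlonglongrightarrow> indicator (\<Union>i. A i) x"
        using LIMSEQ_indicator_UN[of A] by (intro AE_I2)
      show "AE x in torus. \<forall>n. norm (indicator (\<Union>i<n. A i) x :: real) \<le> norm (indicator (\<Union>i. A i) x :: real)"
        by (intro AE_I2) (auto simp: indicator_def)
    qed
  qed
qed

lemma approx_indicator:
  fixes A :: "'a::euclidean_space set"
  assumes "A \<in> sets torus"
  shows "approx (indicator A)"
proof -
  have m: "(indicator A :: 'a \<Rightarrow> real) \<in> borel_measurable torus" using assms by simp
  obtain w where w: "w \<in> borel_measurable borel" "AE x in torus. (indicator A x :: real) = w x"
    using torus_measurable_borel_ex[OF m] by blast
  have "{x. w x = 1} \<in> sets borel" using w(1) by measurable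
  from approx_indicator_borel[OF this] show ?thesis
    by (rule approx_cong_AE[OF _ m])
      (use w(2) AE_space in \<open>eventually_elim, auto simp: indicator_def of_bool_def split: if_splits\<close>)
qed

text \<open>Square integrability is a premise of the claim under induction, so each case must
  recover it for the pieces: summands and approximants are nonnegative and lie below the whole
  function.\<close>

lemma approx_nonneg:
  fixes u :: "'a::euclidean_space \<Rightarrow> real"
  assumes u: "u \<in> borel_measurable torus" "\<And>x. u x \<ge> 0" "L2 u"
  shows "approx u"
  using u
proof (induct rule: borel_measurable_induct_real)
  case (set A)
  then show ?case by (intro approx_indicator)
next
  case (mult u c)
  show ?case
  proof (cases "c = 0")
    case True
    then show ?thesis using approx_lincomb[OF approx_const_1 approx_const_1, of 0 0] by simp
  next
    case False
    then have "L2 u" using L2_scaleR[OF mult(5), of "1 / c"] by simp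
    then have "approx u" using mult by auto
    from approx_lincomb[OF this this, of c 0] show ?thesis by simp
  qed
next
  case (add u v)
  have le: "L2 w" if "w \<in> borel_measurable torus" "\<And>x. 0 \<le> w x" "\<And>x. w x \<le> v x + u x" for w
    unfolding L2_def
  proof
    show "integrable torus (\<lambda>x. (norm (w x))\<^sup>2)"
      using that by (intro Bochner_Integration.integrable_bound[OF L2_integrable_sq[OF add(8)]])
        (auto intro!: AE_I2 power_mono)
  qed (fact that)
  have "approx u" "approx v" using add le by auto
  from approx_lincomb[OF this(2,1), of 1 1] show ?case by simp
next
  case (seq U)
  have lim: "(\<lambda>n. U n x) \<longlonglongrightarrow> u x" if "x \<in> cell" for x using seq(5)[of x] that by simp
  have le: "U n x \<le> u x" if "x \<in> cell" for n x
    using incseq_le[OF _ lim[OF that], of n] seq(4) by (auto simp: incseq_def le_fun_def)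
  have "L2 (U n)" for n
    unfolding L2_def
  proof
    show "integrable torus (\<lambda>x. (norm (U n x))\<^sup>2)"
      using seq(1,2) le
      by (intro Bochner_Integration.integrable_bound[OF L2_integrable_sq[OF seq(6)]])
        (auto intro!: AE_I2 power_mono order_trans[OF le abs_ge_self])
  qed (fact seq)
  then have "approx (U n)" for n using seq by auto
  then show ?case
    by (rule approx_limit[OF seq(6)]) (use lim le seq(2) in \<open>auto intro!: AE_I2 intro: order_trans[OF le abs_ge_self]\<close>)
qed

theorem L2_approx:
  assumes "L2 u" shows "approx u"
proof -
  note [measurable] = L2_measurable[OF assms]
  have L: "L2 (\<lambda>x. max 0 (s * u x))" if "s = 1 \<or> s = -1" for s
    unfolding L2_def
    by (safe, measurable, rule Bochner_Integration.integrable_bound[OF L2_integrable_sq[OF assms]])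
      (use that in \<open>auto simp: power2_eq_square max_def mult_le_0_iff\<close>)
  have "approx (\<lambda>x. max 0 (1 * u x))" "approx (\<lambda>x. max 0 (- 1 * u x))"
    by (intro approx_nonneg L; simp)+
  from approx_lincomb[OF this, of 1 "-1"] show ?thesis
    by (rule approx_cong_AE) (auto simp: max_def)
qed

section \<open>Weak derivatives of periodic functions\<close>

text \<open>\<open>torus_deriv e u v\<close> states, on the Fourier side, that \<open>v\<close> is the weak derivative of
  \<open>u\<close> in direction \<open>e\<close> on the torus.\<close>

definition torus_deriv :: "'a::euclidean_space \<Rightarrow> ('a \<Rightarrow> real) \<Rightarrow> ('a \<Rightarrow> real) \<Rightarrow> bool" where
  "torus_deriv e u v \<longleftrightarrow> (\<forall>k\<in>lat. (LINT x|torus. complex_of_real (v x) * ek k x) =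
     - \<i> * (k \<bullet> e) * (LINT x|torus. complex_of_real (u x) * ek k x))"


section \<open>A periodic partition of unity and localization to the cell\<close>

lemma shift_lat: "k \<in> lat \<Longrightarrow> S \<subseteq> Basis \<Longrightarrow> \<exists>n::int. k \<bullet> shift S = 2 * pi * n"
proof -
  assume k: "k \<in> lat" and S: "S \<subseteq> Basis"
  have "(\<Sum>b\<in>S. k \<bullet> b) \<in> \<int>" using k S by (intro Ints_sum) (auto simp: lat_def)
  then obtain n where "(\<Sum>b\<in>S. k \<bullet> b) = of_int n" by (auto elim: Ints_cases)
  then show ?thesis by (intro exI[of _ n]) (simp add: shift_def inner_sum_right)
qed

lemma cos_shift: "k \<in> lat \<Longrightarrow> S \<subseteq> Basis \<Longrightarrow> cos (k \<bullet> (x - shift S) + c) = cos (k \<bullet> x + c)"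
proof -
  assume "k \<in> lat" "S \<subseteq> Basis"
  then obtain n :: int where n: "k \<bullet> shift S = 2 * pi * n" using shift_lat by blast
  have "k \<bullet> (x - shift S) + c = k \<bullet> x + c - 2 * pi * n" by (simp add: inner_diff_right n)
  then show ?thesis by (simp only: cos_diff cos_int_2pin sin_int_2pin)
qed

text \<open>A partition of unity for the period lattice. A periodic function times
  \<open>cutoff\<close> has compact support, and its integral over the whole space equals the
  integral of the periodic function over one cell.\<close>

definition cutoff :: "'a::euclidean_space \<Rightarrow> real" where
  "cutoff x = (\<Prod>b\<in>Basis. hat (x \<bullet> b))"

lemma Ck_cutoff: "Ck k cutoff"
  unfolding cutoff_def[abs_def]
proof (rule Ck_prod)
  show "Ck k (\<lambda>x. hat (x \<bullet> b))" for b :: 'a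
    using Ck_inner_comp[OF Ck_hat, of k b 0] by (simp add: inner_commute)
qed

lemma cutoff_support:
  fixes x :: "'a::euclidean_space"
  assumes "x \<notin> cbox (- (2 * pi) *\<^sub>R One) ((2 * pi) *\<^sub>R One)"
  shows "cutoff x = 0"
proof -
  obtain b where b: "b \<in> Basis" "x \<bullet> b \<notin> {- (2 * pi)..2 * pi}"
    using assms by (auto simp: mem_box)
  then have "hat (x \<bullet> b) = 0" by (intro hat_eq_0) auto
  with b(1) show ?thesis unfolding cutoff_def by (intro prod_zero) auto
qed

text \<open>Expanding the product over the basis of hat(x_b) + hat(x_b - 2 pi) yields one term for
  each set of shifted coordinates, and every factor is 1 by \<open>hat_sum\<close>.\<close>

lemma cutoff_sum:
  fixes x :: "'a::euclidean_space"
  assumes "x \<in> cell"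
  shows "(\<Sum>S\<in>Pow Basis. cutoff (x - shift S)) = 1"
proof -
  have "cutoff (x - shift S) = (\<Prod>b\<in>S. hat (x \<bullet> b - 2 * pi)) * (\<Prod>b\<in>Basis - S. hat (x \<bullet> b))"
    if "S \<subseteq> Basis" for S
  proof -
    have "cutoff (x - shift S) = (\<Prod>b\<in>S. hat ((x - shift S) \<bullet> b)) * (\<Prod>b\<in>Basis - S. hat ((x - shift S) \<bullet> b))"
      unfolding cutoff_def using prod.subset_diff[OF that finite_Basis] by (simp add: mult.commute)
    moreover have "(\<Prod>b\<in>S. hat ((x - shift S) \<bullet> b)) = (\<Prod>b\<in>S. hat (x \<bullet> b - 2 * pi))"
      using that by (intro prod.cong refl) (auto simp: inner_diff_left shift_inner subset_iff)
    moreover have "(\<Prod>b\<in>Basis - S. hat ((x - shift S) \<bullet> b)) = (\<Prod>b\<in>Basis - S. hat (x \<bullet> b))"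
      using that by (intro prod.cong refl) (auto simp: inner_diff_left shift_inner)
    ultimately show ?thesis by simp
  qed
  then have "(\<Sum>S\<in>Pow Basis. cutoff (x - shift S)) =
      (\<Sum>S\<in>Pow Basis. (\<Prod>b\<in>S. hat (x \<bullet> b - 2 * pi)) * (\<Prod>b\<in>Basis - S. hat (x \<bullet> b)))"
    by (intro sum.cong) auto
  also have "\<dots> = (\<Prod>b\<in>Basis. hat (x \<bullet> b - 2 * pi) + hat (x \<bullet> b))"
    by (rule prod_add[symmetric]) simp
  also have "\<dots> = 1"
    using assms hat_sum by (intro prod.neutral) (auto simp: mem_cell add.commute less_imp_le)
  finally show ?thesis .
qed

text \<open>Unlike \<open>cutoff\<close> this function is supported in the closed cell and positive
  on the open one: it turns cosines into test functions there, and dividing by it loses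
  nothing.\<close>

definition bump :: "'a::euclidean_space \<Rightarrow> real" where
  "bump x = (\<Prod>b\<in>Basis. flat 1 (x \<bullet> b) * flat 1 (2 * pi - x \<bullet> b))"

lemma Ck_bump: "Ck k bump"
  unfolding bump_def[abs_def]
proof (intro Ck_prod Ck_mult)
  show "Ck k (\<lambda>x. flat 1 (x \<bullet> b))" "Ck k (\<lambda>x. flat 1 (2 * pi - x \<bullet> b))" for b :: 'a
    using Ck_inner_comp[OF Ck_flat, of k 1 b 0] Ck_inner_comp[OF Ck_flat, of k 1 "- b" "2 * pi"]
    by (simp_all add: inner_commute)
qed

lemma bump_eq_0:
  fixes x :: "'a::euclidean_space"
  assumes "x \<notin> cell" shows "bump x = 0"
proof -
  obtain b where b: "b \<in> Basis" "x \<bullet> b \<le> 0 \<or> 2 * pi - x \<bullet> b \<le> 0"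
    using assms by (fastforce simp: mem_cell)
  then have "flat 1 (x \<bullet> b) * flat 1 (2 * pi - x \<bullet> b) = 0" by (auto simp: flat_1(3))
  with b(1) show ?thesis unfolding bump_def by (intro prod_zero) auto
qed

lemma bump_pos: "x \<in> cell \<Longrightarrow> bump x > 0"
  unfolding bump_def by (intro prod_pos) (auto simp: mem_cell flat_1(1))

lemma test_function_bump: "test_function bump"
  by (rule test_functionI[OF Ck_bump, of "cbox 0 ((2 * pi) *\<^sub>R One)"])
    (use bump_eq_0 box_subset_cbox in \<open>auto simp: cell_def\<close>)

lemma test_function_cutoff: "test_function cutoff"
  by (rule test_functionI[OF Ck_cutoff, of "cbox (- (2 * pi) *\<^sub>R One) ((2 * pi) *\<^sub>R One)"])
    (use cutoff_support in auto)

lemma locally_integrable_mult: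
  fixes u :: "'a::euclidean_space \<Rightarrow> real"
  assumes u: "locally_integrable u" and g: "continuous_on UNIV g"
    and K: "compact K" "\<And>x. x \<notin> K \<Longrightarrow> g x = 0"
  shows "integrable lebesgue (\<lambda>x. u x * g x)"
proof -
  have Ks: "K \<in> sets lebesgue" using K(1) by (simp add: lmeasurable_compact fmeasurableD)
  have uK: "integrable lebesgue (\<lambda>x. indicator K x *\<^sub>R u x)"
    using u K Ks unfolding locally_integrable_def by (subst integrable_restrict_space[symmetric]) auto
  obtain C where C: "\<And>x. x \<in> K \<Longrightarrow> norm (g x) \<le> C"
    using compact_imp_bounded[OF compact_continuous_image[OF continuous_on_subset[OF g] K(1)]]
    by (auto simp: bounded_iff)
  have gm: "g \<in> borel_measurable lebesgue"
    using borel_measurable_continuous_onI[OF g] by (intro measurable_completion) simp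
  have "integrable lebesgue (\<lambda>x. (indicator K x *\<^sub>R u x) * g x)"
  proof (rule Bochner_Integration.integrable_bound[OF integrable_mult_right[OF uK, of C]])
    show "(\<lambda>x. (indicator K x *\<^sub>R u x) * g x) \<in> borel_measurable lebesgue"
      using gm borel_measurable_integrable[OF uK] by (rule borel_measurable_times[rotated])
    show "AE x in lebesgue. norm ((indicator K x *\<^sub>R u x) * g x) \<le> norm (C * (indicator K x *\<^sub>R u x))"
    proof (intro AE_I2)
      fix x :: 'a
      show "norm ((indicator K x *\<^sub>R u x) * g x) \<le> norm (C * (indicator K x *\<^sub>R u x))"
      proof (cases "x \<in> K")
        case True
        then have "\<bar>u x\<bar> * \<bar>g x\<bar> \<le> \<bar>u x\<bar> * \<bar>C\<bar>" using C[of x] by (intro mult_left_mono) auto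
        then show ?thesis using True by (simp add: abs_mult mult.commute)
      qed simp
    qed
  qed
  moreover have "(\<lambda>x. (indicator K x *\<^sub>R u x) * g x) = (\<lambda>x. u x * g x)"
  proof
    show "(indicator K x *\<^sub>R u x) * g x = u x * g x" for x
      using K(2)[of x] by (auto simp: indicator_def)
  qed
  ultimately show ?thesis by (simp only:)
qed

lemma integrable_test:
  assumes "locally_integrable u" "test_function \<phi>"
  shows "integrable lebesgue (\<lambda>x. u x * \<phi> x)"
    and "e \<in> Basis \<Longrightarrow> integrable lebesgue (\<lambda>x. u x * frechet_derivative \<phi> (at x) e)"
proof -
  obtain K where K: "compact K" "\<And>x. x \<notin> K \<Longrightarrow> \<phi> x = 0" using test_functionD(4)[OF assms(2)] by blast
  show "integrable lebesgue (\<lambda>x. u x * \<phi> x)"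
    by (rule locally_integrable_mult[OF assms(1) test_functionD(1)[OF assms(2)] K])
  show "e \<in> Basis \<Longrightarrow> integrable lebesgue (\<lambda>x. u x * frechet_derivative \<phi> (at x) e)"
    by (rule locally_integrable_mult[OF assms(1) test_functionD(3)[OF assms(2)] K(1)])
      (auto simp: frechet_derivative_support[OF K])
qed

lemma locally_integrable_torus:
  "locally_integrable u \<Longrightarrow> integrable torus u"
proof -
  assume "locally_integrable u"
  then have "integrable (lebesgue_on (cbox 0 ((2 * pi) *\<^sub>R One))) u"
    by (simp add: locally_integrable_def)
  then have i: "integrable lebesgue (\<lambda>x. indicator (cbox 0 ((2 * pi) *\<^sub>R One)) x *\<^sub>R u x)"
    by (subst (asm) integrable_restrict_space) auto
  have "integrable lebesgue (\<lambda>x. indicator cell x *\<^sub>R (indicator (cbox 0 ((2 * pi) *\<^sub>R One)) x *\<^sub>R u x))"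
    by (rule integrable_mult_indicator[OF _ i]) simp
  moreover have "(\<lambda>x. indicator cell x *\<^sub>R (indicator (cbox 0 ((2 * pi) *\<^sub>R One)) x *\<^sub>R u x)) =
      (\<lambda>x. indicator cell x *\<^sub>R u x)"
    using box_subset_cbox[of 0 "(2 * pi) *\<^sub>R One :: 'a"] by (auto simp: indicator_def cell_def fun_eq_iff)
  ultimately show ?thesis unfolding torus_integrable_iff by (simp only:)
qed

section \<open>From weak derivatives on the whole space to the torus\<close>

lemma periodic_shift:
  fixes u :: "'a::euclidean_space \<Rightarrow> real"
  assumes u: "periodic u" and S: "S \<subseteq> Basis"
  shows "AE x in lebesgue. u (x - shift S) = u x"
proof -
  have "finite S" using S finite_subset finite_Basis by blast
  then have "AE x in lebesgue. u (x + shift S) = u x"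
    using S
  proof (induct S)
    case empty
    then show ?case by (simp add: shift_def)
  next
    case (insert b S)
    have 1: "AE x in lebesgue. u (x + shift S) = u x" using insert by auto
    have "AE x in lebesgue. u (x + (2 * pi) *\<^sub>R b) = u x"
      using u insert by (auto simp: periodic_def)
    from AE_lebesgue_translate[OF this, of "shift S"] 1
    show ?case
    proof eventually_elim
      case (elim x)
      have eq: "x + shift (insert b S) = x + shift S + (2 * pi) *\<^sub>R b"
        using insert by (simp add: shift_def algebra_simps)
      show ?case unfolding eq using elim by (simp only:)
    qed
  qed
  from AE_lebesgue_translate[OF this, of "- shift S"] show ?thesis by eventually_elim simp
qed

text \<open>Weak derivatives and the equation are real statements. Writing the sine as a cosine of
  phase -pi/2 lets one real family, indexed by the phase, produce both parts of a Fourier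
  coefficient.\<close>

lemma ek_conv_cos: "ek k x = complex_of_real (cos (k \<bullet> x)) + \<i> * complex_of_real (cos (k \<bullet> x + - (pi / 2)))"
  by (auto simp: ek_def complex_eq_iff cos_diff)

lemma integral_ek_conv_cos:
  assumes w: "integrable torus w" and k: "k \<in> lat"
  shows "(LINT x|torus. complex_of_real (w x) * ek k x) =
    complex_of_real (LINT x|torus. w x * cos (k \<bullet> x)) +
    \<i> * complex_of_real (LINT x|torus. w x * cos (k \<bullet> x + - (pi / 2)))"
    and "integrable torus (\<lambda>x. w x * cos (k \<bullet> x + c))"
proof -
  have [measurable]: "w \<in> borel_measurable torus" using w by auto
  have cm: "(\<lambda>x. cos (k \<bullet> x + c)) \<in> borel_measurable torus" for c
    by (intro measurable_restrict_space1 measurable_completion) simp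
  have i: "integrable torus (\<lambda>x. w x * cos (k \<bullet> x + c))" for c
    using cm[of c] by (intro Bochner_Integration.integrable_bound[OF w])
      (auto simp: abs_mult mult_left_le)
  then show "integrable torus (\<lambda>x. w x * cos (k \<bullet> x + c))" .
  have "(LINT x|torus. complex_of_real (w x) * ek k x) =
      (LINT x|torus. complex_of_real (w x * cos (k \<bullet> x + 0)) + \<i> * complex_of_real (w x * cos (k \<bullet> x + - (pi / 2))))"
    by (simp add: ek_conv_cos algebra_simps)
  also have "\<dots> = (LINT x|torus. complex_of_real (w x * cos (k \<bullet> x + 0))) +
      \<i> * (LINT x|torus. complex_of_real (w x * cos (k \<bullet> x + - (pi / 2))))"
    by (simp only: Bochner_Integration.integral_add[OF integrable_of_real[OF i]
        integrable_mult_right[OF integrable_of_real[OF i]]] integral_mult_right_zero)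
  also have "\<dots> = complex_of_real (LINT x|torus. w x * cos (k \<bullet> x)) +
      \<i> * complex_of_real (LINT x|torus. w x * cos (k \<bullet> x + - (pi / 2)))"
    by (simp only: integral_complex_of_real add_0_right)
  finally show "(LINT x|torus. complex_of_real (w x) * ek k x) =
    complex_of_real (LINT x|torus. w x * cos (k \<bullet> x)) +
    \<i> * complex_of_real (LINT x|torus. w x * cos (k \<bullet> x + - (pi / 2)))" .
qed

text \<open>The fundamental lemma of the calculus of variations, reduced to
  \<open>fourier_uniqueness\<close>: \<open>bump\<close> times a cosine is a test function, so every
  Fourier coefficient of \<open>w * bump\<close> vanishes.\<close>

lemma AE_torus_eq_0_if_test:
  fixes w :: "'a::euclidean_space \<Rightarrow> real"
  assumes w: "\<And>\<phi>. test_function \<phi> \<Longrightarrow> integrable lebesgue (\<lambda>x. w x * \<phi> x)"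
    "\<And>\<phi>. test_function \<phi> \<Longrightarrow> (LINT x|lebesgue. w x * \<phi> x) = 0"
  shows "AE x in torus. w x = 0"
proof -
  have ind: "indicator cell x *\<^sub>R (w x * bump x * c) = w x * (bump x * c)" for x c
    using bump_eq_0[of x] by (auto simp: indicator_def)
  have wb: "integrable torus (\<lambda>x. w x * bump x)"
    unfolding torus_integrable_iff using w(1)[OF test_function_bump] ind[of _ 1] by (simp only: mult_1_right)
  have *: "(LINT x|torus. w x * bump x * cos (k \<bullet> x + c)) = 0" for k c
    unfolding torus_integral_eq ind
    by (rule w(2)[OF test_function_mult[OF test_function_bump Ck_cos_inner]])
  have "AE x in torus. w x * bump x = 0"
  proof (rule fourier_uniqueness[OF wb])
    fix k :: 'a assume k: "k \<in> lat"
    show "(LINT x|torus. complex_of_real (w x * bump x) * ek k x) = 0"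
      unfolding integral_ek_conv_cos(1)[OF wb k] * using *[of k 0] by simp
  qed
  then show ?thesis
    using AE_space by eventually_elim (use bump_pos in \<open>force\<close>)
qed

text \<open>The definition of a weak derivative says nothing about periodicity of \<open>v\<close>.
  It is inherited from \<open>u\<close>: moving the test function by a period does not change its
  pairing with \<open>u\<close>, hence not with \<open>v\<close>.\<close>

lemma weak_deriv_shift:
  assumes u: "periodic u" and uv: "has_weak_deriv e u v" and e: "e \<in> Basis" and S: "S \<subseteq> Basis"
  shows "AE x in torus. v (x - shift S) = v x"
proof -
  have lu: "locally_integrable u" and lv: "locally_integrable v"
    and D: "\<And>\<phi>. test_function \<phi> \<Longrightarrow>
      (LINT x|lebesgue. u x * frechet_derivative \<phi> (at x) e) = - (LINT x|lebesgue. v x * \<phi> x)"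
    using uv by (auto simp: has_weak_deriv_def)
  have *: "integrable lebesgue (\<lambda>x. v (x - shift S) * \<phi> x)"
    "(LINT x|lebesgue. v (x - shift S) * \<phi> x) = (LINT x|lebesgue. v x * \<phi> x)"
    if \<phi>: "test_function \<phi>" for \<phi>
  proof -
    let ?a = "shift S"
    have \<phi>': "test_function (\<lambda>x. \<phi> (x + ?a))" by (rule test_function_translate[OF \<phi>])
    note iv = integrable_test(1)[OF lv \<phi>']
    note iu = integrable_test(2)[OF lu \<phi>' e] integrable_test(2)[OF lu \<phi> e]
    have d: "frechet_derivative (\<lambda>x. \<phi> (x + ?a)) (at x) e = frechet_derivative \<phi> (at (x + ?a)) e" for x
      using frechet_derivative_at[OF frechet_derivative_translate[OF test_functionD(2)[OF \<phi>]]] by metis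
    show "integrable lebesgue (\<lambda>x. v (x - ?a) * \<phi> x)"
      using integral_lebesgue_translate(2)[OF borel_measurable_integrable[OF iv], of "- ?a"] iv by simp
    have "(LINT x|lebesgue. v (x - ?a) * \<phi> x) = (LINT x|lebesgue. v x * \<phi> (x + ?a))"
      using integral_lebesgue_translate(1)[OF borel_measurable_integrable[OF iv], of "- ?a"] by simp
    also have "\<dots> = - (LINT x|lebesgue. u x * frechet_derivative \<phi> (at (x + ?a)) e)"
      using D[OF \<phi>'] by (simp add: d)
    also have "(LINT x|lebesgue. u x * frechet_derivative \<phi> (at (x + ?a)) e) =
        (LINT x|lebesgue. u (x - ?a) * frechet_derivative \<phi> (at x) e)"
      using integral_lebesgue_translate(1)[OF borel_measurable_integrable[OF iu(1)], of "- ?a"] by (simp add: d)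
    also have "\<dots> = (LINT x|lebesgue. u x * frechet_derivative \<phi> (at x) e)"
    proof (rule integral_cong_AE)
      show "(\<lambda>x. u (x - ?a) * frechet_derivative \<phi> (at x) e) \<in> borel_measurable lebesgue"
        using integral_lebesgue_translate(2)[OF borel_measurable_integrable[OF iu(1)], of "- ?a"] iu(1)
        by (auto simp: d)
      show "AE x in lebesgue. u (x - ?a) * frechet_derivative \<phi> (at x) e = u x * frechet_derivative \<phi> (at x) e"
        using periodic_shift[OF u S] by eventually_elim simp
    qed (use iu in auto)
    also have "- \<dots> = (LINT x|lebesgue. v x * \<phi> x)" using D[OF \<phi>] by simp
    finally show "(LINT x|lebesgue. v (x - ?a) * \<phi> x) = (LINT x|lebesgue. v x * \<phi> x)" .
  qed
  have "AE x in torus. v (x - shift S) - v x = 0"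
    using * integrable_test(1)[OF lv]
    by (intro AE_torus_eq_0_if_test) (simp_all add: left_diff_distrib)
  then show ?thesis by eventually_elim simp
qed

text \<open>Against a periodic \<open>w\<close>, a compactly supported \<open>g\<close> acts only
  through its periodization \<open>h\<close>. It is applied both to a cut-off cosine and to the
  derivative of one.\<close>

lemma integral_cutoff_unfold:
  fixes w :: "'a::euclidean_space \<Rightarrow> real"
  assumes i: "integrable lebesgue (\<lambda>x. w x * g x)" and w: "integrable torus w"
    and per: "\<And>S. S \<subseteq> Basis \<Longrightarrow> AE x in torus. w (x - shift S) = w x"
    and g: "continuous_on UNIV g"
    and supp: "\<And>x. x \<notin> cbox (- (2 * pi) *\<^sub>R One) ((2 * pi) *\<^sub>R One) \<Longrightarrow> g x = 0"
    and sum: "\<And>x. x \<in> cell \<Longrightarrow> (\<Sum>S\<in>Pow Basis. g (x - shift S)) = h x"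
  shows "(LINT x|lebesgue. w x * g x) = (LINT x|torus. w x * h x)"
proof -
  have supp': "x \<in> cbox (- (2 * pi) *\<^sub>R One) ((2 * pi) *\<^sub>R One)" if "w x * g x \<noteq> 0" for x
    using supp that by force
  have gm: "(\<lambda>x. g (x - a)) \<in> borel_measurable torus" for a
    by (intro measurable_restrict_space1 measurable_completion)
      (auto intro!: borel_measurable_continuous_onI continuous_on_compose2[OF g] continuous_intros)
  note [measurable] = gm borel_measurable_integrable[OF w]
  have ae: "AE x in torus. w (x - shift S) * g (x - shift S) = w x * g (x - shift S)" if "S \<subseteq> Basis" for S
    using per[OF that] by eventually_elim simp
  have iS: "integrable torus (\<lambda>x. w x * g (x - shift S))" if "S \<subseteq> Basis" for S
    using integral_unfold_cell(2)[OF i supp' that] integrable_cong_AE[OF _ _ ae[OF that]]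
    by (auto dest: borel_measurable_integrable)
  have "(LINT x|lebesgue. w x * g x) =
      (\<Sum>S\<in>Pow Basis. (LINT x|torus. w (x - shift S) * g (x - shift S)))"
    by (rule integral_unfold_cell(1)[OF i supp'])
  also have "\<dots> = (\<Sum>S\<in>Pow Basis. (LINT x|torus. w x * g (x - shift S)))"
    using ae integral_unfold_cell(2)[OF i supp']
    by (intro sum.cong integral_cong_AE) (auto dest: borel_measurable_integrable)
  also have "\<dots> = (LINT x|torus. (\<Sum>S\<in>Pow Basis. w x * g (x - shift S)))"
    by (rule Bochner_Integration.integral_sum[symmetric]) (use iS in auto)
  also have "\<dots> = (LINT x|torus. w x * h x)"
    by (rule Bochner_Integration.integral_cong) (auto simp: sum sum_distrib_left[symmetric])
  finally show ?thesis .
qed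

lemma cos_inner_derivative:
  "((\<lambda>x. cos (k \<bullet> x + c)) has_derivative (\<lambda>b. (k \<bullet> b) * cos (k \<bullet> x + (c + pi / 2)))) (at x)"
proof -
  have "cos (k \<bullet> x + (c + pi / 2)) = - sin (k \<bullet> x + c)"
    unfolding add.assoc[symmetric] cos_add[of _ "pi / 2"] by simp
  then show ?thesis by (auto intro!: derivative_eq_intros)
qed

text \<open>A cosine is no test function, but \<open>cutoff\<close> times it is; both sides of the
  weak identity are then unfolded to the cell, where the cutoff sums to 1.\<close>

lemma weak_deriv_cos:
  fixes u v :: "'a::euclidean_space \<Rightarrow> real"
  assumes u: "periodic u" and uv: "has_weak_deriv e u v" and e: "e \<in> Basis" and k: "k \<in> lat"
  shows "(k \<bullet> e) * (LINT x|torus. u x * cos (k \<bullet> x + (c + pi / 2))) =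
    - (LINT x|torus. v x * cos (k \<bullet> x + c))"
proof -
  have lu: "locally_integrable u" and lv: "locally_integrable v"
    and D: "\<And>\<phi>. test_function \<phi> \<Longrightarrow>
      (LINT x|lebesgue. u x * frechet_derivative \<phi> (at x) e) = - (LINT x|lebesgue. v x * \<phi> x)"
    using uv by (auto simp: has_weak_deriv_def)
  let ?\<psi> = "\<lambda>x. cos (k \<bullet> x + c)"
  let ?\<phi> = "\<lambda>x. cutoff x * ?\<psi> x"
  have \<phi>: "test_function ?\<phi>" by (rule test_function_mult[OF test_function_cutoff Ck_cos_inner])
  have sum: "(\<Sum>S\<in>Pow Basis. ?\<phi> (x - shift S)) = ?\<psi> x" if "x \<in> cell" for x
  proof -
    have "(\<Sum>S\<in>Pow Basis. ?\<phi> (x - shift S)) = (\<Sum>S\<in>Pow Basis. cutoff (x - shift S) * ?\<psi> x)"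
      using k by (intro sum.cong) (auto simp: cos_shift)
    then show ?thesis using cutoff_sum[OF that] by (simp flip: sum_distrib_right)
  qed
  have 1: "(LINT x|lebesgue. v x * ?\<phi> x) = (LINT x|torus. v x * ?\<psi> x)"
    by (rule integral_cutoff_unfold[OF integrable_test(1)[OF lv \<phi>] locally_integrable_torus[OF lv]
        weak_deriv_shift[OF u uv e] test_functionD(1)[OF \<phi>] _ sum])
      (simp_all add: cutoff_support)
  let ?d = "\<lambda>x. frechet_derivative ?\<phi> (at x) e"
  \<comment> \<open>The translated derivatives add up to the derivative of the periodized function,
    which is the cosine on the open cell. So the derivative of the cutoff never has to be
    computed.\<close>
  have dsum: "(\<Sum>S\<in>Pow Basis. ?d (x - shift S)) = (k \<bullet> e) * cos (k \<bullet> x + (c + pi / 2))" if x: "x \<in> cell" for x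
  proof -
    have "((\<lambda>x. \<Sum>S\<in>Pow Basis. ?\<phi> (x + - shift S)) has_derivative
        (\<lambda>b. \<Sum>S\<in>Pow Basis. frechet_derivative ?\<phi> (at (x + - shift S)) b)) (at x)"
      by (intro has_derivative_sum frechet_derivative_translate test_functionD(2)[OF \<phi>])
    then have "(?\<psi> has_derivative (\<lambda>b. \<Sum>S\<in>Pow Basis. frechet_derivative ?\<phi> (at (x + - shift S)) b)) (at x)"
      by (rule has_derivative_transform_within_open[of _ _ _ _ cell]) (use x sum in \<open>auto simp: cell_def\<close>)
    from has_derivative_unique[OF this cos_inner_derivative[of k c x]]
    show ?thesis by (auto dest: fun_cong[of _ _ e])
  qed
  have supp: "?d x = 0" if "x \<notin> cbox (- (2 * pi) *\<^sub>R One) ((2 * pi) *\<^sub>R One)" for x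
    using that by (subst frechet_derivative_support[of "cbox (- (2 * pi) *\<^sub>R One) ((2 * pi) *\<^sub>R One)"])
      (simp_all add: cutoff_support)
  have "(LINT x|lebesgue. u x * ?d x) = (LINT x|torus. u x * ((k \<bullet> e) * cos (k \<bullet> x + (c + pi / 2))))"
    by (rule integral_cutoff_unfold[OF integrable_test(2)[OF lu \<phi> e] locally_integrable_torus[OF lu]
        AE_torus[OF periodic_shift[OF u]] test_functionD(3)[OF \<phi> e] supp dsum])
  also have "\<dots> = (k \<bullet> e) * (LINT x|torus. u x * cos (k \<bullet> x + (c + pi / 2)))"
    by (simp only: mult.left_commute[of _ "k \<bullet> e"] integral_mult_right_zero)
  finally show ?thesis using D[OF \<phi>] 1 by simp
qed

theorem weak_deriv_torus:
  fixes u v :: "'a::euclidean_space \<Rightarrow> real"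
  assumes u: "periodic u" and uv: "has_weak_deriv e u v" and e: "e \<in> Basis"
  shows "torus_deriv e u v"
  unfolding torus_deriv_def
proof
  fix k :: 'a assume k: "k \<in> lat"
  have iu: "integrable torus u" and iv: "integrable torus v"
    using uv by (auto simp: has_weak_deriv_def intro: locally_integrable_torus)
  let ?C = "LINT x|torus. u x * cos (k \<bullet> x)" and ?S = "LINT x|torus. u x * cos (k \<bullet> x + - (pi / 2))"
  have "(LINT x|torus. u x * cos (k \<bullet> x + (0 + pi / 2))) = (LINT x|torus. - (u x * cos (k \<bullet> x + - (pi / 2))))"
    by (rule Bochner_Integration.integral_cong) (auto simp: cos_add cos_diff)
  then have 1: "(LINT x|torus. v x * cos (k \<bullet> x)) = (k \<bullet> e) * ?S"
    using weak_deriv_cos[OF u uv e k, of 0] by simp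
  have 2: "(LINT x|torus. v x * cos (k \<bullet> x + - (pi / 2))) = - (k \<bullet> e) * ?C"
    using weak_deriv_cos[OF u uv e k, of "- (pi / 2)"] by simp
  show "(LINT x|torus. complex_of_real (v x) * ek k x) =
      - \<i> * (k \<bullet> e) * (LINT x|torus. complex_of_real (u x) * ek k x)"
    unfolding integral_ek_conv_cos(1)[OF iu k] integral_ek_conv_cos(1)[OF iv k] 1 2
    by (simp add: complex_eq_iff)
qed

text \<open>The constant 1 has weak derivative 0 in a direction b with
  \<open>k \<bullet> b \<noteq> 0\<close>, and \<open>weak_deriv_torus\<close> turns this into 0 =
  -i (k . b) times the integral of \<open>ek k\<close>.\<close>

lemma ek_orth:
  fixes k :: "'a::euclidean_space"
  assumes k: "k \<in> lat" "k \<noteq> 0"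
  shows "(LINT x|torus. ek k x) = 0"
proof -
  obtain b where b: "b \<in> Basis" "k \<bullet> b \<noteq> 0"
    using k(2) euclidean_all_zero_iff[of k] by blast
  have "has_weak_deriv b (\<lambda>x. 1) (\<lambda>x. 0)"
    using has_weak_deriv_C1[of "\<lambda>x. 1" b] b by simp
  moreover have "periodic (\<lambda>x::'a. 1)" by (simp add: periodic_def)
  ultimately have "torus_deriv b (\<lambda>x. 1) (\<lambda>x. 0)" using weak_deriv_torus b(1) by blast
  then show ?thesis using k b by (auto simp: torus_deriv_def)
qed

section \<open>Fourier projections and the chain rule\<close>

definition vol :: "'a::euclidean_space itself \<Rightarrow> real" where
  "vol _ = measure (torus :: 'a measure) cell"

lemma vol_pos: "vol TYPE('a::euclidean_space) > 0"
proof -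
  have "vol TYPE('a) = measure lborel (box (0::'a) ((2 * pi) *\<^sub>R One))"
    by (simp add: vol_def measure_restrict_space cell_def)
  also have "\<dots> = (\<Prod>b\<in>(Basis::'a set). 2 * pi)"
    by (subst measure_lborel_box) auto
  finally show ?thesis by (simp add: prod_pos)
qed

definition coef :: "('a::euclidean_space \<Rightarrow> real) \<Rightarrow> 'a \<Rightarrow> complex" where
  "coef u k = (LINT x|torus. complex_of_real (u x) * ek (- k) x) / vol TYPE('a)"

definition proj :: "'a set \<Rightarrow> ('a::euclidean_space \<Rightarrow> real) \<Rightarrow> 'a \<Rightarrow> complex" where
  "proj F u x = (\<Sum>k\<in>F. coef u k * ek k x)"

lemma trig_proj: "finite F \<Longrightarrow> F \<subseteq> lat \<Longrightarrow> trig (proj F u)"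
  unfolding trig_def proj_def[abs_def] by blast

lemma integrable_trig: "trig p \<Longrightarrow> integrable torus p"
  using integrable_mult_trig[of "\<lambda>_. 1" p] by simp

lemma integral_double_sum_ek:
  assumes "finite F" "\<And>k l. k \<in> F \<Longrightarrow> l \<in> F \<Longrightarrow> m k l \<in> lat"
  shows "(LINT x|torus. (\<Sum>k\<in>F. \<Sum>l\<in>F. a k l * ek (m k l) x)) =
    (\<Sum>k\<in>F. \<Sum>l\<in>F. (LINT x|torus. a k l * ek (m k l) x))"
proof -
  have i: "integrable torus (\<lambda>x. a k l * ek (m k l) x)" if "k \<in> F" "l \<in> F" for k l
    by (rule integrable_trig[OF trig_cmult_ek[OF assms(2)[OF that]]])
  have "(LINT x|torus. (\<Sum>k\<in>F. \<Sum>l\<in>F. a k l * ek (m k l) x)) =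
      (\<Sum>k\<in>F. (LINT x|torus. (\<Sum>l\<in>F. a k l * ek (m k l) x)))"
    by (rule Bochner_Integration.integral_sum) (rule Bochner_Integration.integrable_sum, rule i)
  also have "\<dots> = (\<Sum>k\<in>F. \<Sum>l\<in>F. (LINT x|torus. a k l * ek (m k l) x))"
    by (rule sum.cong[OF refl], rule Bochner_Integration.integral_sum) (rule i)
  finally show ?thesis .
qed

lemma integral_ek:
  "k \<in> lat \<Longrightarrow> (LINT x|torus. ek k x) = (if k = 0 then complex_of_real (vol TYPE('a)) else 0)"
  for k :: "'a::euclidean_space"
  using ek_orth[of k] by (auto simp: vol_def scaleR_conv_of_real)

text \<open>Pythagoras with the coefficients \<open>c\<close> left free: the last sum shows that the
  Fourier coefficients are the best choice, the middle one that further frequencies can only lower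
  the error.\<close>

lemma nsq_trig_diff:
  fixes u :: "'a::euclidean_space \<Rightarrow> real"
  assumes u: "L2 u" and F: "finite F" "F \<subseteq> lat"
  shows "nsq (\<lambda>x. complex_of_real (u x) - (\<Sum>k\<in>F. c k * ek k x)) =
    nsq u - vol TYPE('a) * (\<Sum>k\<in>F. (norm (coef u k))\<^sup>2) + vol TYPE('a) * (\<Sum>k\<in>F. (norm (c k - coef u k))\<^sup>2)"
proof -
  let ?V = "vol TYPE('a)"
  let ?u = "\<lambda>x. complex_of_real (u x)"
  let ?q = "\<lambda>x. \<Sum>k\<in>F. c k * ek k x"
  let ?r = "\<lambda>x. \<Sum>k\<in>F. cnj (c k) * ek (- k) x"
  have iu: "integrable torus u" by (rule L2_integrable[OF u])
  have iek: "integrable torus (\<lambda>x. ?u x * ek k x)" if "k \<in> lat" for k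
    using integrable_mult_trig[OF iu] trig_cmult_ek[OF that, of 1] by simp
  have coef_cnj: "(LINT x|torus. ?u x * ek k x) = ?V * cnj (coef u k)" if "k \<in> lat" for k
  proof -
    have "cnj (LINT x|torus. ?u x * ek (- k) x) = (LINT x|torus. cnj (?u x * ek (- k) x))"
      by (rule Bochner_Integration.integral_cnj[symmetric])
    then show ?thesis using vol_pos[where 'a='a] by (simp add: coef_def cnj_ek)
  qed
  have coef: "(LINT x|torus. ?u x * ek (- k) x) = ?V * coef u k" for k
    using vol_pos[where 'a='a] by (simp add: coef_def)
  have tq: "trig ?q" using F by (auto simp: trig_def)
  have tr: "trig ?r" using F by (intro trig_sum trig_cmult_ek) auto
  have cnjq: "cnj (?q x) = ?r x" for x by (simp add: cnj_ek)
  have i1: "integrable torus (\<lambda>x. complex_of_real ((u x)\<^sup>2))"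
    using L2_integrable_sq[OF u] by (intro integrable_of_real) simp
  have i2: "integrable torus (\<lambda>x. ?u x * ?r x)" "integrable torus (\<lambda>x. ?u x * ?q x)"
    using integrable_mult_trig[OF iu] tq tr by auto
  have i3: "integrable torus (\<lambda>x. ?q x * ?r x)"
    by (rule integrable_trig[OF trig_mult[OF tq tr]])
  have e: "complex_of_real ((norm (?u x - ?q x))\<^sup>2) =
      complex_of_real ((u x)\<^sup>2) - ?u x * ?r x - ?u x * ?q x + ?q x * ?r x" for x
    unfolding complex_norm_square complex_cnj_diff cnjq complex_cnj_complex_of_real
    by (simp add: algebra_simps power2_eq_square)
  have "complex_of_real (nsq (\<lambda>x. ?u x - ?q x)) =
      (LINT x|torus. complex_of_real ((norm (?u x - ?q x))\<^sup>2))"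
    unfolding nsq_def by (rule integral_complex_of_real[symmetric])
  also have "\<dots> = (LINT x|torus. complex_of_real ((u x)\<^sup>2)) - (LINT x|torus. ?u x * ?r x) -
      (LINT x|torus. ?u x * ?q x) + (LINT x|torus. ?q x * ?r x)"
    unfolding e using i1 i2 i3 by simp
  also have "(LINT x|torus. complex_of_real ((u x)\<^sup>2)) = complex_of_real (nsq u)"
    unfolding nsq_def by (subst integral_complex_of_real) simp
  also have "(LINT x|torus. ?u x * ?r x) = (\<Sum>k\<in>F. cnj (c k) * (?V * coef u k))"
  proof -
    have "(LINT x|torus. ?u x * ?r x) = (LINT x|torus. (\<Sum>k\<in>F. cnj (c k) * (?u x * ek (- k) x)))"
      by (simp add: sum_distrib_left mult_ac)
    also have "\<dots> = (\<Sum>k\<in>F. (LINT x|torus. cnj (c k) * (?u x * ek (- k) x)))"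
      using F iek by (intro Bochner_Integration.integral_sum integrable_mult_right) auto
    finally show ?thesis by (simp add: coef)
  qed
  also have "(LINT x|torus. ?u x * ?q x) = (\<Sum>k\<in>F. c k * (?V * cnj (coef u k)))"
  proof -
    have "(LINT x|torus. ?u x * ?q x) = (LINT x|torus. (\<Sum>k\<in>F. c k * (?u x * ek k x)))"
      by (simp add: sum_distrib_left mult_ac)
    also have "\<dots> = (\<Sum>k\<in>F. (LINT x|torus. c k * (?u x * ek k x)))"
      using F iek by (intro Bochner_Integration.integral_sum integrable_mult_right) auto
    also have "\<dots> = (\<Sum>k\<in>F. c k * (?V * cnj (coef u k)))"
      using F by (intro sum.cong) (auto simp: coef_cnj subset_iff)
    finally show ?thesis .
  qed
  also have "(LINT x|torus. ?q x * ?r x) = (\<Sum>k\<in>F. ?V * (c k * cnj (c k)))"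
  proof -
    have "(LINT x|torus. ?q x * ?r x) =
        (LINT x|torus. (\<Sum>k\<in>F. \<Sum>l\<in>F. (c k * cnj (c l)) * ek (k + - l) x))"
      unfolding sum_product
      by (intro Bochner_Integration.integral_cong sum.cong refl) (simp only: ek_add mult_ac)
    also have "\<dots> = (\<Sum>k\<in>F. \<Sum>l\<in>F. (LINT x|torus. (c k * cnj (c l)) * ek (k + - l) x))"
      using F lat_diff by (intro integral_double_sum_ek) (auto simp: subset_iff)
    also have "\<dots> = (\<Sum>k\<in>F. \<Sum>l\<in>F. if l = k then ?V * (c k * cnj (c k)) else 0)"
    proof (intro sum.cong refl)
      fix k l assume "k \<in> F" "l \<in> F"
      then have "k + - l \<in> lat" using F lat_diff[of k l] by auto
      then show "(LINT x|torus. (c k * cnj (c l)) * ek (k + - l) x) =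
          (if l = k then ?V * (c k * cnj (c k)) else 0)"
        using integral_ek[of "k + - l"] by simp
    qed
    finally show ?thesis using F by simp
  qed
  finally have *: "complex_of_real (nsq (\<lambda>x. ?u x - ?q x)) =
      complex_of_real (nsq u) - (\<Sum>k\<in>F. cnj (c k) * (?V * coef u k)) -
      (\<Sum>k\<in>F. c k * (?V * cnj (coef u k))) + (\<Sum>k\<in>F. ?V * (c k * cnj (c k)))" .
  have "complex_of_real (nsq (\<lambda>x. ?u x - ?q x)) = complex_of_real (nsq u -
      ?V * (\<Sum>k\<in>F. (norm (coef u k))\<^sup>2) + ?V * (\<Sum>k\<in>F. (norm (c k - coef u k))\<^sup>2))"
    unfolding * of_real_add of_real_diff of_real_mult of_real_sum complex_norm_square
    by (simp add: sum_distrib_left algebra_simps sum.distrib sum_subtractf)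
  then show ?thesis by (simp only: of_real_eq_iff)
qed

text \<open>Extend \<open>c\<close> by 0 from \<open>F\<close> to \<open>G\<close> and compare it
  with the Fourier coefficients in \<open>nsq_trig_diff\<close>.\<close>

lemma nsq_proj_le:
  fixes u :: "'a::euclidean_space \<Rightarrow> real"
  assumes "L2 u" "finite G" "G \<subseteq> lat" "F \<subseteq> G"
  shows "nsq (\<lambda>x. complex_of_real (u x) - proj G u x) \<le>
    nsq (\<lambda>x. complex_of_real (u x) - (\<Sum>k\<in>F. c k * ek k x))"
proof -
  have "(\<Sum>k\<in>F. c k * ek k x) = (\<Sum>k\<in>G. (if k \<in> F then c k else 0) * ek k x)" for x
    using assms by (intro sum.mono_neutral_cong_left) auto
  then show ?thesis
    using vol_pos[where 'a='a] unfolding proj_def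
    by (simp add: nsq_trig_diff assms sum_nonneg)
qed

text \<open>The frequency sets are common to both functions, because the partial sum of a derivative
  is the derivative of the partial sum over the same set. A union of two sets works since enlarging
  a set never increases the error.\<close>

lemma proj_tendsto:
  fixes u v :: "'a::euclidean_space \<Rightarrow> real"
  assumes u: "L2 u" and v: "L2 v"
  shows "\<exists>F. (\<forall>n. finite (F n) \<and> F n \<subseteq> lat) \<and>
    (\<lambda>n. nsq (\<lambda>x. complex_of_real (u x) - proj (F n) u x)) \<longlonglongrightarrow> 0 \<and>
    (\<lambda>n. nsq (\<lambda>x. complex_of_real (v x) - proj (F n) v x)) \<longlonglongrightarrow> 0"
proof -
  have "\<exists>F. finite F \<and> F \<subseteq> lat \<and>
      nsq (\<lambda>x. complex_of_real (u x) - proj F u x) < 1 / Suc n \<and>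
      nsq (\<lambda>x. complex_of_real (v x) - proj F v x) < 1 / Suc n" for n
  proof -
    obtain p where p: "trig p" "nsq (\<lambda>x. complex_of_real (u x) - p x) < 1 / Suc n"
      using approxD[OF L2_approx[OF u], of "1 / Suc n"] by auto
    obtain q where q: "trig q" "nsq (\<lambda>x. complex_of_real (v x) - q x) < 1 / Suc n"
      using approxD[OF L2_approx[OF v], of "1 / Suc n"] by auto
    obtain A c where A: "finite A" "A \<subseteq> lat" "p = (\<lambda>x. \<Sum>k\<in>A. c k * ek k x)"
      using p(1) by (auto simp: trig_def)
    obtain B d where B: "finite B" "B \<subseteq> lat" "q = (\<lambda>x. \<Sum>k\<in>B. d k * ek k x)"
      using q(1) by (auto simp: trig_def)
    have "nsq (\<lambda>x. complex_of_real (u x) - proj (A \<union> B) u x) < 1 / Suc n"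
      using nsq_proj_le[OF u, of "A \<union> B" A c] A B p(2) by auto
    moreover have "nsq (\<lambda>x. complex_of_real (v x) - proj (A \<union> B) v x) < 1 / Suc n"
      using nsq_proj_le[OF v, of "A \<union> B" B d] A B q(2) by auto
    ultimately show ?thesis using A B by (intro exI[of _ "A \<union> B"]) auto
  qed
  then obtain F where F: "\<And>n. finite (F n) \<and> F n \<subseteq> lat \<and>
      nsq (\<lambda>x. complex_of_real (u x) - proj (F n) u x) < 1 / Suc n \<and>
      nsq (\<lambda>x. complex_of_real (v x) - proj (F n) v x) < 1 / Suc n" by metis
  have "(\<lambda>n. nsq (\<lambda>x. complex_of_real (u x) - proj (F n) u x)) \<longlonglongrightarrow> 0"
    "(\<lambda>n. nsq (\<lambda>x. complex_of_real (v x) - proj (F n) v x)) \<longlonglongrightarrow> 0"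
    by (rule Lim_null_comparison[OF _ LIMSEQ_Suc[OF lim_1_over_n]];
        use F in \<open>auto intro!: always_eventually less_imp_le simp: nsq_nonneg\<close>)+
  with F show ?thesis by blast
qed

text \<open>Factors converging in L2 have products converging in L1. Young's inequality with a free
  parameter \<open>d\<close> takes the place of Cauchy-Schwarz, so that only the quantities
  \<open>nsq\<close> occur.\<close>

lemma integral_mult_tendsto:
  fixes u v h :: "'a::euclidean_space \<Rightarrow> complex"
  assumes u: "L2 u" and v: "L2 v" and a: "\<And>n. L2 (a n)" and b: "\<And>n. L2 (b n)"
    and au: "(\<lambda>n. nsq (\<lambda>x. u x - a n x)) \<longlonglongrightarrow> 0"
    and bv: "(\<lambda>n. nsq (\<lambda>x. v x - b n x)) \<longlonglongrightarrow> 0"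
    and h: "h \<in> borel_measurable torus" "\<And>x. norm (h x) = 1"
  shows "(\<lambda>n. LINT x|torus. a n x * b n x * h x) \<longlonglongrightarrow> (LINT x|torus. u x * v x * h x)"
proof -
  let ?A = "\<lambda>n. nsq (\<lambda>x. u x - a n x)" and ?B = "\<lambda>n. nsq (\<lambda>x. v x - b n x)"
  note [measurable] = h(1)
  have ih: "integrable torus (\<lambda>x. p x * q x * h x)" if "L2 p" "L2 q" for p q
    using integrable_mult_L2[OF that] L2_measurable[OF that(1)] L2_measurable[OF that(2)] h
    by (intro Bochner_Integration.integrable_bound[OF integrable_mult_L2[OF that]])
      (auto simp: norm_mult)
  have key: "norm ((LINT x|torus. a n x * b n x * h x) - (LINT x|torus. u x * v x * h x)) \<le>
      (?A n + ?B n) + (?A n + ?B n) / d + d * (nsq u + nsq v)" if d: "d > 0" for d n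
  proof -
    note [measurable] = L2_measurable[OF u] L2_measurable[OF v] L2_measurable[OF a] L2_measurable[OF b]
    have Ai: "integrable torus (\<lambda>x. (norm (u x - a n x))\<^sup>2)" "integrable torus (\<lambda>x. (norm (v x - b n x))\<^sup>2)"
      "integrable torus (\<lambda>x. (norm (u x))\<^sup>2)" "integrable torus (\<lambda>x. (norm (v x))\<^sup>2)"
      using u v a b by (auto intro!: L2_integrable_sq L2_diff)
    let ?g = "\<lambda>x. ((norm (u x - a n x))\<^sup>2 + (norm (v x - b n x))\<^sup>2) +
        ((norm (u x - a n x))\<^sup>2 + (norm (v x - b n x))\<^sup>2) / d + d * ((norm (u x))\<^sup>2 + (norm (v x))\<^sup>2)"
    have gi: "integrable torus ?g" using Ai by auto
    have young: "\<alpha> * \<beta> \<le> \<alpha>\<^sup>2 / d + d * \<beta>\<^sup>2" if "\<alpha> \<ge> 0" "\<beta> \<ge> 0" for \<alpha> \<beta> :: real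
    proof -
      have "0 \<le> (\<alpha> - d * \<beta>)\<^sup>2 + \<alpha> * (d * \<beta>)" using that d by (intro add_nonneg_nonneg) auto
      then have "\<alpha> * (d * \<beta>) \<le> \<alpha>\<^sup>2 + (d * \<beta>)\<^sup>2" by (simp add: power2_diff mult_ac)
      then have "\<alpha> * (d * \<beta>) / d \<le> (\<alpha>\<^sup>2 + (d * \<beta>)\<^sup>2) / d" using d by (intro divide_right_mono) auto
      then show ?thesis using d by (simp add: field_simps power2_eq_square)
    qed
    have ptw: "norm (a n x * b n x * h x - u x * v x * h x) \<le> ?g x" for x
    proof -
      let ?\<alpha> = "norm (u x - a n x)" and ?\<beta> = "norm (v x - b n x)"
      have "a n x * b n x - u x * v x = (u x - a n x) * (v x - b n x) - (u x - a n x) * v x - (v x - b n x) * u x"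
        by (simp add: algebra_simps)
      then have "norm (a n x * b n x - u x * v x) \<le>
          norm ((u x - a n x) * (v x - b n x)) + norm ((u x - a n x) * v x) + norm ((v x - b n x) * u x)"
        using norm_triangle_ineq4[of "(u x - a n x) * (v x - b n x)" "(u x - a n x) * v x"]
          norm_triangle_ineq4[of "(u x - a n x) * (v x - b n x) - (u x - a n x) * v x" "(v x - b n x) * u x"]
        by (simp only:)
      also have "\<dots> = ?\<alpha> * ?\<beta> + ?\<alpha> * norm (v x) + ?\<beta> * norm (u x)" by (simp add: norm_mult)
      also have "\<dots> \<le> (?\<alpha>\<^sup>2 + ?\<beta>\<^sup>2) + (?\<alpha>\<^sup>2 / d + d * (norm (v x))\<^sup>2) + (?\<beta>\<^sup>2 / d + d * (norm (u x))\<^sup>2)"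
        using sum_squares_bound[of ?\<alpha> ?\<beta>] mult_nonneg_nonneg[OF norm_ge_zero norm_ge_zero, of "u x - a n x" "v x - b n x"]
        by (intro add_mono young norm_ge_zero) linarith
      finally have "norm (a n x * b n x - u x * v x) \<le> ?g x" by (simp add: algebra_simps add_divide_distrib)
      moreover have "norm (a n x * b n x * h x - u x * v x * h x) = norm (a n x * b n x - u x * v x)"
        unfolding left_diff_distrib[symmetric] norm_mult by (simp add: h norm_mult[symmetric])
      ultimately show ?thesis by simp
    qed
    have "(LINT x|torus. a n x * b n x * h x) - (LINT x|torus. u x * v x * h x) =
        (LINT x|torus. a n x * b n x * h x - u x * v x * h x)"
      using ih[OF a b] ih[OF u v] by simp
    also have "norm \<dots> \<le> (LINT x|torus. ?g x)"
      using ih[OF a b] ih[OF u v] ptw gi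
      by (intro Bochner_Integration.integral_norm_bound_integral) auto
    also have "(LINT x|torus. ?g x) = (?A n + ?B n) + (?A n + ?B n) / d + d * (nsq u + nsq v)"
      using Ai by (simp add: nsq_def)
    finally show ?thesis .
  qed
  show ?thesis
  proof (rule LIMSEQ_I)
    fix \<epsilon> :: real assume \<epsilon>: "\<epsilon> > 0"
    \<comment> \<open>The parameter \<open>d\<close> is fixed first, so that the term which does not
      tend to 0 stays below half of \<epsilon>; only then is \<open>n\<close> taken large. The 1
      keeps \<open>T\<close> positive.\<close>
    define T where "T = 1 + nsq u + nsq v"
    define d where "d = \<epsilon> / (2 * T)"
    have pos: "T > 0" using nsq_nonneg[of u] nsq_nonneg[of v] unfolding T_def by linarith
    then have d: "d > 0" using \<epsilon> by (simp add: d_def)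
    have "d * (nsq u + nsq v) < d * T" using d by (simp add: T_def)
    also have "\<dots> = \<epsilon> / 2" using pos by (simp add: d_def)
    finally have d2: "d * (nsq u + nsq v) < \<epsilon> / 2" .
    have "(\<lambda>n. (?A n + ?B n) + (?A n + ?B n) / d) \<longlonglongrightarrow> (0 + 0) + (0 + 0) / d"
      using d by (intro tendsto_intros au bv) auto
    then have "\<forall>\<^sub>F n in sequentially. (?A n + ?B n) + (?A n + ?B n) / d < \<epsilon> / 2"
      using \<epsilon> by (intro order_tendstoD(2)[where y = "(0 + 0) + (0 + 0) / d"]) auto
    then obtain N where N: "\<And>n. n \<ge> N \<Longrightarrow> (?A n + ?B n) + (?A n + ?B n) / d < \<epsilon> / 2"
      by (auto simp: eventually_sequentially)
    show "\<exists>N. \<forall>n\<ge>N. norm ((LINT x|torus. a n x * b n x * h x) - (LINT x|torus. u x * v x * h x)) < \<epsilon>"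
    proof (intro exI[of _ N] allI impI)
      fix n assume "n \<ge> N"
      from N[OF this] key[OF d, of n] d2
      show "norm ((LINT x|torus. a n x * b n x * h x) - (LINT x|torus. u x * v x * h x)) < \<epsilon>" by linarith
    qed
  qed
qed

section \<open>Products of partial sums and the chain rule for squares\<close>

lemma proj_mult_integral:
  fixes j :: "'a::euclidean_space"
  assumes F: "finite F" "F \<subseteq> lat" and j: "j \<in> lat"
  shows "(LINT x|torus. (\<Sum>k\<in>F. c k * ek k x) * (\<Sum>k\<in>F. d k * ek k x) * ek j x) =
    (\<Sum>k\<in>F. \<Sum>l\<in>F. c k * d l * (if k + l + j = 0 then complex_of_real (vol TYPE('a)) else 0))"
proof -
  have "(LINT x|torus. (\<Sum>k\<in>F. c k * ek k x) * (\<Sum>k\<in>F. d k * ek k x) * ek j x) =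
      (LINT x|torus. (\<Sum>k\<in>F. \<Sum>l\<in>F. (c k * d l) * ek (k + l + j) x))"
    unfolding sum_product unfolding sum_distrib_right
    by (intro Bochner_Integration.integral_cong sum.cong refl) (simp only: ek_add mult_ac)
  also have "\<dots> = (\<Sum>k\<in>F. \<Sum>l\<in>F. (LINT x|torus. (c k * d l) * ek (k + l + j) x))"
    by (rule integral_double_sum_ek[OF F(1)]) (use F j in \<open>blast intro: lat_add\<close>)
  also have "\<dots> = (\<Sum>k\<in>F. \<Sum>l\<in>F. c k * d l * (if k + l + j = 0 then complex_of_real (vol TYPE('a)) else 0))"
  proof (intro sum.cong refl)
    fix k l assume "k \<in> F" "l \<in> F"
    then have "k + l + j \<in> lat" using F j lat_add by blast
    then show "(LINT x|torus. (c k * d l) * ek (k + l + j) x) =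
        c k * d l * (if k + l + j = 0 then complex_of_real (vol TYPE('a)) else 0)"
      using integral_ek[of "k + l + j"] by simp
  qed
  finally show ?thesis .
qed

theorem torus_deriv_square:
  fixes u v :: "'a::euclidean_space \<Rightarrow> real"
  assumes u: "L2 u" and v: "L2 v" and uv: "torus_deriv e u v"
  shows "torus_deriv e (\<lambda>x. (u x)\<^sup>2) (\<lambda>x. 2 * u x * v x)"
  unfolding torus_deriv_def
proof
  fix j :: 'a assume j: "j \<in> lat"
  let ?V = "vol TYPE('a)"
  obtain F where F': "(\<forall>n. finite (F n) \<and> F n \<subseteq> lat) \<and>
      (\<lambda>n. nsq (\<lambda>x. complex_of_real (u x) - proj (F n) u x)) \<longlonglongrightarrow> 0 \<and>
      (\<lambda>n. nsq (\<lambda>x. complex_of_real (v x) - proj (F n) v x)) \<longlonglongrightarrow> 0"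
    using proj_tendsto[OF u v] by (rule exE)
  then have F: "\<And>n. finite (F n)" "\<And>n. F n \<subseteq> lat"
    "(\<lambda>n. nsq (\<lambda>x. complex_of_real (u x) - proj (F n) u x)) \<longlonglongrightarrow> 0"
    "(\<lambda>n. nsq (\<lambda>x. complex_of_real (v x) - proj (F n) v x)) \<longlonglongrightarrow> 0"
    by simp_all
  have P: "L2 (proj (F n) w)" for n w by (rule L2_trig[OF trig_proj[OF F(1,2)]])
  have ej: "ek j \<in> borel_measurable torus"
    using measurable_trig_torus trig_cmult_ek[OF j, of 1] by simp
  have cv: "coef v k = \<i> * (k \<bullet> e) * coef u k" if "k \<in> lat" for k
    using uv that unfolding torus_deriv_def coef_def by (auto dest!: bspec[of _ _ "- k"])
  have eq: "2 * (LINT x|torus. proj (F n) u x * proj (F n) v x * ek j x) =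
      - \<i> * (j \<bullet> e) * (LINT x|torus. proj (F n) u x * proj (F n) u x * ek j x)" for n
  proof -
    let ?s = "\<lambda>k l. if k + l + j = 0 then complex_of_real ?V else 0"
    let ?c = "coef u"
    have uu: "(LINT x|torus. proj (F n) u x * proj (F n) u x * ek j x) =
        (\<Sum>k\<in>F n. \<Sum>l\<in>F n. ?c k * ?c l * ?s k l)"
      unfolding proj_def using proj_mult_integral[OF F(1,2) j] by simp
    have uv: "(LINT x|torus. proj (F n) u x * proj (F n) v x * ek j x) =
        (\<Sum>k\<in>F n. \<Sum>l\<in>F n. ?c k * coef v l * ?s k l)"
      unfolding proj_def using proj_mult_integral[OF F(1,2) j] by simp
    have 1: "(\<Sum>k\<in>F n. \<Sum>l\<in>F n. ?c k * coef v l * ?s k l) =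
        (\<Sum>k\<in>F n. \<Sum>l\<in>F n. \<i> * (l \<bullet> e) * (?c k * ?c l * ?s k l))"
      using F(2) by (intro sum.cong refl) (auto simp: cv subset_iff)
    \<comment> \<open>Exchanging k and l shows that twice the sum carries the factor i (k + l) . e.
      Orthogonality leaves only k + l = -j, so the factor is -i j . e.\<close>
    have "(\<Sum>k\<in>F n. \<Sum>l\<in>F n. \<i> * (l \<bullet> e) * (?c k * ?c l * ?s k l)) =
        (\<Sum>k\<in>F n. \<Sum>l\<in>F n. \<i> * (k \<bullet> e) * (?c k * ?c l * ?s k l))"
      by (subst sum.swap) (simp add: mult_ac add_ac)
    then have "2 * (\<Sum>k\<in>F n. \<Sum>l\<in>F n. ?c k * coef v l * ?s k l) =
        (\<Sum>k\<in>F n. \<Sum>l\<in>F n. \<i> * (l \<bullet> e) * (?c k * ?c l * ?s k l) + \<i> * (k \<bullet> e) * (?c k * ?c l * ?s k l))"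
      unfolding 1 by (simp add: sum.distrib)
    also have "\<dots> = (\<Sum>k\<in>F n. \<Sum>l\<in>F n. - \<i> * (j \<bullet> e) * (?c k * ?c l * ?s k l))"
    proof (intro sum.cong refl)
      fix k l
      show "\<i> * (l \<bullet> e) * (?c k * ?c l * ?s k l) + \<i> * (k \<bullet> e) * (?c k * ?c l * ?s k l) =
          - \<i> * (j \<bullet> e) * (?c k * ?c l * ?s k l)"
      proof (cases "k + l + j = 0")
        case True
        then have "(k + l + j) \<bullet> e = 0" by simp
        then have "j \<bullet> e = - (k \<bullet> e) - l \<bullet> e" by (simp add: inner_simps)
        then have je: "complex_of_real (j \<bullet> e) = - complex_of_real (k \<bullet> e) - complex_of_real (l \<bullet> e)" by simp
        show ?thesis unfolding je by (simp only: True refl if_True) (simp add: algebra_simps)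
      qed simp
    qed
    also have "\<dots> = - \<i> * (j \<bullet> e) * (\<Sum>k\<in>F n. \<Sum>l\<in>F n. ?c k * ?c l * ?s k l)"
      by (simp only: sum_distrib_left)
    finally show ?thesis unfolding uu uv .
  qed
  have "(\<lambda>n. 2 * (LINT x|torus. proj (F n) u x * proj (F n) v x * ek j x)) \<longlonglongrightarrow>
      2 * (LINT x|torus. complex_of_real (u x) * complex_of_real (v x) * ek j x)"
    by (intro tendsto_intros integral_mult_tendsto L2_of_real u v P F ej) auto
  moreover have "(\<lambda>n. - \<i> * (j \<bullet> e) * (LINT x|torus. proj (F n) u x * proj (F n) u x * ek j x)) \<longlonglongrightarrow>
      - \<i> * (j \<bullet> e) * (LINT x|torus. complex_of_real (u x) * complex_of_real (u x) * ek j x)"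
    by (intro tendsto_intros integral_mult_tendsto L2_of_real u v P F ej) auto
  ultimately have "2 * (LINT x|torus. complex_of_real (u x) * complex_of_real (v x) * ek j x) =
      - \<i> * (j \<bullet> e) * (LINT x|torus. complex_of_real (u x) * complex_of_real (u x) * ek j x)"
    unfolding eq by (rule LIMSEQ_unique)
  then show "(LINT x|torus. complex_of_real (2 * u x * v x) * ek j x) =
      - \<i> * (j \<bullet> e) * (LINT x|torus. complex_of_real ((u x)\<^sup>2) * ek j x)"
    by (simp add: power2_eq_square mult.assoc)
qed

section \<open>The phase space\<close>

lemma Omega_eq: "Omega = cell"
  by (auto simp: Omega_def mem_cell Basis_vec_def inner_axis)

lemma Upsilon_eq: "Upsilon = cell"
  by (force simp: Upsilon_def Omega_eq mem_cell Basis_prod_def inner_prod_def)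

lemma mem_cell_prod: "(x, \<theta>) \<in> (cell :: phase set) \<longleftrightarrow> x \<in> cell \<and> \<theta> \<in> cell"
  by (auto simp: Upsilon_eq[symmetric] Upsilon_def Omega_eq) (auto simp: mem_cell)

section \<open>Fubini for completed Lebesgue measure\<close>

lemma AE_slice:
  fixes P :: "phase \<Rightarrow> bool"
  assumes "AE \<xi> in lebesgue. P \<xi>"
  shows "AE x in lebesgue. AE \<theta> in lebesgue. P (x, \<theta>)"
proof -
  have "AE \<xi> in lborel \<Otimes>\<^sub>M lborel. P \<xi>"
    using assms unfolding lborel_prod AE_completion_iff .
  then have "AE x in lborel. AE \<theta> in lborel. P (x, \<theta>)"
    by (rule lborel_pair.AE_pair)
  then show ?thesis unfolding AE_completion_iff .
qed

lemma AE_fst: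
  fixes P :: "space \<Rightarrow> bool"
  assumes "AE x in lebesgue. P x"
  shows "AE \<xi> :: phase in lebesgue. P (fst \<xi>)"
proof -
  have "AE x in lborel. P x" using assms unfolding AE_completion_iff .
  then obtain N where N: "{x\<in>space lborel. \<not> P x} \<subseteq> N" "emeasure lborel N = 0" "N \<in> sets lborel"
    by (rule AE_E)
  have NU: "N \<times> (UNIV :: real set) \<in> sets (lborel \<Otimes>\<^sub>M lborel)"
    using N(3) by (intro pair_measureI) auto
  have "emeasure (lborel \<Otimes>\<^sub>M lborel) (N \<times> (UNIV :: real set)) = 0"
    using N(2,3) by (subst lborel.emeasure_pair_measure_Times) auto
  with NU have "N \<times> (UNIV :: real set) \<in> null_sets (lborel \<Otimes>\<^sub>M lborel)" by auto
  then have "AE \<xi> :: phase in lborel. P (fst \<xi>)"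
    unfolding lborel_prod[symmetric] by (rule AE_I') (use N(1) in auto)
  then show ?thesis unfolding AE_completion_iff .
qed

text \<open>For completed measures the preimages of null sets matter: a Borel representative
  composes well, and \<open>AE_fst\<close> says the exceptional set stays null.\<close>

lemma measurable_lebesgue_fst:
  fixes h :: "space \<Rightarrow> real"
  assumes "h \<in> borel_measurable lebesgue"
  shows "(\<lambda>\<xi> :: phase. h (fst \<xi>)) \<in> borel_measurable lebesgue"
proof -
  obtain h' where h': "h' \<in> borel_measurable lborel" "AE x in lborel. h x = h' x"
    using completion_ex_borel_measurable_real[OF assms] by blast
  have "AE x in lebesgue. h' x = h x" using h'(2) unfolding AE_completion_iff by eventually_elim simp
  then have ae: "AE \<xi> :: phase in lebesgue. h' (fst \<xi>) = h (fst \<xi>)" by (rule AE_fst)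
  have "(\<lambda>\<xi> :: phase. h' (fst \<xi>)) \<in> borel_measurable lborel"
    using h'(1) unfolding lborel_prod[symmetric] by measurable
  then have "(\<lambda>\<xi> :: phase. h' (fst \<xi>)) \<in> borel_measurable lebesgue"
    by (rule measurable_completion)
  from borel_measurable_AE[OF this ae] show ?thesis .
qed

text \<open>Completeness transfers measurability from one function to the other; if neither is
  measurable, both integrals take the default value 0.\<close>

lemma integral_cong_AE_lebesgue:
  fixes f g :: "'a::euclidean_space \<Rightarrow> real"
  assumes ae: "AE x in lebesgue. f x = g x"
  shows "(LINT x|lebesgue. f x) = (LINT x|lebesgue. g x)"
    and "integrable lebesgue f \<longleftrightarrow> integrable lebesgue g"
proof -
  have ae': "AE x in lebesgue. g x = f x" using ae by eventually_elim simp
  have m: "f \<in> borel_measurable lebesgue \<longleftrightarrow> g \<in> borel_measurable lebesgue"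
    using borel_measurable_AE[OF _ ae] borel_measurable_AE[OF _ ae'] by blast
  then show i: "integrable lebesgue f \<longleftrightarrow> integrable lebesgue g"
    using integrable_cong_AE[OF _ _ ae] borel_measurable_integrable[of lebesgue] by blast
  show "(LINT x|lebesgue. f x) = (LINT x|lebesgue. g x)"
  proof (cases "f \<in> borel_measurable lebesgue")
    case True
    then show ?thesis using m ae by (intro integral_cong_AE) auto
  next
    case False
    then have "\<not> integrable lebesgue f" "\<not> integrable lebesgue g"
      using m borel_measurable_integrable[of lebesgue] by blast+
    then show ?thesis by (simp add: not_integrable_integral_eq)
  qed
qed

lemma integral_lborel_lebesgue:
  fixes f g :: "'a::euclidean_space \<Rightarrow> real"
  assumes "AE x in lebesgue. f x = g x" "g \<in> borel_measurable borel"
  shows "(LINT x|lebesgue. f x) = (LINT x|lborel. g x)"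
    and "integrable lebesgue f \<longleftrightarrow> integrable lborel g"
  using integral_cong_AE_lebesgue[OF assms(1)] assms(2)
  by (simp_all add: integral_completion integrable_completion)

lemma indicator_cell_prod:
  "indicator (cell :: phase set) (x, \<theta>) = (indicator cell x * indicator cell \<theta> :: real)"
  by (simp add: indicator_def mem_cell_prod)

lemma theta_density_eq: "theta_density f x = (LINT \<theta>|torus. f (x, \<theta>))"
  unfolding theta_density_def set_lebesgue_integral_def torus_integral_eq
proof (rule integral_cong_AE_lebesgue)
  show "AE \<theta> in lebesgue. indicator {0..2 * pi} \<theta> *\<^sub>R f (x, \<theta>) = indicator cell \<theta> *\<^sub>R f (x, \<theta>)"
    using AE_off_hyperplanes[where 'a = real, of 0] AE_off_hyperplanes[where 'a = real, of "2 * pi"]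
    by eventually_elim (auto simp: indicator_def mem_cell)
qed

text \<open>Lebesgue measure on phase space is the completion of a product measure. Fubini is
  therefore applied to a Borel representative \<open>G\<close> and carried back through almost every
  slice.\<close>

lemma fubini_torus:
  fixes F :: "phase \<Rightarrow> real"
  assumes F: "integrable torus F"
  shows "AE x in (torus :: space measure). integrable torus (\<lambda>\<theta>. F (x, \<theta>))"
    and "integrable torus (\<lambda>x. LINT \<theta>|torus. F (x, \<theta>))"
    and "(LINT \<xi>|torus. F \<xi>) = (LINT x|torus. (LINT \<theta>|torus. F (x, \<theta>)))"
proof -
  let ?F = "\<lambda>\<xi>. indicator cell \<xi> *\<^sub>R F \<xi>"
  have i: "integrable lebesgue ?F" using F by (simp only: torus_integrable_iff)
  obtain G where G: "G \<in> borel_measurable lborel" "AE \<xi> in lborel. ?F \<xi> = G \<xi>"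
    using completion_ex_borel_measurable_real[OF borel_measurable_integrable[OF i]] by blast
  have Gb: "G \<in> borel_measurable borel" using G(1) by simp
  have ae: "AE \<xi> in lebesgue. ?F \<xi> = G \<xi>" using G(2) unfolding AE_completion_iff .
  have iG: "integrable (lborel \<Otimes>\<^sub>M lborel) G"
    using i integral_lborel_lebesgue(2)[OF ae Gb] by (simp add: lborel_prod)
  have Gx: "(\<lambda>\<theta>. G (x, \<theta>)) \<in> borel_measurable borel" for x
    using measurable_compose[OF measurable_Pair1' G(1)[unfolded lborel_prod[symmetric]], of x] by simp
  have sl: "AE x in lebesgue. AE \<theta> in lebesgue. ?F (x, \<theta>) = G (x, \<theta>)" by (rule AE_slice[OF ae])
  have iGx: "AE x in lebesgue. integrable lborel (\<lambda>\<theta>. G (x, \<theta>))"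
    using lborel_pair.AE_integrable_fst'[OF iG] unfolding AE_completion_iff .
  have inner: "AE x in lebesgue. indicator cell x *\<^sub>R (LINT \<theta>|torus. F (x, \<theta>)) = (LINT \<theta>|lborel. G (x, \<theta>))"
    using sl
  proof eventually_elim
    case (elim x)
    have "(LINT \<theta>|lborel. G (x, \<theta>)) = (LINT \<theta>|lebesgue. ?F (x, \<theta>))"
      by (rule integral_lborel_lebesgue(1)[OF elim Gx, symmetric])
    also have "\<dots> = (LINT \<theta>|lebesgue. indicator cell x * (indicator cell \<theta> *\<^sub>R F (x, \<theta>)))"
      by (simp add: indicator_cell_prod mult.assoc)
    finally show ?case by (simp add: torus_integral_eq)
  qed
  have iG1: "integrable lborel (\<lambda>x. LINT \<theta>|lborel. G (x, \<theta>))"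
    by (rule lborel_pair.integrable_fst'[OF iG])
  have mG1: "(\<lambda>x. LINT \<theta>|lborel. G (x, \<theta>)) \<in> borel_measurable borel"
    using borel_measurable_integrable[OF iG1] by simp
  show "integrable torus (\<lambda>x. LINT \<theta>|torus. F (x, \<theta>))"
    unfolding torus_integrable_iff using integral_lborel_lebesgue(2)[OF inner mG1] iG1 by simp
  have "(LINT \<xi>|torus. F \<xi>) = (LINT \<xi>|(lborel \<Otimes>\<^sub>M lborel). G \<xi>)"
    unfolding torus_integral_eq using integral_lborel_lebesgue(1)[OF ae Gb] by (simp add: lborel_prod)
  also have "\<dots> = (LINT x|lborel. (LINT \<theta>|lborel. G (x, \<theta>)))"
    by (rule lborel_pair.integral_fst'[OF iG, symmetric])
  also have "\<dots> = (LINT x|torus. (LINT \<theta>|torus. F (x, \<theta>)))"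
    unfolding torus_integral_eq[where f = "\<lambda>x. LINT \<theta>|torus. F (x, \<theta>)"]
    by (rule integral_lborel_lebesgue(1)[OF inner mG1, symmetric])
  finally show "(LINT \<xi>|torus. F \<xi>) = (LINT x|torus. (LINT \<theta>|torus. F (x, \<theta>)))" .
  have "AE x in lebesgue. x \<in> cell \<longrightarrow> integrable torus (\<lambda>\<theta>. F (x, \<theta>))"
    using sl iGx
  proof eventually_elim
    case (elim x)
    have "integrable lebesgue (\<lambda>\<theta>. ?F (x, \<theta>))"
      using integral_lborel_lebesgue(2)[OF elim(1) Gx] elim(2) by simp
    then show ?case by (auto simp: torus_integrable_iff indicator_cell_prod)
  qed
  then show "AE x in (torus :: space measure). integrable torus (\<lambda>\<theta>. F (x, \<theta>))"
    by (subst AE_restrict_space_iff) auto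
qed

lemma fubini_density:
  fixes f :: "phase \<Rightarrow> real" and h :: "space \<Rightarrow> real"
  assumes i: "integrable torus (\<lambda>\<xi>. f \<xi> * h (fst \<xi>))"
  shows "integrable torus (\<lambda>x. theta_density f x * h x)"
    and "(LINT \<xi>|torus. f \<xi> * h (fst \<xi>)) = (LINT x|torus. theta_density f x * h x)"
  using fubini_torus(2,3)[OF i] by (simp_all add: theta_density_eq)

text \<open>The Tonelli direction. The Fubini lemmas start from integrability on phase space, so
  \<open>h\<close> is truncated at n, where this is clear; the bound by the integral against the
  density is uniform in n, and monotone convergence concludes.\<close>

lemma integrable_density_mult:
  fixes f :: "phase \<Rightarrow> real" and h :: "space \<Rightarrow> real"
  assumes f: "integrable torus f" "\<And>\<xi>. 0 \<le> f \<xi>" and h: "h \<in> borel_measurable lebesgue" "\<And>x. 0 \<le> h x"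
    and i: "integrable torus (\<lambda>x. theta_density f x * h x)"
  shows "integrable torus (\<lambda>\<xi>. f \<xi> * h (fst \<xi>))"
proof (rule integrableI_nonneg)
  have hm: "(\<lambda>\<xi> :: phase. h (fst \<xi>)) \<in> borel_measurable torus"
    by (rule measurable_restrict_space1[OF measurable_lebesgue_fst[OF h(1)]])
  show "(\<lambda>\<xi>. f \<xi> * h (fst \<xi>)) \<in> borel_measurable torus"
    using hm borel_measurable_integrable[OF f(1)] by simp
  show "AE \<xi> in torus. 0 \<le> f \<xi> * h (fst \<xi>)" using f h by simp
  define H where "H n x = min (h x) (real n)" for n x
  have Hi: "integrable torus (\<lambda>\<xi>. f \<xi> * H n (fst \<xi>))" for n
  proof (rule Bochner_Integration.integrable_bound[OF integrable_mult_right[OF f(1), of "real n"]])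
    show "(\<lambda>\<xi>. f \<xi> * H n (fst \<xi>)) \<in> borel_measurable torus"
      unfolding H_def using hm borel_measurable_integrable[OF f(1)] by measurable
    show "AE \<xi> in torus. norm (f \<xi> * H n (fst \<xi>)) \<le> norm (real n * f \<xi>)"
      using f(2) h(2) by (auto intro!: AE_I2 mult_left_mono simp: H_def abs_mult mult.commute[of "real n"])
  qed
  let ?C = "LINT x|torus. theta_density f x * h x"
  have C: "(\<integral>\<^sup>+\<xi>. ennreal (f \<xi> * H n (fst \<xi>)) \<partial>torus) \<le> ennreal ?C" for n
  proof -
    have "(\<integral>\<^sup>+\<xi>. ennreal (f \<xi> * H n (fst \<xi>)) \<partial>torus) = ennreal (LINT \<xi>|torus. f \<xi> * H n (fst \<xi>))"
      using f h by (intro nn_integral_eq_integral Hi) (auto simp: H_def)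
    also have "(LINT \<xi>|torus. f \<xi> * H n (fst \<xi>)) = (LINT x|torus. theta_density f x * H n x)"
      by (rule fubini_density[OF Hi])
    also have "\<dots> \<le> ?C"
    proof (intro integral_mono fubini_density[OF Hi] i mult_left_mono)
      show "0 \<le> theta_density f x" for x
        unfolding theta_density_eq using f(2) by (intro Bochner_Integration.integral_nonneg) auto
    qed (simp add: H_def)
    finally show ?thesis by (simp add: ennreal_leI)
  qed
  have "(\<integral>\<^sup>+\<xi>. ennreal (f \<xi> * h (fst \<xi>)) \<partial>torus) = (\<integral>\<^sup>+\<xi>. (SUP n. ennreal (f \<xi> * H n (fst \<xi>))) \<partial>torus)"
  proof (rule nn_integral_cong)
    fix \<xi> :: phase
    show "ennreal (f \<xi> * h (fst \<xi>)) = (SUP n. ennreal (f \<xi> * H n (fst \<xi>)))"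
    proof (rule antisym)
      obtain n :: nat where "h (fst \<xi>) \<le> real n" using real_arch_simple by blast
      then have "f \<xi> * h (fst \<xi>) = f \<xi> * H n (fst \<xi>)" by (simp add: H_def)
      then show "ennreal (f \<xi> * h (fst \<xi>)) \<le> (SUP n. ennreal (f \<xi> * H n (fst \<xi>)))"
        by (auto intro: SUP_upper2[of n])
      show "(SUP n. ennreal (f \<xi> * H n (fst \<xi>))) \<le> ennreal (f \<xi> * h (fst \<xi>))"
        using f(2) by (intro SUP_least ennreal_leI mult_left_mono) (auto simp: H_def)
    qed
  qed
  also have "\<dots> = (SUP n. \<integral>\<^sup>+\<xi>. ennreal (f \<xi> * H n (fst \<xi>)) \<partial>torus)"
  proof (rule nn_integral_monotone_convergence_SUP)
    show "incseq (\<lambda>n \<xi>. ennreal (f \<xi> * H n (fst \<xi>)))"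
      using f(2) by (auto simp: incseq_def le_fun_def H_def intro!: ennreal_leI mult_left_mono)
    show "(\<lambda>\<xi>. ennreal (f \<xi> * H n (fst \<xi>))) \<in> borel_measurable torus" for n
      using borel_measurable_integrable[OF Hi] by simp
  qed
  also have "\<dots> \<le> ennreal ?C" by (rule SUP_least) (rule C)
  also have "\<dots> < \<infinity>" by simp
  finally show "(\<integral>\<^sup>+\<xi>. ennreal (f \<xi> * h (fst \<xi>)) \<partial>torus) < \<infinity>" .
qed

lemma periodic_density:
  assumes f: "periodic f"
  shows "periodic (theta_density f)"
  unfolding periodic_def
proof
  fix b :: space assume "b \<in> Basis"
  then have "(b, 0) \<in> (Basis :: phase set)" by (simp add: Basis_prod_def)
  with f have "AE \<xi> in lebesgue. f (\<xi> + (2 * pi) *\<^sub>R (b, 0)) = f \<xi>"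
    unfolding periodic_def by (rule bspec)
  from AE_slice[OF this]
  show "AE x in lebesgue. theta_density f (x + (2 * pi) *\<^sub>R b) = theta_density f x"
  proof eventually_elim
    case (elim x)
    then show ?case
      unfolding theta_density_def set_lebesgue_integral_def
      by (intro integral_cong_AE_lebesgue, eventually_elim) simp
  qed
qed

section \<open>Cosines as test functions of the weak equation\<close>

lemma in_Lp_bounded:
  fixes g :: "phase \<Rightarrow> 'b::euclidean_space"
  assumes g: "continuous_on UNIV g" and b: "\<And>\<xi>. norm (g \<xi>) \<le> C"
  shows "in_Lp p Upsilon g"
proof -
  have m: "g \<in> borel_measurable torus"
    using borel_measurable_continuous_onI[OF g]
    by (intro measurable_restrict_space1 measurable_completion) simp
  moreover have "integrable torus (\<lambda>x. norm (g x) ^ p)"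
    using m b by (intro torus.integrable_const_bound[where B = "C ^ p"])
      (auto intro!: AE_I2 power_mono borel_measurable_power)
  ultimately show ?thesis by (simp add: in_Lp_def Upsilon_eq)
qed

lemma in_W1p_per_cos:
  fixes k :: phase
  assumes k: "k \<in> lat"
  shows "in_W1p_per p (\<lambda>\<xi>. cos (k \<bullet> \<xi> + c)) (\<lambda>\<xi>. cos (k \<bullet> \<xi> + (c + pi / 2)) *\<^sub>R fst k)
    (\<lambda>\<xi>. snd k * cos (k \<bullet> \<xi> + (c + pi / 2)))"
proof -
  have wd: "has_weak_deriv e (\<lambda>\<xi>. cos (k \<bullet> \<xi> + c)) (\<lambda>\<xi>. (k \<bullet> e) * cos (k \<bullet> \<xi> + (c + pi / 2)))"
    if "e \<in> Basis" for e
  proof -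
    have d: "frechet_derivative (\<lambda>\<xi>. cos (k \<bullet> \<xi> + c)) (at \<xi>) = (\<lambda>b. (k \<bullet> b) * cos (k \<bullet> \<xi> + (c + pi / 2)))" for \<xi>
      by (rule frechet_derivative_at[OF cos_inner_derivative, symmetric])
    have "has_weak_deriv e (\<lambda>\<xi>. cos (k \<bullet> \<xi> + c)) (\<lambda>\<xi>. frechet_derivative (\<lambda>\<xi>. cos (k \<bullet> \<xi> + c)) (at \<xi>) e)"
      using that cos_inner_derivative
      by (intro has_weak_deriv_C1) (auto simp: d differentiable_def intro!: continuous_intros)
    then show ?thesis by (simp add: d)
  qed
  have "cos (k \<bullet> (\<xi> + (2 * pi) *\<^sub>R b) + c) = cos (k \<bullet> \<xi> + c)" if "b \<in> Basis" for b \<xi>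
  proof -
    have "k \<bullet> b \<in> \<int>" using k that by (auto simp: lat_def)
    then obtain n where "k \<bullet> b = of_int n" by (rule Ints_cases)
    then have "k \<bullet> (\<xi> + (2 * pi) *\<^sub>R b) + c = (k \<bullet> \<xi> + c) + 2 * pi * of_int n"
      by (simp add: inner_add_right)
    then show ?thesis by (simp only: cos_add[of "k \<bullet> \<xi> + c"] cos_int_2pin sin_int_2pin mult_1_right mult_zero_right diff_zero)
  qed
  then have 1: "periodic (\<lambda>\<xi>. cos (k \<bullet> \<xi> + c))" by (simp add: periodic_def)
  have 2: "has_weak_grad_x (\<lambda>\<xi>. cos (k \<bullet> \<xi> + c)) (\<lambda>\<xi>. cos (k \<bullet> \<xi> + (c + pi / 2)) *\<^sub>R fst k)"
    unfolding has_weak_grad_x_def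
  proof
    fix i :: 2
    have "(axis i 1, 0) \<in> (Basis :: phase set)" by (auto simp: Basis_prod_def Basis_vec_def)
    from wd[OF this]
    show "has_weak_deriv (axis i 1, 0) (\<lambda>\<xi>. cos (k \<bullet> \<xi> + c)) (\<lambda>\<xi>. (cos (k \<bullet> \<xi> + (c + pi / 2)) *\<^sub>R fst k) $ i)"
      by (simp add: inner_prod_def inner_axis mult.commute)
  qed
  have "(0, 1) \<in> (Basis :: phase set)" by (auto simp: Basis_prod_def)
  from wd[OF this] have 3: "has_weak_deriv_theta (\<lambda>\<xi>. cos (k \<bullet> \<xi> + c)) (\<lambda>\<xi>. snd k * cos (k \<bullet> \<xi> + (c + pi / 2)))"
    by (simp add: has_weak_deriv_theta_def inner_prod_def)
  have 4: "in_Lp p Upsilon (\<lambda>\<xi>. cos (k \<bullet> \<xi> + c))"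
    by (rule in_Lp_bounded[where C = 1]) (auto intro!: continuous_intros)
  have 5: "in_Lp p Upsilon (\<lambda>\<xi>. cos (k \<bullet> \<xi> + (c + pi / 2)) *\<^sub>R fst k)"
    by (rule in_Lp_bounded[where C = "norm (fst k)"])
      (auto intro!: continuous_intros mult_left_le_one_le)
  have 6: "in_Lp p Upsilon (\<lambda>\<xi>. snd k * cos (k \<bullet> \<xi> + (c + pi / 2)))"
    by (rule in_Lp_bounded[where C = "\<bar>snd k\<bar>"])
      (auto intro!: continuous_intros mult_left_le simp: abs_mult)
  from 1 2 3 4 5 6 show ?thesis unfolding in_W1p_per_def by blast
qed

section \<open>Stationary solutions are constant\<close>

lemma measurable_locally_integrable:
  fixes u :: "'a::euclidean_space \<Rightarrow> real"
  assumes "locally_integrable u"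
  shows "u \<in> borel_measurable lebesgue"
proof (rule borel_measurable_LIMSEQ_real)
  fix n :: nat
  have "integrable (lebesgue_on (cball 0 (real n))) u"
    using assms by (simp add: locally_integrable_def)
  then have "integrable lebesgue (\<lambda>x. indicator (cball 0 (real n)) x *\<^sub>R u x)"
    by (subst (asm) integrable_restrict_space) auto
  then show "(\<lambda>x. indicator (cball 0 (real n)) x *\<^sub>R u x) \<in> borel_measurable lebesgue" by simp
next
  fix x :: 'a
  obtain N :: nat where "norm x \<le> real N" using real_arch_simple by blast
  then have "indicator (cball 0 (real n)) x *\<^sub>R u x = u x" if "n \<ge> N" for n
    using that by (auto simp: indicator_def)
  then show "(\<lambda>n. indicator (cball 0 (real n)) x *\<^sub>R u x) \<longlonglongrightarrow> u x"
    by (intro tendsto_eventually eventually_sequentiallyI[of N]) auto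
qed

lemma measurable_locally_integrable_torus:
  "locally_integrable u \<Longrightarrow> u \<in> borel_measurable torus"
  by (intro measurable_restrict_space1 measurable_locally_integrable)

lemma fourier_const:
  fixes w :: "'a::euclidean_space \<Rightarrow> real"
  assumes w: "integrable torus w"
    and 0: "\<And>k. k \<in> lat \<Longrightarrow> k \<noteq> 0 \<Longrightarrow> (LINT x|torus. complex_of_real (w x) * ek k x) = 0"
  shows "\<exists>c. AE x in torus. w x = c"
proof -
  let ?V = "vol TYPE('a)"
  define c where "c = (LINT x|torus. w x) / ?V"
  have "AE x in torus. w x - c = 0"
  proof (rule fourier_uniqueness)
    show "integrable torus (\<lambda>x. w x - c)" using w by auto
    fix k :: 'a assume k: "k \<in> lat"
    have i: "integrable torus (\<lambda>x. complex_of_real (w x) * ek k x)" "integrable torus (ek k)"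
      using integrable_mult_trig[OF w] integrable_trig trig_cmult_ek[OF k, of 1] by auto
    have "(LINT x|torus. complex_of_real (w x - c) * ek k x) =
        (LINT x|torus. complex_of_real (w x) * ek k x) - complex_of_real c * (LINT x|torus. ek k x)"
      using i by (simp add: left_diff_distrib)
    also have "\<dots> = 0"
    proof (cases "k = 0")
      case True
      have "?V \<noteq> 0" using vol_pos[where 'a='a] by simp
      then have "complex_of_real (LINT x|torus. w x) = complex_of_real c * complex_of_real ?V"
        by (simp add: c_def)
      then show ?thesis
        unfolding True integral_ek[OF lat_0] by simp
    next
      case False
      then show ?thesis using 0[OF k] integral_ek[OF k] by simp
    qed
    finally show "(LINT x|torus. complex_of_real (w x - c) * ek k x) = 0" .
  qed
  then have "AE x in torus. w x = c" by eventually_elim simp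
  then show ?thesis by blast
qed

lemma lat_fst: "k \<in> (lat :: phase set) \<Longrightarrow> fst k \<in> lat"
  and lat_Pair_0: "\<kappa> \<in> lat \<Longrightarrow> (\<kappa>, 0 :: real) \<in> lat"
  by (force simp: lat_def Basis_prod_def inner_prod_def)+

text \<open>Exponentials of frequency (\<kappa>, 0) do not depend on the angle, so their real and
  imaginary parts can be absorbed into \<open>h\<close> before integrating over it.\<close>

lemma fubini_ek:
  fixes f :: "phase \<Rightarrow> real" and h :: "space \<Rightarrow> real"
  assumes i: "integrable torus (\<lambda>\<xi>. f \<xi> * h (fst \<xi>))" and \<kappa>: "\<kappa> \<in> lat"
  shows "(LINT \<xi>|torus. complex_of_real (f \<xi> * h (fst \<xi>)) * ek (\<kappa>, 0) \<xi>) =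
    (LINT x|torus. complex_of_real (theta_density f x * h x) * ek \<kappa> x)"
proof -
  have k: "(\<kappa>, 0) \<in> (lat :: phase set)" by (rule lat_Pair_0[OF \<kappa>])
  have *: "(LINT \<xi>|torus. f \<xi> * h (fst \<xi>) * cos ((\<kappa>, 0) \<bullet> \<xi> + c)) =
      (LINT x|torus. theta_density f x * h x * cos (\<kappa> \<bullet> x + c))" for c
  proof -
    have "integrable torus (\<lambda>\<xi>. f \<xi> * (\<lambda>x. h x * cos (\<kappa> \<bullet> x + c)) (fst \<xi>))"
      using integral_ek_conv_cos(2)[OF i k, of c] by (simp add: inner_prod_def mult.assoc)
    from fubini_density(2)[OF this] show ?thesis by (simp add: inner_prod_def mult.assoc)
  qed
  show ?thesis
    unfolding integral_ek_conv_cos(1)[OF i k] integral_ek_conv_cos(1)[OF fubini_density(1)[OF i] \<kappa>]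
    using *[of 0] *[of "- (pi / 2)"] by simp
qed

lemma L2_AE_bounded:
  fixes u :: "'a::euclidean_space \<Rightarrow> real"
  assumes "u \<in> borel_measurable torus" "AE x in torus. \<bar>u x\<bar> \<le> C"
  shows "L2 u"
  unfolding L2_def
proof
  show "integrable torus (\<lambda>x. (norm (u x))\<^sup>2)"
  proof (rule torus.integrable_const_bound[where B = "C\<^sup>2"])
    show "AE x in torus. norm ((norm (u x))\<^sup>2) \<le> C\<^sup>2"
      using assms(2) by eventually_elim (simp add: abs_le_square_iff[symmetric])
  qed (use assms(1) in simp)
qed (fact assms)

lemma L2_mult_bounded:
  fixes u b :: "'a::euclidean_space \<Rightarrow> real"
  assumes u: "L2 u" and b: "b \<in> borel_measurable torus" "AE x in torus. \<bar>b x\<bar> \<le> 1"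
  shows "L2 (\<lambda>x. b x * u x)"
  unfolding L2_def
proof
  note [measurable] = L2_measurable[OF u] b(1)
  show "(\<lambda>x. b x * u x) \<in> borel_measurable torus" by simp
  show "integrable torus (\<lambda>x. (norm (b x * u x))\<^sup>2)"
  proof (rule Bochner_Integration.integrable_bound[OF L2_integrable_sq[OF u]])
    show "AE x in torus. norm ((norm (b x * u x))\<^sup>2) \<le> norm ((norm (u x))\<^sup>2)"
      using b(2)
      by eventually_elim (simp add: abs_mult abs_le_square_iff[symmetric] mult_left_le_one_le)
  qed simp
qed

lemma L2_component:
  fixes H :: "'a::euclidean_space \<Rightarrow> real ^ 'n"
  assumes H: "in_Lp 2 cell H" and m: "(\<lambda>x. H x $ i) \<in> borel_measurable torus"
  shows "L2 (\<lambda>x. H x $ i)"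
  unfolding L2_def
proof
  have "integrable torus (\<lambda>x. (norm (H x))\<^sup>2)" using H by (simp add: in_Lp_def)
  then show "integrable torus (\<lambda>x. (norm (H x $ i))\<^sup>2)"
  proof (rule Bochner_Integration.integrable_bound)
    have "(norm (H x $ i))\<^sup>2 \<le> (norm (H x))\<^sup>2" for x
      using component_le_norm_cart[of "H x" i] by (intro power_mono) auto
    then show "AE x in torus. norm ((norm (H x $ i))\<^sup>2) \<le> norm ((norm (H x))\<^sup>2)"
      by simp
  qed (use m in simp)
qed (fact m)

lemma torus_AE_fst:
  assumes "AE x in (torus :: space measure). P x"
  shows "AE \<xi> in (torus :: phase measure). P (fst \<xi>)"
proof -
  have "AE x in lebesgue. x \<in> cell \<longrightarrow> P (x :: space)"
    using assms by (subst (asm) AE_restrict_space_iff) auto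
  from AE_fst[OF this] have "AE \<xi> :: phase in lebesgue. \<xi> \<in> cell \<longrightarrow> P (fst \<xi>)"
  proof eventually_elim
    case (elim \<xi>)
    then show ?case using mem_cell_prod[of "fst \<xi>" "snd \<xi>"] by simp
  qed
  then show ?thesis by (subst AE_restrict_space_iff) auto
qed

lemma ek_integral_cong_AE:
  assumes "u \<in> borel_measurable torus" "v \<in> borel_measurable torus" "AE x in torus. u x = v x" "k \<in> lat"
  shows "(LINT x|torus. complex_of_real (u x) * ek k x) = (LINT x|torus. complex_of_real (v x) * ek k x)"
proof (rule integral_cong_AE)
  have [measurable]: "ek k \<in> borel_measurable torus"
    using measurable_trig_torus trig_cmult_ek[OF assms(4), of 1] by simp
  note [measurable] = assms(1,2)
  show "(\<lambda>x. complex_of_real (u x) * ek k x) \<in> borel_measurable torus"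
    "(\<lambda>x. complex_of_real (v x) * ek k x) \<in> borel_measurable torus" by measurable
  show "AE x in torus. complex_of_real (u x) * ek k x = complex_of_real (v x) * ek k x"
    using assms(3) by eventually_elim simp
qed

lemma ek_integral_lincomb:
  assumes "integrable torus u" "integrable torus v" "k \<in> lat"
  shows "(LINT x|torus. complex_of_real (a * u x + b * v x) * ek k x) =
    a * (LINT x|torus. complex_of_real (u x) * ek k x) + b * (LINT x|torus. complex_of_real (v x) * ek k x)"
proof -
  have i: "integrable torus (\<lambda>x. complex_of_real (u x) * ek k x)"
    "integrable torus (\<lambda>x. complex_of_real (v x) * ek k x)"
    using integrable_mult_trig assms trig_cmult_ek[OF assms(3), of 1] by auto
  have "(LINT x|torus. complex_of_real (a * u x + b * v x) * ek k x) =
      (LINT x|torus. complex_of_real a * (complex_of_real (u x) * ek k x) +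
        complex_of_real b * (complex_of_real (v x) * ek k x))"
    by (simp add: algebra_simps)
  also have "\<dots> = complex_of_real a * (LINT x|torus. complex_of_real (u x) * ek k x) +
      complex_of_real b * (LINT x|torus. complex_of_real (v x) * ek k x)"
    using i by simp
  finally show ?thesis .
qed

lemma torus_derivD:
  "torus_deriv e u v \<Longrightarrow> k \<in> lat \<Longrightarrow> (LINT x|torus. complex_of_real (v x) * ek k x) =
     - \<i> * (k \<bullet> e) * (LINT x|torus. complex_of_real (u x) * ek k x)"
  by (auto simp: torus_deriv_def)

theorem stationary_solution_const:
  assumes De: "De > 0" and sol: "stationary_solution De f"
  shows "\<exists>c. AE \<xi> in torus. f \<xi> = c"
proof -
  define \<rho> where "\<rho> = theta_density f"
  define g where "g = (\<lambda>\<xi>. sqrt (f \<xi>))"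
  define s where "s = (\<lambda>x. sqrt (1 - \<rho> x))"
  from sol[unfolded stationary_solution_def Let_def, folded \<rho>_def, folded g_def s_def]
  obtain dg Ds W where per: "periodic f" and f3: "in_Lp 3 Upsilon f"
    and f_nn: "AE \<xi> in lebesgue. 0 \<le> f \<xi>" and \<rho>01: "AE x in lebesgue. \<rho> x \<in> {0..1}"
    and wdg: "has_weak_deriv_theta g dg" and dg2: "in_Lp 2 Upsilon dg"
    and wDs: "has_weak_grad s Ds" and Ds2: "in_Lp 2 Omega Ds"
    and wW: "has_weak_grad_x (\<lambda>\<xi>. s (fst \<xi>) * g \<xi>) W"
    and V2: "in_Lp 2 Upsilon (\<lambda>\<xi>. W \<xi> - g \<xi> *\<^sub>R Ds (fst \<xi>))"
    and eqn: "\<And>\<psi> G d. in_W1p_per 6 \<psi> G d \<Longrightarrow>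
      (LINT \<xi>:Upsilon|lebesgue. (De *\<^sub>R ((2 * s (fst \<xi>) * g \<xi>) *\<^sub>R (W \<xi> - g \<xi> *\<^sub>R Ds (fst \<xi>))
         + (- 2 * f \<xi> * s (fst \<xi>)) *\<^sub>R Ds (fst \<xi>))) \<bullet> G \<xi> + (2 * g \<xi> * dg \<xi>) * d \<xi>) = 0"
    by (auto simp: g_def s_def \<rho>_def)

  \<comment> \<open>The function \<open>sqrt\<close> is odd on the reals, so this holds also where
    \<open>f\<close> is negative. Thus g^2 is a version of \<open>f\<close> that is nonnegative
    everywhere.\<close>
  have g_sq: "(g \<xi>)\<^sup>2 = \<bar>f \<xi>\<bar>" for \<xi>
    by (simp add: g_def real_sqrt_abs2 power2_eq_square flip: real_sqrt_mult)
  have f_eq: "AE \<xi> in lebesgue. f \<xi> = (g \<xi>)\<^sup>2" using f_nn by eventually_elim (simp add: g_sq)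
  have f_eqt: "AE \<xi> in torus. f \<xi> = (g \<xi>)\<^sup>2" by (rule AE_torus[OF f_eq])
  \<comment> \<open>\<open>integrable_density_mult\<close> asks for nonnegativity at every point, so
    \<rho> is replaced by the density of g^2, equal to it almost everywhere.\<close>
  define r where "r = theta_density (\<lambda>\<xi>. (g \<xi>)\<^sup>2)"
  have r\<rho>: "AE x in lebesgue. r x = \<rho> x"
    using AE_slice[OF f_eq]
  proof eventually_elim
    case (elim x)
    then show ?case
      unfolding r_def \<rho>_def theta_density_def set_lebesgue_integral_def
      by (intro integral_cong_AE_lebesgue, eventually_elim) simp
  qed
  have rs: "AE x in torus. r x = 1 - (s x)\<^sup>2 \<and> 0 \<le> s x \<and> s x \<le> 1 \<and> 0 \<le> r x \<and> r x \<le> 1"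
  proof (rule AE_torus)
    show "AE x in lebesgue. r x = 1 - (s x)\<^sup>2 \<and> 0 \<le> s x \<and> s x \<le> 1 \<and> 0 \<le> r x \<and> r x \<le> 1"
      using r\<rho> \<rho>01 by eventually_elim (auto simp: s_def)
  qed

  have lg: "locally_integrable g" "locally_integrable dg"
    using wdg by (auto simp: has_weak_deriv_theta_def has_weak_deriv_def)
  have ls: "locally_integrable s" "locally_integrable (\<lambda>x. Ds x $ i)" for i
    using wDs by (auto simp: has_weak_grad_def has_weak_deriv_def)
  have lW: "locally_integrable (\<lambda>\<xi>. s (fst \<xi>) * g \<xi>)" "locally_integrable (\<lambda>\<xi>. W \<xi> $ i)" for i
    using wW by (auto simp: has_weak_grad_x_def has_weak_deriv_def)
  have sm: "s \<in> borel_measurable torus" "(\<lambda>\<xi> :: phase. s (fst \<xi>)) \<in> borel_measurable torus"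
    using measurable_locally_integrable[OF ls(1)] measurable_lebesgue_fst
    by (auto intro!: measurable_restrict_space1)
  have Dsm: "(\<lambda>x. Ds x $ i) \<in> borel_measurable torus"
    "(\<lambda>\<xi> :: phase. Ds (fst \<xi>) $ i) \<in> borel_measurable torus" for i
    using measurable_locally_integrable[OF ls(2), of i] measurable_lebesgue_fst
    by (auto intro!: measurable_restrict_space1)
  note meas [measurable] = sm Dsm lg[THEN measurable_locally_integrable_torus]

  have fi: "integrable torus (\<lambda>\<xi>. (g \<xi>)\<^sup>2)"
  proof -
    have "integrable torus (\<lambda>\<xi>. 1 + \<bar>f \<xi>\<bar> ^ 3)"
      using f3 by (auto simp: in_Lp_def Upsilon_eq)
    then show ?thesis
    proof (rule Bochner_Integration.integrable_bound)
      have "a \<le> 1 + a ^ 3" if "a \<ge> 0" for a :: real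
      proof (cases "a \<le> 1")
        case False
        then have "a ^ 1 \<le> a ^ 3" by (intro power_increasing) auto
        then show ?thesis by simp
      next
        case True
        moreover have "0 \<le> a ^ 3" using that by simp
        ultimately show ?thesis by linarith
      qed
      then show "AE \<xi> in torus. norm ((g \<xi>)\<^sup>2) \<le> norm (1 + \<bar>f \<xi>\<bar> ^ 3)"
        by (intro AE_I2) (auto simp: g_sq)
    qed simp
  qed
  have g2: "L2 g" using fi by (auto simp: L2_def)
  have dg2': "L2 dg" using dg2 by (auto simp: in_Lp_def L2_def Upsilon_eq)
  have s_le: "AE x in torus. \<bar>s x\<bar> \<le> 1" "AE x in torus. \<bar>(s x)\<^sup>2\<bar> \<le> 1"
    using rs by (eventually_elim, simp add: power_le_one)+
  have s2: "L2 s" by (rule L2_AE_bounded[OF sm(1) s_le(1)])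
  have Ds2': "L2 (\<lambda>x. Ds x $ i)" for i
    using Ds2 by (intro L2_component) (auto simp: Omega_eq)
  have ri: "integrable torus r"
    using fubini_torus(2)[OF fi] by (simp add: r_def theta_density_eq[abs_def])
  note [measurable] = borel_measurable_integrable[OF ri]

  text \<open>This is where the bound \<open>\<rho> \<le> 1\<close> enters: \<open>g \<nabla>s\<close> is square integrable because
    integrating \<open>g\<^sup>2 = f\<close> over the angle first gives \<open>\<rho>\<close>.\<close>
  have gDs2: "L2 (\<lambda>\<xi>. g \<xi> * Ds (fst \<xi>) $ i)" for i
    unfolding L2_def
  proof
    have "integrable torus (\<lambda>x. r x * (Ds x $ i)\<^sup>2)"
    proof (rule Bochner_Integration.integrable_bound[OF L2_integrable_sq[OF Ds2'[of i]]])
      show "AE x in torus. norm (r x * (Ds x $ i)\<^sup>2) \<le> norm ((norm (Ds x $ i))\<^sup>2)"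
        using rs by eventually_elim (auto simp: abs_mult mult_left_le_one_le)
    qed simp
    then have "integrable torus (\<lambda>\<xi>. (g \<xi>)\<^sup>2 * (Ds (fst \<xi>) $ i)\<^sup>2)"
      using measurable_locally_integrable[OF ls(2), of i]
      by (intro integrable_density_mult[where h = "\<lambda>x. (Ds x $ i)\<^sup>2"] fi) (auto simp: r_def)
    then show "integrable torus (\<lambda>\<xi>. (norm (g \<xi> * Ds (fst \<xi>) $ i))\<^sup>2)"
      by (simp add: power_mult_distrib)
  qed simp
  have Wm: "(\<lambda>\<xi>. W \<xi> $ i) \<in> borel_measurable torus" for i
    by (rule measurable_locally_integrable_torus[OF lW(2)])
  \<comment> \<open>The solution concept bounds only V; adding g \<nabla>s recovers the gradient of
    s g, which the chain rule for (s g)^2 needs in L2.\<close>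
  have W2: "L2 (\<lambda>\<xi>. W \<xi> $ i)" for i
  proof -
    have "L2 (\<lambda>\<xi>. (W \<xi> - g \<xi> *\<^sub>R Ds (fst \<xi>)) $ i)"
      using V2 Wm by (intro L2_component) (auto simp: Upsilon_eq)
    from L2_add[OF this gDs2[of i]] show ?thesis by simp
  qed
  have sg2: "L2 (\<lambda>\<xi>. s (fst \<xi>) * g \<xi>)"
    by (rule L2_mult_bounded[OF g2 sm(2) torus_AE_fst[OF s_le(1)]])

  have per_g: "periodic g"
    using per by (auto simp: periodic_def g_def elim!: eventually_mono)
  have per_s: "periodic s"
    using periodic_density[OF per] by (auto simp: periodic_def s_def \<rho>_def elim!: eventually_mono)
  have per_sg: "periodic (\<lambda>\<xi>. s (fst \<xi>) * g \<xi>)"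
    unfolding periodic_def
  proof
    fix b :: phase assume b: "b \<in> Basis"
    have "AE \<xi> in lebesgue. g (\<xi> + (2 * pi) *\<^sub>R b) = g \<xi>" using per_g b by (simp add: periodic_def)
    moreover have "AE \<xi> :: phase in lebesgue. s (fst \<xi> + (2 * pi) *\<^sub>R fst b) = s (fst \<xi>)"
    proof (cases "fst b = 0")
      case False
      then have "fst b \<in> Basis" using b by (auto simp: Basis_prod_def)
      then have "AE x in lebesgue. s (x + (2 * pi) *\<^sub>R fst b) = s x" using per_s by (simp add: periodic_def)
      then show ?thesis by (rule AE_fst)
    qed simp
    ultimately show "AE \<xi> in lebesgue. s (fst (\<xi> + (2 * pi) *\<^sub>R b)) * g (\<xi> + (2 * pi) *\<^sub>R b) = s (fst \<xi>) * g \<xi>"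
      by eventually_elim simp
  qed

  have ax: "axis i 1 \<in> (Basis :: space set)" "(axis i 1, 0) \<in> (Basis :: phase set)"
    "(0, 1) \<in> (Basis :: phase set)" for i :: 2
    by (auto simp: Basis_prod_def Basis_vec_def)
  have td_g: "torus_deriv (0, 1) (\<lambda>\<xi>. (g \<xi>)\<^sup>2) (\<lambda>\<xi>. 2 * g \<xi> * dg \<xi>)"
    using wdg by (intro torus_deriv_square[OF g2 dg2'] weak_deriv_torus[OF per_g _ ax(3)])
      (simp add: has_weak_deriv_theta_def)
  have td_s: "torus_deriv (axis i 1) s (\<lambda>x. Ds x $ i)" for i
    using wDs by (intro weak_deriv_torus[OF per_s _ ax(1)]) (simp add: has_weak_grad_def)
  have td_s2: "torus_deriv (axis i 1) (\<lambda>x. (s x)\<^sup>2) (\<lambda>x. 2 * s x * Ds x $ i)" for i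
    by (rule torus_deriv_square[OF s2 Ds2' td_s])
  have s22: "L2 (\<lambda>x. (s x)\<^sup>2)"
    by (rule L2_AE_bounded[OF _ s_le(2)]) simp
  have sDs2: "L2 (\<lambda>x. s x * Ds x $ i)" for i
    by (rule L2_mult_bounded[OF Ds2' sm(1) s_le(1)])
  then have sDs2': "L2 (\<lambda>x. 2 * s x * Ds x $ i)" for i
    using L2_scaleR[OF sDs2[of i], of 2] by (simp add: mult.assoc)
  \<comment> \<open>The square rule is iterated because f s^2, integrated over the angle, is (1 -
    s^2) s^2.\<close>
  have td_s4: "torus_deriv (axis i 1) (\<lambda>x. ((s x)\<^sup>2)\<^sup>2) (\<lambda>x. 2 * (s x)\<^sup>2 * (2 * s x * Ds x $ i))" for i
    by (rule torus_deriv_square[OF s22 sDs2' td_s2])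
  have td_sg: "torus_deriv (axis i 1, 0) (\<lambda>\<xi>. (s (fst \<xi>) * g \<xi>)\<^sup>2)
      (\<lambda>\<xi>. 2 * (s (fst \<xi>) * g \<xi>) * W \<xi> $ i)" for i
    using wW by (intro torus_deriv_square[OF sg2 W2] weak_deriv_torus[OF per_sg _ ax(2)])
      (simp add: has_weak_grad_x_def)

  \<comment> \<open>With V = W - g \<nabla>s the x-flux 2 s g V - 2 f s \<nabla>s is A - 4 B, where
    A is the gradient of (s g)^2 and B is f s \<nabla>s; the gradient of g alone does not
    occur.\<close>
  define A where "A i \<xi> = 2 * (s (fst \<xi>) * g \<xi>) * W \<xi> $ i" for i \<xi>
  define B where "B i \<xi> = (g \<xi>)\<^sup>2 * (s (fst \<xi>) * Ds (fst \<xi>) $ i)" for i \<xi>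
  define E where "E \<xi> = 2 * g \<xi> * dg \<xi>" for \<xi>
  have Ai: "integrable torus (A i)" for i
    using integrable_mult_right[OF integrable_mult_L2[OF sg2 W2[of i]], of 2]
    unfolding A_def by (simp add: mult.assoc)
  have Bi: "integrable torus (B i)" for i
    using integrable_mult_L2[OF sg2 gDs2[of i]]
    unfolding B_def by (simp add: power2_eq_square mult_ac)
  have Ei: "integrable torus E"
    using integrable_mult_right[OF integrable_mult_L2[OF g2 dg2'], of 2]
    unfolding E_def by (simp add: mult.assoc)
  define J :: "(phase \<Rightarrow> real) \<Rightarrow> phase \<Rightarrow> complex" where
    "J u k = (LINT \<xi>|torus. complex_of_real (u \<xi>) * ek k \<xi>)" for u k
  define K :: "(space \<Rightarrow> real) \<Rightarrow> space \<Rightarrow> complex" where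
    "K u k = (LINT x|torus. complex_of_real (u x) * ek k x)" for u k
  have eqn_J: "complex_of_real De * (\<Sum>i\<in>UNIV. complex_of_real (fst k $ i) * (J (A i) k - 4 * J (B i) k)) + complex_of_real (snd k) * J E k = 0"
    if k: "k \<in> lat" for k
  proof -
    define P where "P \<xi> = De * (\<Sum>i\<in>UNIV. fst k $ i * (A i \<xi> - 4 * B i \<xi>)) + snd k * E \<xi>" for \<xi>
    have Pi: "integrable torus P"
      unfolding P_def using Ai Bi Ei by auto
    have P0: "(LINT \<xi>|torus. P \<xi> * cos (k \<bullet> \<xi> + (c + pi / 2))) = 0" for c
    proof -
      let ?I = "\<lambda>\<xi>. (De *\<^sub>R ((2 * s (fst \<xi>) * g \<xi>) *\<^sub>R (W \<xi> - g \<xi> *\<^sub>R Ds (fst \<xi>))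
         + (- 2 * f \<xi> * s (fst \<xi>)) *\<^sub>R Ds (fst \<xi>))) \<bullet> (cos (k \<bullet> \<xi> + (c + pi / 2)) *\<^sub>R fst k)
         + (2 * g \<xi> * dg \<xi>) * (snd k * cos (k \<bullet> \<xi> + (c + pi / 2)))"
      have "AE \<xi> in lebesgue. indicator cell \<xi> *\<^sub>R ?I \<xi> = indicator cell \<xi> *\<^sub>R (P \<xi> * cos (k \<bullet> \<xi> + (c + pi / 2)))"
        using f_eq
      proof eventually_elim
        case (elim \<xi>)
        have "?I \<xi> = P \<xi> * cos (k \<bullet> \<xi> + (c + pi / 2))"
          unfolding elim P_def A_def B_def E_def inner_vec_def sum_2
          by (simp add: algebra_simps power2_eq_square)
        then show ?case by simp
      qed
      from integral_cong_AE_lebesgue(1)[OF this] eqn[OF in_W1p_per_cos[OF k, of 6 c]]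
      show ?thesis
        unfolding torus_integral_eq set_lebesgue_integral_def Upsilon_eq by (simp only:)
    qed
    \<comment> \<open>Differentiating the test cosine advanced its phase by pi/2; the values -pi/2
      and -pi of \<open>c\<close> compensate and give the real and imaginary parts.\<close>
    have "(LINT \<xi>|torus. complex_of_real (P \<xi>) * ek k \<xi>) = 0"
      unfolding integral_ek_conv_cos(1)[OF Pi k] using P0[of "- (pi / 2)"] P0[of "- pi"]
      by (simp add: algebra_simps)
    moreover have "(LINT \<xi>|torus. complex_of_real (P \<xi>) * ek k \<xi>) =
        complex_of_real De * (\<Sum>i\<in>UNIV. complex_of_real (fst k $ i) * (J (A i) k - 4 * J (B i) k)) + complex_of_real (snd k) * J E k"
    proof -
      have e: "P \<xi> = De * (\<Sum>i\<in>UNIV. fst k $ i * (1 * A i \<xi> + (- 4) * B i \<xi>)) + snd k * E \<xi>" for \<xi>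
        by (simp add: P_def)
      have i1: "integrable torus (\<lambda>\<xi>. 1 * A i \<xi> + (- 4) * B i \<xi>)" for i using Ai Bi by auto
      have i2: "integrable torus (\<lambda>\<xi>. fst k $ 1 * (1 * A 1 \<xi> + (- 4) * B 1 \<xi>) + fst k $ 2 * (1 * A 2 \<xi> + (- 4) * B 2 \<xi>))"
        using Ai Bi by auto
      show ?thesis
        unfolding e sum_2 J_def
        by (subst ek_integral_lincomb[OF i2 Ei k], subst ek_integral_lincomb[OF i1 i1 k],
            subst (1 2) ek_integral_lincomb[OF Ai Bi k]) simp
    qed
    ultimately show ?thesis by simp
  qed
  have JA: "J (A i) k = - \<i> * (fst k $ i) * J (\<lambda>\<xi>. (s (fst \<xi>) * g \<xi>)\<^sup>2) k" if "k \<in> lat" for i k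
    using torus_derivD[OF td_sg that, of i] unfolding J_def A_def
    by (simp add: inner_prod_def inner_axis)
  have JE: "J E k = - \<i> * complex_of_real (snd k) * J (\<lambda>\<xi>. (g \<xi>)\<^sup>2) k" if "k \<in> lat" for k
    using torus_derivD[OF td_g that] unfolding J_def E_def
    by (simp add: inner_prod_def)
  have sg_eq: "(s (fst \<xi>) * g \<xi>)\<^sup>2 = (g \<xi>)\<^sup>2 * (s (fst \<xi>))\<^sup>2" for \<xi>
    by (simp add: power_mult_distrib)
  have sgi: "integrable torus (\<lambda>\<xi>. (g \<xi>)\<^sup>2 * (s (fst \<xi>))\<^sup>2)"
    using L2_integrable_sq[OF sg2] by (simp add: power_mult_distrib mult.commute)

  text \<open>Testing with functions of \<open>x\<close> alone eliminates the angle: the flux collapses to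
    \<open>-2 s \<nabla>s = \<nabla>\<rho>\<close>, so \<open>\<rho>\<close> is harmonic on the torus.\<close>
  have K_s2: "K (\<lambda>x. (s x)\<^sup>2) \<kappa> = 0" if \<kappa>: "\<kappa> \<in> lat" "\<kappa> \<noteq> 0" for \<kappa>
  proof -
    let ?k = "(\<kappa>, 0) :: phase"
    let ?S2 = "K (\<lambda>x. (s x)\<^sup>2) \<kappa>" and ?S4 = "K (\<lambda>x. ((s x)\<^sup>2)\<^sup>2) \<kappa>"
    have k: "?k \<in> lat" by (rule lat_Pair_0[OF \<kappa>(1)])
    note si = L2_integrable[OF s22] and s4i = integrable_mult_L2[OF s22 s22, folded power2_eq_square]
    have 1: "J (\<lambda>\<xi>. (s (fst \<xi>) * g \<xi>)\<^sup>2) ?k = ?S2 - ?S4"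
    proof -
      have "J (\<lambda>\<xi>. (s (fst \<xi>) * g \<xi>)\<^sup>2) ?k = K (\<lambda>x. r x * (s x)\<^sup>2) \<kappa>"
        unfolding J_def K_def sg_eq r_def by (rule fubini_ek[OF sgi \<kappa>(1)])
      also have "\<dots> = K (\<lambda>x. 1 * (s x)\<^sup>2 + (- 1) * ((s x)\<^sup>2)\<^sup>2) \<kappa>"
        unfolding K_def
      proof (rule ek_integral_cong_AE[OF _ _ _ \<kappa>(1)])
        show "AE x in torus. r x * (s x)\<^sup>2 = 1 * (s x)\<^sup>2 + (- 1) * ((s x)\<^sup>2)\<^sup>2"
          using rs
        proof eventually_elim
          case (elim x)
          then have eq: "r x = 1 - (s x)\<^sup>2" by simp
          show ?case unfolding eq by (simp add: algebra_simps power2_eq_square)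
        qed
      qed simp_all
      also have "\<dots> = ?S2 - ?S4"
        unfolding K_def by (subst ek_integral_lincomb[OF si s4i \<kappa>(1)]) simp
      finally show ?thesis .
    qed
    \<comment> \<open>Here f has become 1 - s^2, and 4 (1 - s^2) s \<nabla>s is the gradient of 2
      s^2 - s^4. In terms of \<open>?D2\<close> and \<open>?D4\<close> the product (1 - s^2) s
      \<nabla>s has the coefficients 1/2 and -1/4.\<close>
    have 2: "4 * J (B i) ?k = - \<i> * (\<kappa> $ i) * (2 * ?S2 - ?S4)" for i
    proof -
      let ?D2 = "\<lambda>x. 2 * s x * Ds x $ i" and ?D4 = "\<lambda>x. 2 * (s x)\<^sup>2 * (2 * s x * Ds x $ i)"
      have D4i: "integrable torus ?D4"
        using integrable_mult_right[OF integrable_mult_L2[OF s22 sDs2'[of i]], of 2] by (simp add: mult.assoc)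
      have "J (B i) ?k = K (\<lambda>x. r x * (s x * Ds x $ i)) \<kappa>"
        using Bi[of i] unfolding J_def K_def B_def r_def
        by (intro fubini_ek[where h = "\<lambda>x. s x * Ds x $ i"] \<kappa>(1))
      also have "\<dots> = K (\<lambda>x. (1/2) * ?D2 x + (- (1/4)) * ?D4 x) \<kappa>"
        unfolding K_def
      proof (rule ek_integral_cong_AE[OF _ _ _ \<kappa>(1)])
        show "AE x in torus. r x * (s x * Ds x $ i) = (1/2) * ?D2 x + (- (1/4)) * ?D4 x"
          using rs
        proof eventually_elim
          case (elim x)
          then have eq: "r x = 1 - (s x)\<^sup>2" by simp
          show ?case unfolding eq by (simp add: algebra_simps power2_eq_square)
        qed
      qed simp_all
      also have "\<dots> = (1/2) * K ?D2 \<kappa> - (1/4) * K ?D4 \<kappa>"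
        unfolding K_def by (subst ek_integral_lincomb[OF L2_integrable[OF sDs2'] D4i \<kappa>(1)]) simp
      also have "K ?D2 \<kappa> = - \<i> * (\<kappa> $ i) * ?S2"
        using torus_derivD[OF td_s2 \<kappa>(1), of i] by (simp add: K_def inner_axis)
      also have "K ?D4 \<kappa> = - \<i> * (\<kappa> $ i) * ?S4"
        using torus_derivD[OF td_s4 \<kappa>(1), of i] by (simp add: K_def inner_axis)
      finally show ?thesis by (simp add: algebra_simps)
    qed
    \<comment> \<open>The quartic terms cancel: (s^2 - s^4) - (2 s^2 - s^4) = -s^2.\<close>
    have t: "J (A i) ?k - 4 * J (B i) ?k = \<i> * (\<kappa> $ i) * ?S2" for i
      unfolding 2 JA[OF k] 1 by (simp add: algebra_simps)
    have "complex_of_real De * (\<Sum>i\<in>UNIV. complex_of_real (\<kappa> $ i) * (\<i> * complex_of_real (\<kappa> $ i) * ?S2)) = 0"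
      using eqn_J[OF k] unfolding t by simp
    then have "complex_of_real De * \<i> * complex_of_real (\<kappa> \<bullet> \<kappa>) * ?S2 = 0"
      by (simp add: inner_vec_def sum_2 algebra_simps)
    then show ?thesis using De \<kappa>(2) by simp
  qed
  then obtain c where c: "AE x in torus. (s x)\<^sup>2 = c"
    using fourier_const[OF L2_integrable[OF s22]] unfolding K_def by blast
  have s_const: "AE x in torus. s x = sqrt c"
    using c rs by eventually_elim auto
  \<comment> \<open>The constant is known only through an almost everywhere identity, so its sign is
    read off an integral over a cell of positive measure. It is the diffusion coefficient in x, up
    to \<open>De\<close>, in the final step.\<close>
  have "0 \<le> (LINT x|torus. (s x)\<^sup>2)" by simp
  also have "\<dots> = (LINT x|(torus :: space measure). c)"
    by (rule integral_cong_AE) (simp_all add: c)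
  also have "\<dots> = vol TYPE(space) * c" by (simp add: vol_def)
  finally have c0: "c \<ge> 0" using vol_pos[where 'a = space] by (simp add: zero_le_mult_iff)
  \<comment> \<open>Constancy of s forces its weak gradient to vanish almost everywhere, which
    removes the terms \<open>B\<close> from the equation.\<close>
  have Ds0: "AE x in torus. Ds x $ i = 0" for i
  proof (rule fourier_uniqueness[OF L2_integrable[OF Ds2']])
    fix k :: space assume k: "k \<in> lat"
    have "K s k = K (\<lambda>x. sqrt c) k"
      unfolding K_def by (rule ek_integral_cong_AE[OF _ _ s_const k]) simp_all
    also have "\<dots> = sqrt c * (LINT x|torus. ek k x)" by (simp add: K_def)
    finally have "k = 0 \<or> K s k = 0" using ek_orth[OF k] by auto
    then show "(LINT x|torus. complex_of_real (Ds x $ i) * ek k x) = 0"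
      using torus_derivD[OF td_s k, of i] by (auto simp: K_def)
  qed
  have "J (\<lambda>\<xi>. (g \<xi>)\<^sup>2) k = 0" if k: "k \<in> lat" "k \<noteq> 0" for k
  proof (cases "snd k = 0")
    case True
    obtain \<kappa> where \<kappa>: "k = (\<kappa>, 0)" using True by (cases k) auto
    have \<kappa>l: "\<kappa> \<in> lat" "\<kappa> \<noteq> 0" using lat_fst[OF k(1)] k(2) by (auto simp: \<kappa> zero_prod_def)
    have "J (\<lambda>\<xi>. (g \<xi>)\<^sup>2) k = K r \<kappa>"
      using fubini_ek[of "\<lambda>\<xi>. (g \<xi>)\<^sup>2" "\<lambda>_. 1" \<kappa>] fi \<kappa>l(1) by (simp add: J_def K_def r_def \<kappa>)
    also have "\<dots> = K (\<lambda>x. 1 - c) \<kappa>"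
      unfolding K_def
    proof (rule ek_integral_cong_AE[OF _ _ _ \<kappa>l(1)])
      show "AE x in torus. r x = 1 - c" using rs c by eventually_elim simp
    qed simp_all
    also have "\<dots> = 0" using ek_orth[OF \<kappa>l] by (simp add: K_def)
    finally show ?thesis .
  next
    case False
    have B0: "J (B i) k = 0" for i
    proof -
      have "J (B i) k = (LINT \<xi>|torus. complex_of_real ((\<lambda>_. 0) \<xi>) * ek k \<xi>)"
        unfolding J_def
      proof (rule ek_integral_cong_AE[OF borel_measurable_integrable[OF Bi] _ _ k(1)])
        show "AE \<xi> in torus. B i \<xi> = 0"
          using torus_AE_fst[OF Ds0[of i]] by eventually_elim (simp add: B_def)
      qed simp
      then show ?thesis by simp
    qed
    have S: "J (\<lambda>\<xi>. (s (fst \<xi>) * g \<xi>)\<^sup>2) k = c * J (\<lambda>\<xi>. (g \<xi>)\<^sup>2) k"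
    proof -
      \<comment> \<open>The zero summand gives the expression the shape of
        \<open>ek_integral_lincomb\<close>.\<close>
      have "J (\<lambda>\<xi>. (s (fst \<xi>) * g \<xi>)\<^sup>2) k = J (\<lambda>\<xi>. c * (g \<xi>)\<^sup>2 + 0 * (g \<xi>)\<^sup>2) k"
        unfolding J_def
      proof (rule ek_integral_cong_AE[OF _ _ _ k(1)])
        show "AE \<xi> in torus. (s (fst \<xi>) * g \<xi>)\<^sup>2 = c * (g \<xi>)\<^sup>2 + 0 * (g \<xi>)\<^sup>2"
          using torus_AE_fst[OF c] by eventually_elim (simp add: power_mult_distrib)
      qed simp_all
      also have "\<dots> = c * J (\<lambda>\<xi>. (g \<xi>)\<^sup>2) k"
        unfolding J_def by (subst ek_integral_lincomb[OF fi fi k(1)]) simp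
      finally show ?thesis .
    qed
    let ?Z = "J (\<lambda>\<xi>. (g \<xi>)\<^sup>2) k"
    have "complex_of_real De * (\<Sum>i\<in>UNIV. complex_of_real (fst k $ i) * (- \<i> * complex_of_real (fst k $ i) * (c * ?Z))) + complex_of_real (snd k) * (- \<i> * complex_of_real (snd k) * ?Z) = 0"
      using eqn_J[OF k(1)] unfolding JA[OF k(1)] JE[OF k(1)] B0 S by simp
    then have "- \<i> * complex_of_real (De * c * (fst k \<bullet> fst k) + (snd k)\<^sup>2) * ?Z = 0"
      by (simp add: inner_vec_def sum_2 algebra_simps power2_eq_square)
    moreover have "De * c * (fst k \<bullet> fst k) + (snd k)\<^sup>2 > 0"
      using De c0 False by (intro add_nonneg_pos) auto
    ultimately show ?thesis by (metis complex_i_not_zero less_irrefl mult_eq_0_iff neg_equal_0_iff_equal of_real_eq_0_iff)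
  qed
  then obtain C where "AE \<xi> in torus. (g \<xi>)\<^sup>2 = C"
    using fourier_const[OF fi] unfolding J_def by blast
  then have "AE \<xi> in torus. f \<xi> = C" using f_eqt by eventually_elim simp
  then show ?thesis by blast
qed

section \<open>The mass determines the constant\<close>

lemma mass_const:
  assumes "AE \<xi> in torus. f \<xi> = c"
  shows "mass f = c * vol TYPE(phase)"
proof -
  have "AE \<xi> in lebesgue. indicator cell \<xi> *\<^sub>R f \<xi> = indicator cell \<xi> *\<^sub>R c"
  proof -
    have "AE \<xi> in lebesgue. \<xi> \<in> cell \<longrightarrow> f \<xi> = c"
      using assms by (subst (asm) AE_restrict_space_iff) auto
    then show ?thesis by eventually_elim (auto simp: indicator_def)
  qed
  from integral_cong_AE_lebesgue(1)[OF this]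
  have "mass f = (LINT \<xi>|(torus :: phase measure). c)"
    unfolding mass_def set_lebesgue_integral_def Upsilon_eq torus_integral_eq by (simp only:)
  then show ?thesis by (simp add: vol_def)
qed

theorem theorem3:
  fixes De m :: real and f\<^sub>1 f\<^sub>2 :: "phase \<Rightarrow> real"
  assumes "De > 0" and "m > 0"
    and "stationary_solution De f\<^sub>1" and "mass f\<^sub>1 = m"
    and "stationary_solution De f\<^sub>2" and "mass f\<^sub>2 = m"
  shows "AE \<xi> in lebesgue_on Upsilon. f\<^sub>1 \<xi> = f\<^sub>2 \<xi>"
proof -
  obtain c\<^sub>1 where c1: "AE \<xi> in torus. f\<^sub>1 \<xi> = c\<^sub>1"
    using stationary_solution_const[OF assms(1,3)] by blast
  obtain c\<^sub>2 where c2: "AE \<xi> in torus. f\<^sub>2 \<xi> = c\<^sub>2"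
    using stationary_solution_const[OF assms(1,5)] by blast
  have "c\<^sub>1 = c\<^sub>2"
    using mass_const[OF c1] mass_const[OF c2] assms(4,6) vol_pos[where 'a = phase] by simp
  from c1 c2 show ?thesis unfolding Upsilon_eq by eventually_elim (simp add: \<open>c\<^sub>1 = c\<^sub>2\<close>)
qed

end
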